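(* Suppose that, for some constants $\gamma,\varepsilon>0$, there is a data structure for the dynamic $k$-mismatch problem that solves instances satisfying $k=2\lfloor (n/m)^\gamma\rfloor$, with preprocessing in $\mathcal{O}(n^{\mathcal{O}(1)})$ time, updates of the pattern in $\mathcal{O}((n/m)^{1-\varepsilon})$ time, and queries in $\mathcal{O}(k^{1-\varepsilon})$ time, providing correct answers with high probability. Then the OMv conjecture fails.
   Context: For strings $S,R$ of equal length, $\operatorname{HD}(S,R)=|\{i : S[i]\neq R[i]\}|$; strings are 0-indexed and $S[a\mathinner{.\,.} b)=S[a]\cdots S[b-1]$. Here the dynamic $k$-mismatch problem is considered for a pattern $P$ of length $m$ and a text $T$ of length $n\ge m$ (possibly much longer than $m$), with threshold $k$: a query $\mathrm{Query}(i)$, $i\in[0\mathinner{.\,.} n-m]$, returns $\operatorname{HD}(T[i\mathinner{.\,.} i+m),P)$ if it is at most $k$ and $\infty$ otherwise; an update of the pattern $\mathrm{Update}(P,i,x)$ sets $P[i]:=x$. Online Boolean Matrix-Vector Multiplication (OMv): given a Boolean matrix $M\in\{0,1\}^{n\times n}$, a sequence of $n$ vectors $v_1,\dots,v_n\in\{0,1\}^n$ arrives online, and for each $v_i$ the algorithm must output the Boolean product $Mv_i$ before receiving $v_{i+1}$. The OMv conjecture states that for every constant $\epsilon>0$ there is no $\mathcal{O}(n^{3-\epsilon})$-time algorithm solving OMv correctly with probability at least $\frac23$; "the OMv conjecture fails" means such an algorithm exists for some constant $\epsilon>0$. *)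

theory Defs
  imports "HOL-Probability.Probability" "HOL-Library.Extended_Nat"
begin

section \<open>A randomized word RAM\<close>

text \<open>
  All running times refer to a unit-cost word RAM whose programs are deeply embedded, so that a
  program is a finite object that does not depend on the input. It has registers and an
  indirectly addressed memory; both hold natural numbers smaller than a word bound \<open>W\<close>. For an
  input of size \<open>n\<close> the bound will always be \<open>(n + 2) ^ d\<close> with a constant \<open>d\<close>, i.e. machine words
  have \<open>O(log n)\<close> bits. An instruction whose result is not a word crashes the machine (instead
  of wrapping around); this is no restriction, since a constant factor in the word length
  suffices to compute modulo the original bound.
\<close>

unbundle bit_operations_syntax

datatype binop = Add | Sub | Mul | Div | Mod | BitAnd | BitOr | BitXor | Shl | Shr | Less | Eq

fun eval_binop :: "binop \<Rightarrow> nat \<Rightarrow> nat \<Rightarrow> nat" where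
  "eval_binop Add x y = x + y"
| "eval_binop Sub x y = x - y"
| "eval_binop Mul x y = x * y"
| "eval_binop Div x y = x div y"
| "eval_binop Mod x y = x mod y"
| "eval_binop BitAnd x y = x AND y"
| "eval_binop BitOr x y = x OR y"
| "eval_binop BitXor x y = x XOR y"
| "eval_binop Shl x y = push_bit y x"
| "eval_binop Shr x y = drop_bit y x"
| "eval_binop Less x y = of_bool (x < y)"
| "eval_binop Eq x y = of_bool (x = y)"

text \<open>Every argument of type \<^typ>\<open>nat\<close> names a register, except for the second one of \<open>Const\<close>.\<close>

datatype com =
    Skip
  | Const nat nat
  | Op binop nat nat nat
  | Load nat nat
  | Store nat nat
  | Rand nat nat
  | Seq com com
  | IfNZ nat com com
  | WhileNZ nat com

record state =
  regs :: "nat \<Rightarrow> nat"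
  mem  :: "nat \<Rightarrow> nat"

abbreviation crash :: "'a spmf" where
  "crash \<equiv> return_pmf None"

definition set_reg :: "nat \<Rightarrow> nat \<Rightarrow> nat \<Rightarrow> state \<Rightarrow> state spmf" where
  "set_reg W r v s = (if v < W then return_spmf (s\<lparr>regs := (regs s)(r := v)\<rparr>) else crash)"

text \<open>
  A single step executes the first command of a stack of pending commands. \<open>Rand r x\<close> draws a
  number uniformly below the contents of \<open>x\<close>, independently of all previous draws.
\<close>

fun step :: "nat \<Rightarrow> com \<Rightarrow> com list \<Rightarrow> state \<Rightarrow> (com list \<times> state) spmf" where
  "step W Skip K s = return_spmf (K, s)"
| "step W (Const r v) K s = map_spmf (Pair K) (set_reg W r v s)"
| "step W (Op f r x y) K s =
     map_spmf (Pair K) (set_reg W r (eval_binop f (regs s x) (regs s y)) s)"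
| "step W (Load r x) K s = map_spmf (Pair K) (set_reg W r (mem s (regs s x)) s)"
| "step W (Store x y) K s = return_spmf (K, s\<lparr>mem := (mem s)(regs s x := regs s y)\<rparr>)"
| "step W (Rand r x) K s =
     (if regs s x = 0 then crash
      else bind_spmf (spmf_of_set {..<regs s x}) (\<lambda>v. map_spmf (Pair K) (set_reg W r v s)))"
| "step W (Seq c1 c2) K s = return_spmf (c1 # c2 # K, s)"
| "step W (IfNZ x c1 c2) K s = return_spmf ((if regs s x \<noteq> 0 then c1 else c2) # K, s)"
| "step W (WhileNZ x c) K s = return_spmf (if regs s x \<noteq> 0 then c # WhileNZ x c # K else K, s)"

text \<open>
  \<open>run W t\<close> executes at most \<open>t\<close> steps and returns the final state with the number of unused
  steps. Probability mass is lost exactly by crashing or by exceeding the time budget, so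
  that \<^const>\<open>lossless_spmf\<close> expresses a worst-case bound on the running time.
\<close>

fun run :: "nat \<Rightarrow> nat \<Rightarrow> com list \<times> state \<Rightarrow> (state \<times> nat) spmf" where
  "run W t ([], s) = return_spmf (s, t)"
| "run W 0 (c # K, s) = crash"
| "run W (Suc t) (c # K, s) = bind_spmf (step W c K s) (run W t)"

definition exec :: "nat \<Rightarrow> nat \<Rightarrow> com \<Rightarrow> state \<Rightarrow> state spmf" where
  "exec W t c s = map_spmf fst (run W t ([c], s))"


section \<open>The dynamic k-mismatch problem\<close>

text \<open>Meaningful only for strings of equal length.\<close>

definition hamming_distance :: "nat list \<Rightarrow> nat list \<Rightarrow> nat" where
  "hamming_distance S R = card {i. i < length S \<and> S ! i \<noteq> R ! i}"

definition k_mismatch_query :: "nat \<Rightarrow> nat list \<Rightarrow> nat list \<Rightarrow> nat \<Rightarrow> enat" where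
  "k_mismatch_query k T P i =
     (let h = hamming_distance (take (length P) (drop i T)) P
      in if h \<le> k then enat h else \<infinity>)"

datatype operation = Update nat nat | Query nat

fun valid_operation :: "nat \<Rightarrow> nat \<Rightarrow> nat \<Rightarrow> operation \<Rightarrow> bool" where
  "valid_operation \<sigma> n m (Update i x) \<longleftrightarrow> i < m \<and> x < \<sigma>"
| "valid_operation \<sigma> n m (Query i) \<longleftrightarrow> i \<le> n - m"

fun correct_answers :: "nat \<Rightarrow> nat list \<Rightarrow> nat list \<Rightarrow> operation list \<Rightarrow> enat list" where
  "correct_answers k T P [] = []"
| "correct_answers k T P (Update i x # ops) = correct_answers k T (P[i := x]) ops"
| "correct_answers k T P (Query i # ops) = k_mismatch_query k T P i # correct_answers k T P ops"

text \<open>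
  A data structure consists of three programs. Preprocessing starts with \<open>n\<close> and \<open>m\<close> in registers
  0 and 1 and with the pattern followed by the text in memory. The entire state persists between
  operations, except that the arguments of an operation are passed in registers 0 and 1; the
  answer to a query is returned in register 0.
\<close>

definition ds_input :: "nat list \<Rightarrow> nat list \<Rightarrow> state" where
  "ds_input T P =
     \<lparr>regs = (\<lambda>_. 0)(0 := length T, 1 := length P),
      mem = (\<lambda>a. if a < length (P @ T) then (P @ T) ! a else 0)\<rparr>"

fun decode_answer :: "nat \<Rightarrow> enat" where
  "decode_answer 0 = \<infinity>"
| "decode_answer (Suc h) = enat h"

fun run_operations ::
  "nat \<Rightarrow> nat \<Rightarrow> nat \<Rightarrow> com \<Rightarrow> com \<Rightarrow> operation list \<Rightarrow> state \<Rightarrow> enat list spmf" where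
  "run_operations W tu tq upd qry [] s = return_spmf []"
| "run_operations W tu tq upd qry (Update i x # ops) s =
     bind_spmf (exec W tu upd (s\<lparr>regs := (regs s)(0 := i, 1 := x)\<rparr>))
       (run_operations W tu tq upd qry ops)"
| "run_operations W tu tq upd qry (Query i # ops) s =
     bind_spmf (exec W tq qry (s\<lparr>regs := (regs s)(0 := i)\<rparr>))
       (\<lambda>s'. map_spmf ((#) (decode_answer (regs s' 0)))
               (run_operations W tu tq upd qry ops s'))"

definition run_ds ::
  "nat \<Rightarrow> nat \<Rightarrow> nat \<Rightarrow> nat \<Rightarrow> com \<Rightarrow> com \<Rightarrow> com \<Rightarrow> nat list \<Rightarrow> nat list \<Rightarrow> operation list
    \<Rightarrow> enat list spmf" where
  "run_ds W tp tu tq pre upd qry T P ops =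
     bind_spmf (exec W tp pre (ds_input T P)) (run_operations W tu tq upd qry ops)"

definition threshold :: "real \<Rightarrow> nat \<Rightarrow> nat \<Rightarrow> nat" where
  "threshold \<gamma> n m = 2 * nat \<lfloor>(real n / real m) powr \<gamma>\<rfloor>"

text \<open>
  \<open>\<sigma> n\<close> is the size of the alphabet for texts of length \<open>n\<close>; characters have to fit into machine
  words. High probability means that for every constant \<open>c\<close>, the data structure (which may
  depend on \<open>c\<close>) answers each query correctly with probability at least \<open>1 - 1 / n ^ c\<close>, for every
  sequence of operations fixed in advance. Since \<open>\<gamma>\<close> is a constant, \<open>k\<close> is a function of \<open>n\<close> and
  \<open>m\<close> and not a separate input.
\<close>

definition dynamic_k_mismatch_ds :: "(nat \<Rightarrow> nat) \<Rightarrow> real \<Rightarrow> real \<Rightarrow> bool" where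
  "dynamic_k_mismatch_ds \<sigma> \<gamma> \<epsilon> \<longleftrightarrow>
    (\<forall>c::nat. \<exists>pre upd qry. \<exists>C::real. \<exists>d e::nat.
      \<forall>n m T P ops.
        1 \<le> m \<and> m \<le> n \<and>
        length T = n \<and> set T \<subseteq> {..<\<sigma> n} \<and> length P = m \<and> set P \<subseteq> {..<\<sigma> n} \<and>
        list_all (valid_operation (\<sigma> n) n m) ops \<longrightarrow>
        (let k = threshold \<gamma> n m;
             W = (n + 2) ^ d;
             tp = nat \<lfloor>C * real n ^ e\<rfloor>;
             tu = nat \<lfloor>C * (real n / real m) powr (1 - \<epsilon>)\<rfloor>;
             tq = nat \<lfloor>C * real k powr (1 - \<epsilon>)\<rfloor>;
             answers = run_ds W tp tu tq pre upd qry T P ops;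
             correct = correct_answers k T P ops
         in \<sigma> n \<le> W \<and> lossless_spmf answers \<and>
            (\<forall>j < length correct.
               measure (measure_spmf answers) {as. as ! j = correct ! j} \<ge> 1 - 1 / real n ^ c)))"


section \<open>Online Boolean matrix-vector multiplication\<close>

text \<open>Matrices and vectors are functions of which only the indices below \<open>n\<close> are relevant.\<close>

definition bool_mat_vec :: "nat \<Rightarrow> (nat \<Rightarrow> nat \<Rightarrow> bool) \<Rightarrow> (nat \<Rightarrow> bool) \<Rightarrow> bool list" where
  "bool_mat_vec n M v = map (\<lambda>i. \<exists>j<n. M i j \<and> v j) [0..<n]"

text \<open>
  An algorithm consists of a program that is run once on the matrix (cells \<open>0\<close> to \<open>n\<^sup>2 - 1\<close>, row by
  row, with \<open>n\<close> in register 0) and a program that is run once per vector. Each vector is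
  written to the \<open>n\<close> cells from address \<open>n\<^sup>2\<close> on only after the product with the
  previous one has been read off from the \<open>n\<close> cells from address \<open>n\<^sup>2 + n\<close> on. The time budget is
  shared by all these runs.
\<close>

definition omv_input :: "nat \<Rightarrow> (nat \<Rightarrow> nat \<Rightarrow> bool) \<Rightarrow> state" where
  "omv_input n M =
     \<lparr>regs = (\<lambda>_. 0)(0 := n),
      mem = (\<lambda>a. if a < n\<^sup>2 then of_bool (M (a div n) (a mod n)) else 0)\<rparr>"

definition omv_feed :: "nat \<Rightarrow> (nat \<Rightarrow> bool) \<Rightarrow> state \<Rightarrow> state" where
  "omv_feed n v s =
     s\<lparr>mem := (\<lambda>a. if n\<^sup>2 \<le> a \<and> a < n\<^sup>2 + n then of_bool (v (a - n\<^sup>2)) else mem s a)\<rparr>"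

definition omv_output :: "nat \<Rightarrow> state \<Rightarrow> nat list" where
  "omv_output n s = map (\<lambda>i. mem s (n\<^sup>2 + n + i)) [0..<n]"

fun omv_rounds ::
  "nat \<Rightarrow> com \<Rightarrow> nat \<Rightarrow> (nat \<Rightarrow> bool) list \<Rightarrow> state \<times> nat \<Rightarrow> nat list list spmf" where
  "omv_rounds W mul n [] (s, t) = return_spmf []"
| "omv_rounds W mul n (v # vs) (s, t) =
     bind_spmf (run W t ([mul], omv_feed n v s))
       (\<lambda>(s', t'). map_spmf ((#) (omv_output n s')) (omv_rounds W mul n vs (s', t')))"

definition run_omv ::
  "nat \<Rightarrow> nat \<Rightarrow> com \<Rightarrow> com \<Rightarrow> nat \<Rightarrow> (nat \<Rightarrow> nat \<Rightarrow> bool) \<Rightarrow> (nat \<Rightarrow> bool) list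
    \<Rightarrow> nat list list spmf" where
  "run_omv W t init mul n M vs =
     bind_spmf (run W t ([init], omv_input n M)) (omv_rounds W mul n vs)"

definition omv_solvable :: "real \<Rightarrow> bool" where
  "omv_solvable \<epsilon> \<longleftrightarrow>
    (\<exists>init mul. \<exists>C::real. \<exists>d::nat.
      \<forall>n\<ge>1. \<forall>M vs. length vs = n \<longrightarrow>
        (let outputs = run_omv ((n + 2) ^ d) (nat \<lfloor>C * real n powr (3 - \<epsilon>)\<rfloor>) init mul n M vs
         in lossless_spmf outputs \<and>
            measure (measure_spmf outputs)
              {map (\<lambda>v. map of_bool (bool_mat_vec n M v)) vs} \<ge> 2 / 3))"

definition OMv_conjecture :: bool where
  "OMv_conjecture \<longleftrightarrow> (\<forall>\<epsilon>>0. \<not> omv_solvable \<epsilon>)"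

end

theory Submission
  imports Defs
begin

text \<open>
  Split the \<open>N \<times> N\<close> matrix into blocks with \<open>r\<close> rows and
    \<open>w\<close> columns and keep one data structure
  per block. The rows of the block, with every entry \<open>a\<close> encoded as \<open>(1 - a)
    a\<close>, form the text;
  the pattern encodes each coordinate \<open>b\<close> of the current vector as \<open>0 b\<close>.
    A row at Hamming distance
  \<open>h\<close> from the pattern then has inner product \<open>(w + |v| - h) / 2\<close> with the
    vector, so that the
  entry of the product is read off by comparing \<open>h\<close> with \<open>w + |v|\<close>. A
    round costs \<open>w\<close> updates
  and \<open>r\<close> queries per block, where \<open>n / m = r\<close> and
    \<open>k = 2 \<lfloor>r\<^sup>\<gamma>\<rfloor>\<close>. With \<open>r = g\<^sup>p\<close> and
    \<open>w = g\<^sup>q\<close>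
  for integers \<open>(1 - \<epsilon>) \<gamma> p < q \<le> \<gamma> p\<close>, every distance is at
    most \<open>k\<close>, and the cost per block is
  smaller than \<open>r w\<close> by a power of \<open>g\<close>. The base \<open>g\<close> is about
    the \<open>D\<close>-th root of \<open>N\<close>, with \<open>D\<close> so
  large that preprocessing all blocks is cheap.

  The degree of the preprocessing time may depend on the exponent of the error probability, so
  choosing that exponent large enough for a union bound over all queries would be circular.
  Instead, each block is given constantly many independent copies of a data structure with error
  probability \<open>1 / n\<close>, and a majority vote is taken.
\<close>

section \<open>Reasoning about programs\<close>

text \<open>If rows were stored as plain bits, the distance of a row \<open>a\<close> from a vector
  \<open>b\<close> would be \<open>|a| + |b| - 2 a.b\<close> and depend on the weight of the row.
  With the two-letter code all rows of a block share one comparison value per round. Two obstacles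
  shape the rest. The guarantee of the data structure concerns operation sequences fixed in advance,
  whereas the host interleaves all copies and must answer each vector before it sees the next. The
  operations sent to a copy depend on the vectors alone, never on answers, so the interleaved run
  has exactly the distribution of independent complete runs, transposed. Both the error bound of one
  copy and the independence of different copies are used in that form. Moreover,
  \<open>omv_solvable\<close> asks for a program that never crashes and respects an explicit budget
  for every \<open>N \<ge> 1\<close>. Hence the program logic tracks time and overflow along with
  the distribution, and no bound is merely asymptotic: the constant \<open>G\<close> added to the
  rounded root makes the union bound work for small \<open>N\<close> as well.\<close>

lemma step_append:
  "step W c (K @ L) s = map_spmf (\<lambda>(K', s'). (K' @ L, s')) (step W c K s)"
  by (cases c) (auto simp: spmf.map_comp o_def map_spmf_bind_spmf intro!: map_spmf_cong
    bind_spmf_cong)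

lemma run_append:
  assumes "lossless_spmf (run W B (cs, s))"
  shows "run W (B + t) (cs @ K, s) = bind_spmf (run W B (cs, s)) (\<lambda>(s', l). run W (l + t)
    (K, s'))"
  using assms
proof (induction B arbitrary: cs s)
  case 0
  then show ?case by (cases cs) auto
next
  case (Suc B)
  show ?case
  proof (cases cs)
    case Nil
    then show ?thesis by simp
  next
    case (Cons c cs')
    have "lossless_spmf (run W B (K', s'))" if "(K', s') \<in> set_spmf (step W c cs' s)" for K' s'
      using Suc.prems that Cons by (auto simp: lossless_bind_spmf)
    then have "bind_spmf (step W c cs' s) (\<lambda>(K', s'). run W (B + t) (K' @ K, s'))
      = bind_spmf (step W c cs' s) (\<lambda>(K', s'). run W B (K', s') \<bind>
        (\<lambda>(s', l). run W (l + t) (K, s')))"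
      by (intro bind_spmf_cong) (auto simp: Suc.IH)
    then show ?thesis
      unfolding Cons by (simp add: step_append bind_map_spmf o_def case_prod_unfold)
  qed
qed

text \<open>Lets the budget of a whole list be used for its first command alone, as the induction in
  \<open>run_block\<close> requires.\<close>

lemma lossless_run_prefix:
  assumes "lossless_spmf (run W B (cs @ K, s))"
  shows "lossless_spmf (run W B (cs, s))"
  using assms
proof (induction B arbitrary: cs s)
  case 0
  then show ?case by (cases cs) auto
next
  case (Suc B)
  then show ?case
    by (cases cs) (auto simp: step_append lossless_bind_spmf bind_map_spmf)
qed

lemma run_mono:
  assumes "lossless_spmf (run W B (cs, s))"
  shows "run W (B + t) (cs, s) = map_spmf (\<lambda>(s', l). (s', l + t)) (run W B (cs, s))"
  using run_append[OF assms, of t "[]"]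
  by (simp add: map_spmf_conv_bind_spmf case_prod_unfold)

fun block :: "com list \<Rightarrow> com" where
  "block [] = Skip"
| "block (c # cs) = Seq c (block cs)"

text \<open>The overhead is one step per \<open>Seq\<close> and one for the closing
  \<open>Skip\<close>.\<close>

lemma run_block:
  assumes "lossless_spmf (run W B (cs, s))"
  shows "run W (B + length cs + 1) (block cs # K, s) =
    bind_spmf (run W B (cs, s)) (\<lambda>(s', l). run W l (K, s'))"
  using assms
proof (induction cs arbitrary: B s)
  case Nil
  then show ?case by simp
next
  case (Cons c cs)
  have l: "lossless_spmf (run W B ([c], s))"
    using lossless_run_prefix[of W B "[c]" cs s] Cons.prems by simp
  have eq: "run W B (c # cs, s) = bind_spmf (run W B ([c], s)) (\<lambda>(s', l). run W l (cs, s'))"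
    using run_append[OF l, of 0 cs] by simp
  have "lossless_spmf (run W l (cs, s'))" if "(s', l) \<in> set_spmf (run W B ([c], s))" for s' l
    using Cons.prems that unfolding eq by (auto simp: lossless_bind_spmf)
  then have "bind_spmf (run W B ([c], s)) (\<lambda>(s', l). run W (l + (length cs + 1))
    (block cs # K, s'))
     = bind_spmf (run W B ([c], s)) (\<lambda>(s', l). run W l (cs, s') \<bind>
       (\<lambda>(s', l). run W l (K, s')))"
    using Cons.IH by (intro bind_spmf_cong) (auto simp: add.assoc[symmetric] simp del: run.simps)
  moreover have "run W (B + length (c # cs) + 1) (block (c # cs) # K, s)
      = run W (B + (length cs + 1)) ([c] @ (block cs # K), s)"
    by simp
  ultimately show ?case
    by (simp only: run_append[OF l] eq bind_spmf_assoc case_prod_unfold prod.sel)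
qed

text \<open>
  A probabilistic relational Hoare judgement: within \<open>B\<close> steps and
    without crashing, the program
  simulates the abstract distribution \<open>p\<close> up to the relation \<open>\<Phi>\<close>.
\<close>

definition simulates ::
  "nat \<Rightarrow> nat \<Rightarrow> com list \<Rightarrow> state \<Rightarrow>
    (state \<Rightarrow> 'a \<Rightarrow> bool) \<Rightarrow> 'a spmf \<Rightarrow> bool" where
  "simulates W B cs s \<Phi> p \<longleftrightarrow>
    lossless_spmf p \<and> rel_spmf (\<lambda>(s', _) a. \<Phi> s' a) (run W B (cs, s)) p"

lemma simulates_lossless_run: "simulates W B cs s \<Phi> p \<Longrightarrow>
  lossless_spmf (run W B (cs, s))"
  by (auto simp: simulates_def lossless_spmf_def dest: rel_spmf_weightD)

lemma simulates_mono:
  assumes "simulates W B cs s \<Phi> p" "B \<le> B'"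
    and "\<And>s' a. \<Phi> s' a \<Longrightarrow> a \<in> set_spmf p \<Longrightarrow> \<Psi> s' a"
  shows "simulates W B' cs s \<Psi> p"
proof -
  obtain t where t: "B' = B + t" using assms(2) le_Suc_ex by blast
  have "run W B' (cs, s) = map_spmf (\<lambda>(s', l). (s', l + t)) (run W B (cs, s))"
    unfolding t by (rule run_mono[OF simulates_lossless_run[OF assms(1)]])
  then show ?thesis
    using assms(1,3) unfolding simulates_def
    by (auto simp: spmf_rel_map elim!: rel_spmf_mono_strong)
qed

lemma simulates_Nil: "\<Phi> s a \<Longrightarrow> simulates W B [] s \<Phi> (return_spmf a)"
  by (simp add: simulates_def)

lemma simulates_append:
  assumes 1: "simulates W B1 cs1 s \<Phi> p"
    and 2: "\<And>s' a. \<Phi> s' a \<Longrightarrow> a \<in> set_spmf p \<Longrightarrow>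
      simulates W B2 cs2 s' \<Psi> (f a)"
  shows "simulates W (B1 + B2) (cs1 @ cs2) s \<Psi> (bind_spmf p f)"
proof -
  have rel: "rel_spmf (\<lambda>(s', _) a. \<Phi> s' a \<and>
    a \<in> set_spmf p) (run W B1 (cs1, s)) p"
    using 1 unfolding simulates_def by (auto elim!: rel_spmf_mono_strong)
  \<comment> \<open>Each value in the support of \<open>p\<close> is related to some final state, so
    the second premise applies to it and makes \<open>f a\<close> lossless.\<close>
  have ll: "lossless_spmf (bind_spmf p f)"
  proof -
    have "\<exists>s'. \<Phi> s' a" if "a \<in> set_spmf p" for a
      using 1 that unfolding simulates_def by (fastforce elim!: rel_spmfE)
    then show ?thesis using 1 2 unfolding simulates_def lossless_bind_spmf by blast
  qed
  have "rel_spmf (\<lambda>(s', _) a. \<Psi> s' a)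
      (bind_spmf (run W B1 (cs1, s)) (\<lambda>(s', l). run W (l + B2) (cs2, s'))) (bind_spmf p f)"
  proof (rule rel_spmf_bindI[OF rel], clarify)
    fix s' l a assume "\<Phi> s' a" "a \<in> set_spmf p"
    from simulates_mono[OF 2[OF this], of "l + B2" \<Psi>]
    show "rel_spmf (\<lambda>(s', _) a. \<Psi> s' a) (run W (l + B2) (cs2, s')) (f a)"
      unfolding simulates_def by simp
  qed
  then show ?thesis
    using ll run_append[OF simulates_lossless_run[OF 1], of B2 cs2]
    unfolding simulates_def by simp
qed

lemma simulates_block:
  assumes "simulates W B cs s \<Phi> p"
  shows "simulates W (B + length cs + 1) [block cs] s \<Phi> p"
  using assms run_block[OF simulates_lossless_run[OF assms], of "[]"]
  unfolding simulates_def by (simp add: map_spmf_conv_bind_spmf case_prod_unfold del: run.simps(3))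

subsection \<open>Expressions\<close>

datatype expr = Lit nat | Var nat | Bin binop expr expr | At expr

fun value_of :: "expr \<Rightarrow> (nat \<Rightarrow> nat) \<Rightarrow>
  (nat \<Rightarrow> nat) \<Rightarrow> nat" where
  "value_of (Lit k) \<rho> \<mu> = k"
| "value_of (Var x) \<rho> \<mu> = \<rho> x"
| "value_of (Bin f a b) \<rho> \<mu> = eval_binop f (value_of a \<rho> \<mu>)
  (value_of b \<rho> \<mu>)"
| "value_of (At a) \<rho> \<mu> = \<mu> (value_of a \<rho> \<mu>)"

text \<open>The registers from \<open>d\<close> on form an evaluation stack with the result in
  \<open>d\<close>. A register is copied as \<open>x OR x\<close>, which cannot overflow.\<close>

fun compile_expr :: "expr \<Rightarrow> nat \<Rightarrow> com list" where
  "compile_expr (Lit k) d = [Const d k]"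
| "compile_expr (Var x) d = [Op BitOr d x x]"
| "compile_expr (Bin f a b) d = compile_expr a d @ compile_expr b (Suc d) @ [Op f d d (Suc d)]"
| "compile_expr (At a) d = compile_expr a d @ [Load d d]"

fun cost :: "expr \<Rightarrow> nat" where
  "cost (Lit k) = 1"
| "cost (Var x) = 1"
| "cost (Bin f a b) = cost a + (cost b + 1)"
| "cost (At a) = cost a + 1"

lemma length_compile_expr [simp]: "length (compile_expr e d) = cost e"
  by (induction e arbitrary: d) auto

text \<open>
  If the variables and the loaded cells are at most \<open>X\<close>, then no intermediate result
    exceeds
  \<open>(X + 2) ^ deg e\<close>, which reduces all overflow checks to the inequality
  \<open>(X + 2) ^ deg e < W\<close>.
\<close>

fun tame :: "nat \<Rightarrow> expr \<Rightarrow> (nat \<Rightarrow> nat) \<Rightarrow>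
  (nat \<Rightarrow> nat) \<Rightarrow> bool" where
  "tame X (Lit k) \<rho> \<mu> \<longleftrightarrow> True"
| "tame X (Var x) \<rho> \<mu> \<longleftrightarrow> x < 31 \<and> \<rho> x \<le> X"
| "tame X (Bin f a b) \<rho> \<mu> \<longleftrightarrow> f \<in> {Add, Sub, Mul, Div, Mod, Less, Eq}
  \<and> tame X a \<rho> \<mu> \<and> tame X b \<rho> \<mu>"
| "tame X (At a) \<rho> \<mu> \<longleftrightarrow> tame X a \<rho> \<mu> \<and>
  \<mu> (value_of a \<rho> \<mu>) \<le> X"

fun deg :: "expr \<Rightarrow> nat" where
  "deg (Lit k) = k"
| "deg (Var x) = 1"
| "deg (Bin f a b) = deg a + deg b + 1"
| "deg (At a) = deg a + 1"

text \<open>Explains the degrees: a literal satisfies \<open>k \<le> 2 ^ k\<close>, sums and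
  products of two powers of \<open>X + 2\<close> are absorbed by one further factor
  \<open>X + 2\<close>, and the other operations give nothing larger. A loaded value is at most
  \<open>X\<close> by assumption; the degree of \<open>At a\<close> has to cover the address as
  well.\<close>

lemma value_of_le:
  "tame X e \<rho> \<mu> \<Longrightarrow> value_of e \<rho> \<mu> \<le> (X + 2) ^ deg e"
proof (induction e)
  case (Lit k)
  have "k \<le> 2 ^ k" by (rule less_imp_le[OF less_exp])
  also have "\<dots> \<le> (X + 2) ^ k" by (rule power_mono) auto
  finally show ?case by simp
next
  case (Bin f a b)
  let ?A = "(X + 2) ^ deg a" and ?B = "(X + 2) ^ deg b"
  have IH: "value_of a \<rho> \<mu> \<le> ?A" "value_of b \<rho> \<mu> \<le> ?B" using Bin by auto
  have pos: "1 \<le> ?A" "1 \<le> ?B" by auto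
  have "?A + ?B \<le> 2 * (?A * ?B)"
    using pos by (metis add_mono mult_2 mult_le_mono nat_mult_1 nat_mult_1_right order_refl)
  also have "\<dots> \<le> (X + 2) * (?A * ?B)" by (rule mult_right_mono) auto
  also have "\<dots> = (X + 2) ^ deg (Bin f a b)"
    by (simp only: deg.simps power_add power_one_right mult_ac)
  finally have sum: "?A + ?B \<le> (X + 2) ^ deg (Bin f a b)" .
  have "?A * ?B \<le> (X + 2) * (?A * ?B)" by simp
  also have "\<dots> = (X + 2) ^ deg (Bin f a b)" by (simp add: power_add)
  finally have prod: "?A * ?B \<le> (X + 2) ^ deg (Bin f a b)" .
  have "value_of a \<rho> \<mu> * value_of b \<rho> \<mu> \<le> ?A * ?B" using IH
    by (rule mult_mono) auto
  moreover have "1 \<le> max (?A + ?B) (?A * ?B)" using pos by (metis le_max_iff_disj trans_le_add1)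
  ultimately have "eval_binop f (value_of a \<rho> \<mu>) (value_of b \<rho> \<mu>) \<le> max
    (?A + ?B) (?A * ?B)"
    using Bin.prems IH div_le_dividend[of "value_of a \<rho> \<mu>" "value_of b \<rho> \<mu>"]
      mod_less_eq_dividend[of "value_of a \<rho> \<mu>" "value_of b \<rho> \<mu>"]
    by (auto simp del: div_le_dividend mod_less_eq_dividend)
  with sum prod show ?case unfolding value_of.simps by linarith
next
  case (At a)
  have "X \<le> X + 2" by (rule le_add1)
  also have "\<dots> \<le> (X + 2) ^ deg (At a)" by (rule self_le_power) auto
  finally show ?case using At.prems by simp
qed auto

text \<open>Masking scratch registers and the registers of the simulated machine lets assertions be
  equations between register functions, although evaluation overwrites the higher registers.\<close>

definition low :: "(nat \<Rightarrow> nat) \<Rightarrow> nat \<Rightarrow> nat" where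
  "low \<rho> = (\<lambda>y. if y < 31 then \<rho> y else 0)"

lemma simulates_Const:
  "0 < B \<Longrightarrow> k < W \<Longrightarrow>
    \<Phi> (s\<lparr>regs := (regs s)(r := k)\<rparr>) a \<Longrightarrow>
    simulates W B [Const r k] s \<Phi> (return_spmf a)"
  by (cases B) (simp_all add: simulates_def set_reg_def)

lemma simulates_Op:
  "0 < B \<Longrightarrow> eval_binop f (regs s x) (regs s y) < W \<Longrightarrow>
   \<Phi> (s\<lparr>regs := (regs s)(r := eval_binop f (regs s x)
     (regs s y))\<rparr>) a \<Longrightarrow>
   simulates W B [Op f r x y] s \<Phi> (return_spmf a)"
  by (cases B) (simp_all add: simulates_def set_reg_def)

lemma simulates_Load:
  "0 < B \<Longrightarrow> mem s (regs s x) < W \<Longrightarrow>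
    \<Phi> (s\<lparr>regs := (regs s)(r := mem s (regs s x))\<rparr>) a \<Longrightarrow>
   simulates W B [Load r x] s \<Phi> (return_spmf a)"
  by (cases B) (simp_all add: simulates_def set_reg_def)

lemma simulates_Store:
  "0 < B \<Longrightarrow> \<Phi> (s\<lparr>mem :=
    (mem s)(regs s x := regs s y)\<rparr>) a \<Longrightarrow>
   simulates W B [Store x y] s \<Phi> (return_spmf a)"
  by (cases B) (simp_all add: simulates_def set_reg_def)

lemma simulates_append_det:
  assumes "simulates W B1 cs1 s (\<lambda>s' (_::unit). simulates W B2 cs2 s' \<Psi> p)
    (return_spmf ())"
  shows "simulates W (B1 + B2) (cs1 @ cs2) s \<Psi> p"
  using simulates_append[OF assms, of B2 cs2 \<Psi> "\<lambda>_. p"] by simp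

text \<open>The clause about registers below \<open>d\<close> protects the left operand while the
  right one is evaluated one register higher; with \<open>31 \<le> d\<close> it also protects the
  variables.\<close>

lemma simulates_expr:
  assumes "tame X e (low (regs s)) (mem s)" "(X + 2) ^ deg e < W" "31 \<le> d"
  shows "simulates W (cost e) (compile_expr e d) s
    (\<lambda>s' (_::unit). mem s' = mem s \<and> regs s' d = value_of e (low (regs s))
      (mem s) \<and>
       (\<forall>y<d. regs s' y = regs s y)) (return_spmf ())"
  using assms
proof (induction e arbitrary: s d)
  case (Lit k)
  then have "k < W"
    using value_of_le[OF Lit(1)] by (metis deg.simps(1) le_less_trans value_of.simps(1))
  then show ?case by (auto intro!: simulates_Const)
next
  case (Var x)
  then show ?case by (auto intro!: simulates_Op simp: low_def)
next
  case (Bin f a b)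
  have dg: "(X + 2) ^ deg a < W" "(X + 2) ^ deg b < W"
    using Bin.prems(2) power_increasing[of "deg a" "deg (Bin f a b)" "X + 2"]
      power_increasing[of "deg b" "deg (Bin f a b)" "X + 2"] by auto
  have fit: "value_of (Bin f a b) (low (regs s)) (mem s) < W"
    using value_of_le[OF Bin.prems(1)] Bin.prems(2) by simp
  have low_eq: "low (regs s') = low (regs s)" if "\<forall>y<d. regs s' y = regs s y"
    for s' :: state
    using that Bin.prems(3) by (auto simp: low_def)
  have tame: "tame X a (low (regs s)) (mem s)" "tame X b (low (regs s)) (mem s)"
    using Bin.prems(1) by auto
  have d: "31 \<le> d" "31 \<le> Suc d" using Bin.prems(3) by auto
  let ?v = "\<lambda>e. value_of e (low (regs s)) (mem s)"
  show ?case
    unfolding compile_expr.simps cost.simps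
  proof (rule simulates_append_det, rule simulates_mono[OF Bin.IH(1)[OF tame(1) dg(1) d(1)]
    order.refl])
    fix s1 :: state and u :: unit
    assume s1: "mem s1 = mem s \<and> regs s1 d = ?v a \<and> (\<forall>y<d. regs s1 y = regs s y)"
    then have low1: "low (regs s1) = low (regs s)" using low_eq by blast
    then have tame1: "tame X b (low (regs s1)) (mem s1)" using tame s1 by simp
    show "simulates W (cost b + 1) (compile_expr b (Suc d) @ [Op f d d (Suc d)]) s1
      (\<lambda>s' _. mem s' = mem s \<and> regs s' d = ?v (Bin f a b) \<and>
        (\<forall>y<d. regs s' y = regs s y))
      (return_spmf ())"
    proof (rule simulates_append_det, rule simulates_mono[OF Bin.IH(2)[OF tame1 dg(2) d(2)]
      order.refl])
      fix s2 :: state and u :: unit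
      assume s2: "mem s2 = mem s1 \<and> regs s2 (Suc d) = value_of b (low (regs s1))
        (mem s1) \<and>
        (\<forall>y<Suc d. regs s2 y = regs s1 y)"
      have v: "eval_binop f (regs s2 d) (regs s2 (Suc d)) = ?v (Bin f a b)"
        using s1 s2 low1 by simp
      have fr: "regs s2 y = regs s y" if "y < d" for y
        using s1 s2 that by (metis less_SucI)
      show "simulates W 1 [Op f d d (Suc d)] s2
        (\<lambda>s' _. mem s' = mem s \<and> regs s' d = ?v (Bin f a b) \<and>
          (\<forall>y<d. regs s' y = regs s y))
        (return_spmf ())"
      proof (rule simulates_Op)
        show "eval_binop f (regs s2 d) (regs s2 (Suc d)) < W" using fit by (simp only: v)
      qed (unfold v, use s1 s2 fr in simp_all)
    qed
  qed
next
  case (At a)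
  have dg: "(X + 2) ^ deg a < W"
    using At.prems(2) power_increasing[of "deg a" "deg (At a)" "X + 2"] by auto
  have fit: "value_of (At a) (low (regs s)) (mem s) < W"
    using value_of_le[OF At.prems(1)] At.prems(2) by simp
  show ?case
    unfolding compile_expr.simps cost.simps
    by (rule simulates_append_det, rule simulates_mono[OF At.IH[of s d]])
      (use At.prems dg fit in \<open>auto intro!: simulates_Load\<close>)
qed

subsection \<open>Structured programs\<close>

text \<open>The precondition is one concrete pair of registers and memory. What is known about that
  pair stays in the proof context, so no separate assertion logic is needed.\<close>

definition hoare ::
  "nat \<Rightarrow> nat \<Rightarrow> com list \<Rightarrow> (nat \<Rightarrow> nat) \<Rightarrow>
    (nat \<Rightarrow> nat)
    \<Rightarrow> ((nat \<Rightarrow> nat) \<Rightarrow>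
      (nat \<Rightarrow> nat) \<Rightarrow> 'a \<Rightarrow> bool) \<Rightarrow> 'a spmf
      \<Rightarrow> bool" where
  "hoare W B cs \<rho> \<mu> \<Phi> p \<longleftrightarrow>
    (\<forall>s::state. mem s = \<mu> \<longrightarrow> low (regs s) = \<rho> \<longrightarrow>
       simulates W B cs s (\<lambda>s' a. \<Phi> (low (regs s')) (mem s') a) p)"

lemma hoare_mono:
  assumes "hoare W B cs \<rho> \<mu> \<Phi> p" "B \<le> B'"
    and "\<And>\<rho>' \<mu>' a. \<Phi> \<rho>' \<mu>' a \<Longrightarrow>
      a \<in> set_spmf p \<Longrightarrow> \<Psi> \<rho>' \<mu>' a"
  shows "hoare W B' cs \<rho> \<mu> \<Psi> p"
  using assms unfolding hoare_def by (blast intro: simulates_mono)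

lemma hoare_Nil: "\<Phi> \<rho> \<mu> a \<Longrightarrow>
  hoare W B [] \<rho> \<mu> \<Phi> (return_spmf a)"
  unfolding hoare_def by (auto intro: simulates_Nil)

lemma hoare_append:
  assumes "hoare W B1 cs1 \<rho> \<mu> (\<lambda>\<rho>' \<mu>' a. hoare W B2 cs2 \<rho>' \<mu>'
    \<Psi> (f a)) p"
  shows "hoare W (B1 + B2) (cs1 @ cs2) \<rho> \<mu> \<Psi> (bind_spmf p f)"
  using assms unfolding hoare_def by (auto intro!: simulates_append)

lemma hoare_append_det:
  assumes "hoare W B1 cs1 \<rho> \<mu> (\<lambda>\<rho>' \<mu>'
    (_::unit). hoare W B2 cs2 \<rho>' \<mu>' \<Psi> p) (return_spmf ())"
  shows "hoare W (B1 + B2) (cs1 @ cs2) \<rho> \<mu> \<Psi> p"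
  using hoare_append[OF assms] by simp

definition assign :: "nat \<Rightarrow> expr \<Rightarrow> com list" where
  "assign x e = compile_expr e 31 @ [Op BitOr x 31 31]"

definition store :: "expr \<Rightarrow> expr \<Rightarrow> com list" where
  "store e1 e2 = compile_expr e1 31 @ compile_expr e2 32 @ [Store 31 32]"

text \<open>\<open>WhileNZ\<close> tests a register only, so the guard is evaluated before the loop
  and again at the end of each pass.\<close>

definition while_expr :: "expr \<Rightarrow> com list \<Rightarrow> com list" where
  "while_expr e cs = compile_expr e 31 @ [WhileNZ 31 (block (cs @ compile_expr e 31))]"

lemma hoare_assign:
  assumes "tame X e \<rho> \<mu>" "(X + 2) ^ deg e < W" "x < 31" "\<Phi>
    (\<rho>(x := value_of e \<rho> \<mu>)) \<mu> a"
  shows "hoare W (cost e + 1) (assign x e) \<rho> \<mu> \<Phi> (return_spmf a)"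
  unfolding hoare_def assign_def
proof (intro allI impI)
  fix s :: state assume s: "mem s = \<mu>" "low (regs s) = \<rho>"
  have lw: "low ((regs s')(x := v)) = \<rho>(x := v)" if "\<forall>y<31. regs s' y = regs s y"
    for s' :: state and v
    using that s assms(3) by (auto simp: low_def)
  have fit: "value_of e \<rho> \<mu> < W"
    using value_of_le[OF assms(1)] assms(2) by simp
  show "simulates W (cost e + 1) (compile_expr e 31 @ [Op BitOr x 31 31]) s
      (\<lambda>s' a. \<Phi> (low (regs s')) (mem s') a) (return_spmf a)"
    by (rule simulates_append_det, rule simulates_mono[OF simulates_expr[of X]])
      (use s assms fit lw in \<open>auto intro!: simulates_Op\<close>)
qed

lemma hoare_store:
  assumes "tame X e1 \<rho> \<mu>" "(X + 2) ^ deg e1 < W" "tame X e2 \<rho> \<mu>" "(X + 2) ^ deg e2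
    < W"
    and "\<Phi> \<rho> (\<mu>(value_of e1 \<rho> \<mu> := value_of e2 \<rho> \<mu>)) a"
  shows "hoare W (cost e1 + (cost e2 + 1)) (store e1 e2) \<rho> \<mu> \<Phi> (return_spmf a)"
  unfolding hoare_def store_def
proof (intro allI impI)
  fix s :: state assume s: "mem s = \<mu>" "low (regs s) = \<rho>"
  have lw: "low (regs s') = \<rho>" if "\<forall>y<31. regs s' y = regs s y" for s' :: state
    using that s by (auto simp: low_def)
  show "simulates W (cost e1 + (cost e2 + 1)) (compile_expr e1 31 @ compile_expr e2 32 @ [Store 31
    32]) s
      (\<lambda>s' a. \<Phi> (low (regs s')) (mem s') a) (return_spmf a)"
  proof (rule simulates_append_det, rule simulates_mono[OF simulates_expr[of X]], goal_cases)
    case (5 s1 u)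
    note s1 = 5(1)
    then have l1: "low (regs s1) = \<rho>" by (auto intro: lw)
    show ?case
    proof (rule simulates_append_det, rule simulates_mono[OF simulates_expr[of X]], goal_cases)
      case (5 s2 u)
      then have "low (regs s2) = \<rho>" using s1 by (auto intro: lw)
      then show ?case using 5 s1 s l1 assms by (auto intro!: simulates_Store)
    qed (use s assms l1 s1 in auto)
  qed (use s assms in auto)
qed

text \<open>The abstract effect of a counted loop: probabilistic passes threaded through an
  accumulator.\<close>

fun foldM :: "('i \<Rightarrow> 'a \<Rightarrow> 'a spmf) \<Rightarrow> 'i list \<Rightarrow> 'a
  \<Rightarrow> 'a spmf" where
  "foldM f [] a = return_spmf a"
| "foldM f (x # xs) a = bind_spmf (f x a) (foldM f xs)"

lemma foldM_append: "foldM f (xs @ ys) a = bind_spmf (foldM f xs a) (foldM f ys)"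
proof (induction xs arbitrary: a)
  case (Cons x xs)
  then have "foldM f (xs @ ys) = (\<lambda>b. bind_spmf (foldM f xs b) (foldM f ys))" by (rule ext)
  then show ?case by simp
qed simp

lemma foldM_map: "foldM f (map g xs) a = foldM (\<lambda>x. f (g x)) xs a"
proof (induction xs arbitrary: a)
  case (Cons x xs)
  then have "foldM f (map g xs) = foldM (\<lambda>x. f (g x)) xs" by (rule ext)
  then show ?case by simp
qed simp

lemma foldM_return_unit [simp]: "foldM (\<lambda>_ _. return_spmf ()) xs () = return_spmf ()"
  by (induction xs) auto

text \<open>One pass costs \<open>B\<close> for the body, \<open>cost e\<close> for the guard,
  \<open>length cs + cost e + 1\<close> for unfolding the block and 1 for the test. Register 31 has
  to hold the value of the guard at every test, so this joins the invariant
  \<open>I\<close>.\<close>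

lemma while_aux:
  fixes a :: 'a and s :: state
  assumes body: "\<And>i \<rho> \<mu> a. i < n \<Longrightarrow>
    I i \<rho> \<mu> a \<Longrightarrow> value_of e \<rho> \<mu> \<noteq> 0 \<and>
    hoare W B cs \<rho> \<mu> (I (Suc i)) (f i a)"
    and fin: "\<And>\<rho> \<mu> a. I n \<rho> \<mu> a \<Longrightarrow>
      value_of e \<rho> \<mu> = 0"
    and tame: "\<And>i \<rho> \<mu> a. i \<le> n \<Longrightarrow>
      I i \<rho> \<mu> a \<Longrightarrow> tame X e \<rho> \<mu>"
    and deg: "(X + 2) ^ deg e < W"
    and "i \<le> n" "I i (low (regs s)) (mem s) a" "regs s 31 = value_of e (low (regs s)) (mem s)"
  shows "simulates W ((n - i) * (B + length cs + 2 * cost e + 2) + 1)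
    [WhileNZ 31 (block (cs @ compile_expr e 31))] s
    (\<lambda>s' a. I n (low (regs s')) (mem s') a) (foldM f [i..<n] a)"
  using assms(5-)
proof (induction "n - i" arbitrary: i s a)
  case 0
  then have [simp]: "i = n" by simp
  show ?case using 0 fin by (simp add: simulates_def)
next
  case (Suc k)
  then have i: "i < n" and k: "k = n - Suc i" by auto
  let ?body = "cs @ compile_expr e 31" and ?C = "B + length cs + 2 * cost e + 2"
  let ?w = "WhileNZ 31 (block ?body)"
  have nz: "regs s 31 \<noteq> 0" and hb: "hoare W B cs (low (regs s)) (mem s) (I (Suc i)) (f i a)"
    using body[OF i] Suc.prems by auto
  have "simulates W (B + cost e) ?body s
     (\<lambda>s' a. I (Suc i) (low (regs s')) (mem s') a \<and>
       regs s' 31 = value_of e (low (regs s')) (mem s'))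
     (bind_spmf (f i a) return_spmf)"
  proof (rule simulates_append)
    show "simulates W B cs s (\<lambda>s' a. I (Suc i) (low (regs s')) (mem s') a) (f i a)"
      using hb unfolding hoare_def by auto
  next
    fix s1 :: state and a1 assume I1: "I (Suc i) (low (regs s1)) (mem s1) a1"
    have "tame X e (low (regs s1)) (mem s1)" using tame[of "Suc i"] I1 i by auto
    from simulates_expr[OF this deg order.refl]
    have *: "simulates W (cost e) (compile_expr e 31) s1
      (\<lambda>s' _. I (Suc i) (low (regs s')) (mem s') a1 \<and>
        regs s' 31 = value_of e (low (regs s')) (mem s'))
       (return_spmf ())"
    proof (rule simulates_mono[OF _ order.refl])
      fix s' :: state and u :: unit
      assume 3: "mem s' = mem s1 \<and> regs s' 31 = value_of e (low (regs s1)) (mem s1) \<and>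
        (\<forall>y<31. regs s' y = regs s1 y)"
      then have "low (regs s') = low (regs s1)" by (auto simp: low_def)
      then show "I (Suc i) (low (regs s')) (mem s') a1 \<and>
        regs s' 31 = value_of e (low (regs s')) (mem s')"
        using 3 I1 by simp
    qed
    show "simulates W (cost e) (compile_expr e 31) s1
       (\<lambda>s' a. I (Suc i) (low (regs s')) (mem s') a \<and>
         regs s' 31 = value_of e (low (regs s')) (mem s'))
       (return_spmf a1)"
      using simulates_append[OF *, of 0 "[]" _ "\<lambda>_. return_spmf a1"]
      by (simp add: simulates_Nil)
  qed
  note block = simulates_block[OF this]
  have "simulates W (B + length cs + 2 * cost e + 1) [block ?body] s
     (\<lambda>s' a. I (Suc i) (low (regs s')) (mem s') a \<and>
       regs s' 31 = value_of e (low (regs s')) (mem s'))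
     (bind_spmf (f i a) return_spmf)"
    by (rule simulates_mono[OF block]) auto
  then have b: "simulates W (B + length cs + 2 * cost e + 1) [block ?body] s
     (\<lambda>s' a. I (Suc i) (low (regs s')) (mem s') a \<and>
       regs s' 31 = value_of e (low (regs s')) (mem s'))
     (f i a)"
    by simp
  have "simulates W (B + length cs + 2 * cost e + 1 + (k * ?C + 1)) ([block ?body] @ [?w]) s
     (\<lambda>s' a. I n (low (regs s')) (mem s') a) (bind_spmf (f i a) (foldM f [Suc i..<n]))"
  proof (rule simulates_append[OF b])
    fix s1 :: state and a1
    assume "I (Suc i) (low (regs s1)) (mem s1) a1 \<and>
      regs s1 31 = value_of e (low (regs s1)) (mem s1)"
    then show "simulates W (k * ?C + 1) [?w] s1
     (\<lambda>s' a. I n (low (regs s')) (mem s') a) (foldM f [Suc i..<n] a1)"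
      using Suc.hyps(1)[OF k, of s1 a1] i unfolding k[symmetric] by simp
  qed
  moreover have "(n - i) * ?C + 1 = Suc (B + length cs + 2 * cost e + 1 + (k * ?C + 1))"
    using Suc.hyps(2)[symmetric] by simp
  moreover have "run W (Suc t) ([?w], s) = run W t ([block ?body] @ [?w], s)" for t
    using nz by simp
  moreover have "[i..<n] = i # [Suc i..<n]" using i by (rule upt_conv_Cons)
  ultimately show ?case
    unfolding simulates_def by (simp only: foldM.simps append.simps)
qed

lemma hoare_while:
  fixes a :: 'a
  assumes body: "\<And>i \<rho> \<mu> a. i < n \<Longrightarrow>
    I i \<rho> \<mu> a \<Longrightarrow> value_of e \<rho> \<mu> \<noteq> 0 \<and>
    hoare W B cs \<rho> \<mu> (I (Suc i)) (f i a)"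
    and fin: "\<And>\<rho> \<mu> a. I n \<rho> \<mu> a \<Longrightarrow>
      value_of e \<rho> \<mu> = 0"
    and tame: "\<And>i \<rho> \<mu> a. i \<le> n \<Longrightarrow>
      I i \<rho> \<mu> a \<Longrightarrow> tame X e \<rho> \<mu>"
    and deg: "(X + 2) ^ deg e < W"
    and I0: "I 0 \<rho> \<mu> a"
  shows "hoare W (cost e + (n * (B + length cs + 2 * cost e + 2) + 1))
    (while_expr e cs) \<rho> \<mu>
    (I n) (foldM f [0..<n] a)"
  unfolding hoare_def while_expr_def
proof (intro allI impI)
  fix s :: state assume s: "mem s = \<mu>" "low (regs s) = \<rho>"
  let ?w = "[WhileNZ 31 (block (cs @ compile_expr e 31))]"
  have t: "tame X e (low (regs s)) (mem s)" using tame[of 0] I0 s by auto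
  show "simulates W (cost e + (n * (B + length cs + 2 * cost e + 2) + 1)) (compile_expr e 31 @ ?w) s
     (\<lambda>s' a. I n (low (regs s')) (mem s') a) (foldM f [0..<n] a)"
  proof (rule simulates_append_det, rule simulates_mono[OF simulates_expr[OF t deg order.refl]
    order.refl])
    fix s' :: state and u :: unit
    assume 3: "mem s' = mem s \<and> regs s' 31 = value_of e (low (regs s)) (mem s) \<and>
      (\<forall>y<31. regs s' y = regs s y)"
    then have "low (regs s') = low (regs s)" by (auto simp: low_def)
    then show "simulates W (n * (B + length cs + 2 * cost e + 2) + 1) ?w s'
        (\<lambda>s' a. I n (low (regs s')) (mem s') a) (foldM f [0..<n] a)"
      using while_aux[of n I e W B cs f X 0 s' a, OF body fin tame deg] I0 s 3 by simp
  qed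
qed

section \<open>Counted loops\<close>

definition for_loop :: "nat \<Rightarrow> nat \<Rightarrow> com list \<Rightarrow> com list" where
  "for_loop x b cs = assign x (Lit 0) @
     while_expr (Bin Less (Var x) (Var b)) (cs @ assign x (Bin Add (Var x) (Lit 1)))"

lemma length_assign [simp]: "length (assign x e) = cost e + 1"
  by (simp add: assign_def)

lemma length_store [simp]: "length (store e e') = cost e + cost e' + 1"
  by (simp add: store_def)

lemma length_for_loop [simp]: "length (for_loop x b cs) = 6"
  by (simp add: for_loop_def while_expr_def)

text \<open>The body establishes the invariant for the already incremented counter, so that
  applications never deal with the increment. The exponent 3 is the degree of both the test and the
  increment; 20 and 10 round up the fixed overheads.\<close>

lemma hoare_for:
  fixes a :: 'a
  assumes body: "\<And>i \<rho> \<mu> a. i < n \<Longrightarrow>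
    I i \<rho> \<mu> a \<Longrightarrow> \<rho> x = i \<Longrightarrow>
    \<rho> b = n \<Longrightarrow>
      hoare W B cs \<rho> \<mu> (\<lambda>\<rho>' \<mu>' a'. \<rho>' x = i \<and>
        \<rho>' b = n \<and> I (Suc i) (\<rho>'(x := Suc i)) \<mu>' a') (f i a)"
    and I0: "I 0 (\<rho>(x := 0)) \<mu> a"
    and xb: "x \<noteq> b" "x < 31" "b < 31" "\<rho> b = n" "n \<le> X" and W: "(X + 2) ^ 3 < W"
  shows "hoare W (n * (B + length cs + 20) + 10) (for_loop x b cs) \<rho> \<mu> (I n)
    (foldM f [0..<n] a)"
proof -
  let ?e = "Bin Less (Var x) (Var b)" and ?inc = "assign x (Bin Add (Var x) (Lit 1))"
  let ?I = "\<lambda>i \<rho> \<mu> a. I i \<rho> \<mu> a \<and> \<rho> x = i \<and> \<rho> b = n"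
  have W0: "(X + 2) ^ 0 < W" using W
    by (metis le_add2 le_less_trans one_le_numeral one_le_power order.trans power_0)
  have "hoare W (cost ?e + (n * (B + 4 + length (cs @ ?inc) + 2 * cost ?e + 2) + 1))
    (while_expr ?e (cs @ ?inc)) (\<rho>(x := 0)) \<mu> (?I n) (foldM f [0..<n] a)"
  proof (rule hoare_while[where X = X and I = ?I])
    fix i \<rho> \<mu> a assume i: "i < n" and I: "?I i \<rho> \<mu> a"
    have "hoare W (B + 4) (cs @ ?inc) \<rho> \<mu> (?I (Suc i)) (bind_spmf (f i a) return_spmf)"
    proof (rule hoare_append, rule hoare_mono[OF body])
      fix \<rho>' \<mu>' a'
      assume *: "\<rho>' x = i \<and> \<rho>' b = n \<and>
        I (Suc i) (\<rho>'(x := Suc i)) \<mu>' a'"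
      have "hoare W (cost (Bin Add (Var x) (Lit 1)) + 1) ?inc \<rho>' \<mu>' (?I (Suc i))
        (return_spmf a')"
        by (rule hoare_assign[where X = X])
          (use * i W xb in \<open>auto simp: numeral_3_eq_3 simp del: power_Suc\<close>)
      then show "hoare W 4 ?inc \<rho>' \<mu>' (?I (Suc i)) (return_spmf a')"
        by (simp add: eval_nat_numeral)
    qed (use i I in auto)
    then show "value_of ?e \<rho> \<mu> \<noteq> 0 \<and>
      hoare W (B + 4) (cs @ ?inc) \<rho> \<mu> (?I (Suc i)) (f i a)"
      using I i by simp
  next
    show "(X + 2) ^ deg ?e < W" using W by (simp add: numeral_3_eq_3 del: power_Suc)
  next
    show "?I 0 (\<rho>(x := 0)) \<mu> a" using I0 xb by simp
  qed (use xb in auto)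
  note while = this
  have "hoare W (2 + (n * (B + length cs + 20) + 8)) (for_loop x b cs) \<rho> \<mu> (I n)
    (foldM f [0..<n] a)"
    unfolding for_loop_def
  proof (rule hoare_append_det)
    have "hoare W (n * (B + length cs + 20) + 8) (while_expr ?e (cs @ ?inc)) (\<rho>(x := 0)) \<mu>
        (I n) (foldM f [0..<n] a)"
      by (rule hoare_mono[OF while]) (simp_all add: algebra_simps)
    then have "hoare W (cost (Lit 0) + 1) (assign x (Lit 0)) \<rho> \<mu>
       (\<lambda>\<rho>' \<mu>' (_::unit). hoare W (n * (B + length cs + 20) + 8) (while_expr ?e
         (cs @ ?inc)) \<rho>' \<mu>'
          (I n) (foldM f [0..<n] a)) (return_spmf ())"
      by (intro hoare_assign[where X = X]) (use W0 xb in auto)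
    then show "hoare W 2 (assign x (Lit 0)) \<rho> \<mu>
       (\<lambda>\<rho>' \<mu>' (_::unit). hoare W (n * (B + length cs + 20) + 8) (while_expr ?e
         (cs @ ?inc)) \<rho>' \<mu>'
          (I n) (foldM f [0..<n] a)) (return_spmf ())"
      by (simp add: numeral_2_eq_2)
  qed
  then show ?thesis by (rule hoare_mono) auto
qed

section \<open>Running a data structure inside another program\<close>

text \<open>
  The registers of the simulated machine are the host registers from 32 on, its memory starts at
  the address in host register 30, and host register 31 is scratch. The host's own variables are
  the registers below 31. Between calls, the simulated registers are kept in memory at the address
  in host register 11.
\<close>

fun relocate :: "com \<Rightarrow> com" where
  "relocate Skip = Skip"
| "relocate (Const r k) = Const (r + 32) k"
| "relocate (Op f r x y) = Op f (r + 32) (x + 32) (y + 32)"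
| "relocate (Load r x) = Seq (Op Add 31 (x + 32) 30) (Load (r + 32) 31)"
| "relocate (Store x y) = Seq (Op Add 31 (x + 32) 30) (Store 31 (y + 32))"
| "relocate (Rand r x) = Rand (r + 32) (x + 32)"
| "relocate (Seq c1 c2) = Seq (relocate c1) (relocate c2)"
| "relocate (IfNZ x c1 c2) = IfNZ (x + 32) (relocate c1) (relocate c2)"
| "relocate (WhileNZ x c) = WhileNZ (x + 32) (relocate c)"

fun regs_below :: "nat \<Rightarrow> com \<Rightarrow> bool" where
  "regs_below R Skip \<longleftrightarrow> True"
| "regs_below R (Const r k) \<longleftrightarrow> r < R"
| "regs_below R (Op f r x y) \<longleftrightarrow> r < R \<and> x < R \<and> y < R"
| "regs_below R (Load r x) \<longleftrightarrow> r < R \<and> x < R"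
| "regs_below R (Store x y) \<longleftrightarrow> x < R \<and> y < R"
| "regs_below R (Rand r x) \<longleftrightarrow> r < R \<and> x < R"
| "regs_below R (Seq c1 c2) \<longleftrightarrow> regs_below R c1 \<and> regs_below R c2"
| "regs_below R (IfNZ x c1 c2) \<longleftrightarrow> x < R \<and> regs_below R c1 \<and>
  regs_below R c2"
| "regs_below R (WhileNZ x c) \<longleftrightarrow> x < R \<and> regs_below R c"

lemma regs_below_mono: "regs_below R c \<Longrightarrow> R \<le> R' \<Longrightarrow>
  regs_below R' c"
  by (induction c) auto

text \<open>A program is a finite term, so the number of registers to be saved is a constant that
  can be compiled into the host.\<close>

lemma ex_regs_below: "\<exists>R. regs_below R c"
proof (induction c)
  case (Op f r x y)
  show ?case by (rule exI[of _ "Suc (r + x + y)"]) auto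
next
  case (Load r x)
  show ?case by (rule exI[of _ "Suc (r + x)"]) auto
next
  case (Store r x)
  show ?case by (rule exI[of _ "Suc (r + x)"]) auto
next
  case (Rand r x)
  show ?case by (rule exI[of _ "Suc (r + x)"]) auto
next
  case (Seq c1 c2)
  then obtain R1 R2 where "regs_below R1 c1" "regs_below R2 c2" by blast
  then show ?case by (intro exI[of _ "R1 + R2"]) (auto intro: regs_below_mono)
next
  case (IfNZ x c1 c2)
  then obtain R1 R2 where "regs_below R1 c1" "regs_below R2 c2" by blast
  then show ?case by (intro exI[of _ "R1 + R2 + Suc x"]) (auto intro: regs_below_mono)
next
  case (WhileNZ x c)
  then obtain R where "regs_below R c" by blast
  then show ?case by (intro exI[of _ "R + Suc x"]) (auto intro: regs_below_mono)
qed auto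

text \<open>\<open>S0\<close> is the host state at the beginning of the call and serves as reference
  for the frame. The window has length \<open>W\<close> because addresses come from registers and
  these hold words; this is why the bound on the registers is part of the relation.\<close>

definition embeds :: "nat \<Rightarrow> nat \<Rightarrow> nat \<Rightarrow> state \<Rightarrow>
  state \<Rightarrow> state \<Rightarrow> bool" where
  "embeds W R b s S0 S \<longleftrightarrow>
    (\<forall>x<R. regs S (x + 32) = regs s x \<and> regs s x < W) \<and>
      (\<forall>a<W. mem S (b + a) = mem s a) \<and>
    (\<forall>y<31. regs S y = regs S0 y) \<and> (\<forall>z. z < b \<or>
      b + W \<le> z \<longrightarrow> mem S z = mem S0 z)"

lemma embeds_set_reg:
  "embeds W R b s S0 S \<Longrightarrow> r < R \<Longrightarrow> v < W \<Longrightarrow>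
   embeds W R b (s\<lparr>regs := (regs s)(r := v)\<rparr>) S0 (S\<lparr>regs :=
     (regs S)(r + 32 := v)\<rparr>)"
  by (auto simp: embeds_def)

lemma embeds_scratch:
  "embeds W R b s S0 S \<Longrightarrow> embeds W R b s S0 (S\<lparr>regs :=
    (regs S)(31 := v)\<rparr>)"
  by (auto simp: embeds_def)

lemma embeds_set_mem:
  "embeds W R b s S0 S \<Longrightarrow> a < W \<Longrightarrow>
   embeds W R b (s\<lparr>mem := (mem s)(a := v)\<rparr>) S0 (S\<lparr>mem :=
     (mem S)(b + a := v)\<rparr>)"
  by (auto simp: embeds_def)

text \<open>Losslessness of the simulated step excludes overflow and draws from an empty range, so
  results are words of the small machine and, even shifted by \<open>b\<close>, of the host. The
  three steps are one \<open>Seq\<close>, the address computation and the access.\<close>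

lemma relocate_step:
  assumes ll: "lossless_spmf (step W c K s)" and R: "regs_below R c"
    and E: "embeds W R b s S0 S" and b: "regs S0 30 = b" and W': "b + W \<le> W'"
    and c: "\<And>c1 c2. c \<noteq> Seq c1 c2" "\<And>x c1 c2. c \<noteq> IfNZ x c1 c2" "\<And>x c'.
      c \<noteq> WhileNZ x c'"
  shows "simulates W' 3 [relocate c] S (\<lambda>S' (K', s'). K' = K \<and>
    embeds W R b s' S0 S') (step W c K s)"
proof -
  have r: "regs S (x + 32) = regs s x" "regs s x < W" if "x < R" for x
    using E that by (auto simp: embeds_def)
  have m: "mem S (a + b) = mem s a" if "a < W" for a
    using E that by (auto simp: embeds_def add.commute)
  have b': "regs S 30 = b" using E b by (auto simp: embeds_def)
  have WW': "v < W \<Longrightarrow> v < W'" "v < W \<Longrightarrow> v + b < W'" for v using W'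
    by auto
  show ?thesis
  proof (cases c)
    case Skip
    then show ?thesis using E by (simp add: simulates_def numeral_3_eq_3)
  next
    case (Const r k)
    then show ?thesis using ll R E WW'
      by (auto simp: simulates_def numeral_3_eq_3 set_reg_def split: if_splits intro!:
        embeds_set_reg)
  next
    case (Op f q x y)
    then show ?thesis using ll R E WW' r
      by (auto simp: simulates_def numeral_3_eq_3 set_reg_def split: if_splits intro!:
        embeds_set_reg)
  next
    case (Load q x)
    then have "regs s x + b < W'" "mem s (regs s x) < W" "regs S (x + 32) = regs s x"
       "mem S (regs s x + b) = mem s (regs s x)"
      using ll R WW' r[of x] m[of "regs s x"] by (auto simp: set_reg_def split: if_splits)
    moreover have "embeds W R b (s\<lparr>regs := (regs s)(q := v)\<rparr>) S0
        (S\<lparr>regs := (regs S)(31 := u, q + 32 := v)\<rparr>)" if "v < W" for u v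
      using embeds_set_reg[OF embeds_scratch[OF E] _ that, of q u] R Load by simp
    ultimately show ?thesis using Load WW' b'
      by (auto simp: simulates_def numeral_3_eq_3 set_reg_def)
  next
    case (Store x y)
    then have *: "regs s x + b < W'" "regs S (x + 32) = regs s x" "regs S
      (y + 32) = regs s y" "regs s x < W"
      using R WW' r by auto
    have "embeds W R b (s\<lparr>mem := (mem s)(regs s x := regs s y)\<rparr>) S0
     (S\<lparr>regs := (regs S)(31 := regs s x + b), mem :=
       (mem S)(regs s x + b := regs s y)\<rparr>)"
      using embeds_set_mem[OF embeds_scratch[OF E] *(4)] by (simp add: add.commute)
    then show ?thesis using Store E b' *
      by (auto simp: simulates_def numeral_3_eq_3 set_reg_def)
  next
    case (Rand q x)
    then have x: "regs s x \<noteq> 0" "regs S (x + 32) = regs s x" "regs s x < W" "q < R"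
      using ll R r by (auto split: if_splits)
    then have v: "v < W" "v < W'" if "v < regs s x" for v using that WW' by (meson less_trans)+
    have "rel_spmf (\<lambda>(S', _) (K', s'). K' = K \<and> embeds W R b s' S0 S')
      (spmf_of_set {..<regs s x} \<bind> (\<lambda>v. return_spmf (S\<lparr>regs :=
        (regs S)(q + 32 := v)\<rparr>, 2::nat)))
      (spmf_of_set {..<regs s x} \<bind> (\<lambda>v. return_spmf (K, s\<lparr>regs :=
        (regs s)(q := v)\<rparr>)))"
      by (rule rel_spmf_bind_reflI) (use x v E in \<open>auto intro!: embeds_set_reg\<close>)
    moreover have "run W' 3 ([relocate c], S) =
      spmf_of_set {..<regs s x} \<bind> (\<lambda>v. return_spmf (S\<lparr>regs :=
        (regs S)(q + 32 := v)\<rparr>, 2::nat))"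
      using x v unfolding Rand
      by (auto simp: numeral_3_eq_3 numeral_2_eq_2 set_reg_def intro!: bind_spmf_cong)
    moreover have "step W c K s =
      spmf_of_set {..<regs s x} \<bind> (\<lambda>v. return_spmf (K, s\<lparr>regs :=
        (regs s)(q := v)\<rparr>))"
      using x v unfolding Rand by (auto simp: set_reg_def intro!: bind_spmf_cong)
    ultimately show ?thesis using ll unfolding simulates_def by simp
  qed (use c in auto)
qed

lemma relocate_run:
  assumes "lossless_spmf (run W t (K, s))" "list_all (regs_below R) K"
    and "embeds W R b s S0 S" and b: "regs S0 30 = b" and W': "b + W \<le> W'"
  shows "simulates W' (3 * t) (map relocate K) S (\<lambda>S' (s', _). embeds W R b s' S0 S')
    (run W t (K, s))"
  using assms(1-3)
proof (induction t arbitrary: K s S)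
  case 0
  then show ?case by (cases K) (auto intro: simulates_Nil)
next
  case (Suc t)
  show ?case
  proof (cases K)
    case Nil
    then show ?thesis using Suc.prems by (auto intro: simulates_Nil)
  next
    case (Cons c K')
    have ll: "lossless_spmf (step W c K' s)"
      and ll': "\<And>k s'. (k, s') \<in> set_spmf (step W c K' s) \<Longrightarrow>
        lossless_spmf (run W t (k, s'))"
      using Suc.prems(1) Cons by auto
    have below: "regs_below R c" "list_all (regs_below R) K'" using Suc.prems Cons by auto
    \<comment> \<open>Control flow only rearranges the stack, in the same way on both sides, and
      costs a single step; two of the three budgeted steps remain.\<close>
    have control: ?thesis
      if step: "step W c K' s = return_spmf (k, s)" "step W' (relocate c)
        (map relocate K') S = return_spmf (map relocate k, S)"
        and k: "list_all (regs_below R) k" for k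
    proof -
      have "simulates W' (3 * t) (map relocate k) S (\<lambda>S' (s', _). embeds W R b s' S0 S')
        (run W t (k, s))"
        by (rule Suc.IH) (use ll' step k Suc.prems in auto)
      then have "simulates W' (3 * t + 2) (map relocate k) S (\<lambda>S'
        (s', _). embeds W R b s' S0 S') (run W t (k, s))"
        by (rule simulates_mono) auto
      moreover have "3 * Suc t = Suc (3 * t + 2)" "map relocate K = relocate c # map relocate K'"
        using Cons by simp_all
      then have "run W' (3 * Suc t) (map relocate K, S) = run W' (3 * t + 2) (map relocate k, S)"
        by (simp only: run.simps step(2) return_bind_spmf)
      moreover have "run W (Suc t) (K, s) = run W t (k, s)" using step(1) Cons by simp
      ultimately show ?thesis unfolding simulates_def by simp
    qed
    have simple: ?thesis if "simulates W' 3 [relocate c] S (\<lambda>S' (K'', s'). K'' = K' \<and>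
      embeds W R b s' S0 S') (step W c K' s)"
    proof -
      have "simulates W' (3 + 3 * t) ([relocate c] @ map relocate K') S (\<lambda>S'
        (s', _). embeds W R b s' S0 S')
        (bind_spmf (step W c K' s) (run W t))"
        by (rule simulates_append[OF that]) (auto intro!: Suc.IH simp: ll' below)
      then show ?thesis unfolding Cons by simp
    qed
    show ?thesis
    proof (cases "(\<exists>c1 c2. c = Seq c1 c2) \<or> (\<exists>x c1 c2. c = IfNZ x c1 c2) \<or>
      (\<exists>x c'. c = WhileNZ x c')")
      case False
      then show ?thesis
        by (intro simple relocate_step[OF ll below(1) Suc.prems(3) b W']) auto
    next
      case True
      have r: "regs S (x + 32) = regs s x" if "x < R" for x
        using Suc.prems(3) that by (auto simp: embeds_def)
      from True show ?thesis
      proof (elim disjE exE)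
        fix c1 c2 assume "c = Seq c1 c2"
        then show ?thesis using below by (intro control[of "c1 # c2 # K'"]) auto
      next
        fix x c1 c2 assume "c = IfNZ x c1 c2"
        then show ?thesis using below r by (intro control[of "(if regs s x \<noteq> 0 then c1 else
          c2) # K'"]) auto
      next
        fix x c1 assume "c = WhileNZ x c1"
        then show ?thesis using below r
          by (intro control[of "if regs s x \<noteq> 0 then c1 # WhileNZ x c1 # K' else K'"]) auto
      qed
    qed
  qed
qed

section \<open>Saving and restoring the registers of a simulated machine\<close>

definition restore_regs :: "nat \<Rightarrow> com list" where
  "restore_regs R = concat (map (\<lambda>x. [Const 31 x, Op Add 31 31 11, Load
    (x + 32) 31]) [0..<R])"

definition save_regs :: "nat \<Rightarrow> com list" where
  "save_regs R = concat (map (\<lambda>x. [Const 31 x, Op Add 31 31 11, Store 31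
    (x + 32)]) [0..<R])"

lemma simulates_restore_regs:
  assumes "regs S 11 + R \<le> W" "\<forall>x<R. mem S (regs S 11 + x) < W"
  shows "simulates W (3 * R) (restore_regs R) S (\<lambda>S' (_::unit). mem S' = mem S \<and>
    (\<forall>y<31. regs S' y = regs S y) \<and> (\<forall>x<R. regs S' (x + 32) = mem S
      (regs S 11 + x))) (return_spmf ())"
  using assms
proof (induction R)
  case 0
  then show ?case by (simp add: restore_regs_def simulates_Nil)
next
  case (Suc R)
  have eq: "restore_regs (Suc R) = restore_regs R @ [Const 31 R, Op Add 31 31 11, Load (R + 32) 31]"
    "3 * Suc R = 3 * R + 3"
    by (simp_all add: restore_regs_def)
  show ?case
    unfolding eq
  proof (rule simulates_append_det, rule simulates_mono[OF Suc.IH order.refl])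
    fix S1 :: state and u :: unit
    assume 1: "mem S1 = mem S \<and> (\<forall>y<31. regs S1 y = regs S y) \<and>
      (\<forall>x<R. regs S1 (x + 32) = mem S (regs S 11 + x))"
    have "regs S1 11 = regs S 11" "R < W" "R + regs S 11 < W" "mem S (R + regs S 11) < W"
      using 1 Suc.prems by (auto simp: add.commute)
    then show "simulates W 3 [Const 31 R, Op Add 31 31 11, Load (R + 32) 31] S1
      (\<lambda>S' _. mem S' = mem S \<and> (\<forall>y<31. regs S' y = regs S y) \<and>
        (\<forall>x<Suc R. regs S' (x + 32) = mem S (regs S 11 + x))) (return_spmf ())"
      using 1 by (auto simp: simulates_def set_reg_def numeral_3_eq_3 add.commute less_Suc_eq)
  qed (use Suc.prems in auto)
qed

lemma simulates_save_regs:
  assumes "regs S 11 + R \<le> W"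
  shows "simulates W (3 * R) (save_regs R) S (\<lambda>S' (_::unit).
    (\<forall>y. y \<noteq> 31 \<longrightarrow> regs S' y = regs S y) \<and>
    mem S' = (\<lambda>z. if regs S 11 \<le> z \<and> z < regs S 11 + R then regs S
      (z - regs S 11 + 32) else mem S z))
    (return_spmf ())"
  using assms
proof (induction R)
  case 0
  then show ?case by (auto simp: save_regs_def intro!: simulates_Nil)
next
  case (Suc R)
  have eq: "save_regs (Suc R) = save_regs R @ [Const 31 R, Op Add 31 31 11, Store 31 (R + 32)]"
    "3 * Suc R = 3 * R + 3"
    by (simp_all add: save_regs_def)
  show ?case
    unfolding eq
  proof (rule simulates_append_det, rule simulates_mono[OF Suc.IH order.refl])
    fix S1 :: state and u :: unit
    assume 1: "(\<forall>y. y \<noteq> 31 \<longrightarrow> regs S1 y = regs S y) \<and>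
      mem S1 = (\<lambda>z. if regs S 11 \<le> z \<and> z < regs S 11 + R then regs S
        (z - regs S 11 + 32) else mem S z)"
    have "regs S1 11 = regs S 11" "R < W" "R + regs S 11 < W" "regs S1 (R + 32) = regs S (R + 32)"
      using 1 Suc.prems by auto
    then show "simulates W 3 [Const 31 R, Op Add 31 31 11, Store 31 (R + 32)] S1
      (\<lambda>S' _. (\<forall>y. y \<noteq> 31 \<longrightarrow> regs S' y = regs S y) \<and>
       mem S' = (\<lambda>z. if regs S 11 \<le> z \<and> z < regs S 11 + Suc R then regs S
         (z - regs S 11 + 32) else mem S z))
      (return_spmf ())"
      using 1 by (auto simp: simulates_def set_reg_def numeral_3_eq_3 fun_eq_iff less_Suc_eq)
  qed (use Suc.prems in auto)
qed

definition call :: "nat \<Rightarrow> com \<Rightarrow> com list" where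
  "call R c = restore_regs R @ [relocate c] @ save_regs R"

text \<open>Registers from \<open>R\<close> on and cells from \<open>W\<close> on are left out: the
  program does not name the former, and addresses are words below \<open>W\<close>.\<close>

definition boxed :: "nat \<Rightarrow> nat \<Rightarrow> nat \<Rightarrow> nat \<Rightarrow> state
  \<Rightarrow> (nat \<Rightarrow> nat) \<Rightarrow> bool" where
  "boxed W R b b' s \<mu> \<longleftrightarrow>
    (\<forall>x<R. \<mu> (b + x) = regs s x \<and> regs s x < W) \<and>
      (\<forall>a<W. \<mu> (b' + a) = mem s a)"

text \<open>The factor 3 comes from relocation, and \<open>6 * R\<close> pays for copying
  \<open>R\<close> registers in and out with three instructions each. The frame is what lets other
  copies survive the call.\<close>

lemma hoare_call:
  assumes box: "boxed W R (\<rho> 11) (\<rho> 30) s \<mu>" and ll: "lossless_spmf (exec W t c s)"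
    and R: "regs_below R c" and sep: "\<rho> 11 + R \<le> \<rho> 30" and
      W': "\<rho> 30 + W \<le> W'"
  shows "hoare W' (3 * t + 6 * R) (call R c) \<rho> \<mu>
    (\<lambda>\<rho>' \<mu>' s'. \<rho>' = \<rho> \<and>
      boxed W R (\<rho> 11) (\<rho> 30) s' \<mu>' \<and>
      (\<forall>z. \<not> (\<rho> 11 \<le> z \<and> z < \<rho> 11 + R) \<and>
        \<not> (\<rho> 30 \<le> z \<and> z < \<rho> 30 + W) \<longrightarrow> \<mu>' z = \<mu> z))
    (exec W t c s)"
  unfolding hoare_def
proof (intro allI impI)
  fix S :: state assume S: "mem S = \<mu>" "low (regs S) = \<rho>"
  have r11: "regs S 11 = \<rho> 11" and r30: "regs S 30 = \<rho> 30" using S by (auto simp: low_def)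
  have lw: "low (regs S') = \<rho>" if "\<forall>y<31. regs S' y = regs S y" for S' :: state
    using that S by (auto simp: low_def)
  have fit: "\<forall>x<R. mem S (regs S 11 + x) < W'" "regs S 11 + R \<le> W'"
    using box S W' sep unfolding r11 boxed_def by auto
  let ?Q = "\<lambda>S' s'. low (regs S') = \<rho> \<and>
    boxed W R (\<rho> 11) (\<rho> 30) s' (mem S') \<and>
      (\<forall>z. \<not> (\<rho> 11 \<le> z \<and> z < \<rho> 11 + R) \<and>
        \<not> (\<rho> 30 \<le> z \<and> z < \<rho> 30 + W) \<longrightarrow> mem S' z = \<mu> z)"
  have "simulates W' (3 * R + (3 * t + 3 * R)) (restore_regs R @ [relocate c] @ save_regs R) S ?Q
    (exec W t c s)"
  proof (rule simulates_append_det, rule simulates_mono[OF simulates_restore_regs[OF fit(2,1)]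
    order.refl])
    fix S1 :: state and u :: unit
    assume 1: "mem S1 = mem S \<and> (\<forall>y<31. regs S1 y = regs S y) \<and>
      (\<forall>x<R. regs S1 (x + 32) = mem S (regs S 11 + x))"
    have E: "embeds W R (\<rho> 30) s S1 S1"
      using box 1 S unfolding embeds_def boxed_def r11 by auto
    have "simulates W' (3 * t) (map relocate [c]) S1 (\<lambda>S' (s', _). embeds W R
      (\<rho> 30) s' S1 S') (run W t ([c], s))"
      by (rule relocate_run) (use ll R E W' 1 r30 in \<open>auto simp: exec_def\<close>)
    moreover have "simulates W' (3 * R) (save_regs R) S2 ?Q (return_spmf (fst sl))"
      if E2: "(\<lambda>(s', _). embeds W R (\<rho> 30) s' S1 S2) sl"
        for S2 and sl :: "state \<times> nat"
    proof -
      obtain s' l where sl: "sl = (s', l)" by force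
      have r2: "\<forall>y<31. regs S2 y = regs S y" using E2 1 by (auto simp: embeds_def sl)
      then have r2': "regs S2 11 = \<rho> 11" using r11 by simp
      have "simulates W' (3 * R) (save_regs R) S2 (\<lambda>S' (_::unit). ?Q S' s') (return_spmf
        ())"
      proof (rule simulates_mono[OF simulates_save_regs order.refl])
        show "regs S2 11 + R \<le> W'" using r2' r11 fit by simp
        fix S3 :: state and u :: unit
        assume 3: "(\<forall>y. y \<noteq> 31 \<longrightarrow> regs S3 y = regs S2 y) \<and>
          mem S3 = (\<lambda>z. if regs S2 11 \<le> z \<and> z < regs S2 11 + R then regs S2
            (z - regs S2 11 + 32) else mem S2 z)"
        have "low (regs S3) = \<rho>" using 3 r2 by (intro lw) auto
        moreover have "boxed W R (\<rho> 11) (\<rho> 30) s' (mem S3)"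
          using 3 E2 sep unfolding r2' boxed_def embeds_def sl by auto
        moreover have "mem S3 z = \<mu> z"
          if "\<not> (\<rho> 11 \<le> z \<and> z < \<rho> 11 + R)" "\<not> (\<rho> 30 \<le> z \<and>
            z < \<rho> 30 + W)" for z
          using that 3 E2 1 S unfolding r2' embeds_def sl by auto
        ultimately show "?Q S3 s'" by blast
      qed
      from simulates_append[OF this, of 0 "[]" ?Q "\<lambda>_. return_spmf s'"] show ?thesis
        by (simp add: simulates_Nil sl)
    qed
    ultimately have "simulates W' (3 * t + 3 * R) (map relocate [c] @ save_regs R) S1 ?Q
      (bind_spmf (run W t ([c], s)) (\<lambda>sl. return_spmf (fst sl)))"
      by (rule simulates_append)
    then show "simulates W' (3 * t + 3 * R) ([relocate c] @ save_regs R) S1 ?Q (exec W t c s)"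
      by (simp add: exec_def map_spmf_conv_bind_spmf)
  qed
  then show "simulates W' (3 * t + 6 * R) (call R c) S (\<lambda>S' s'. low
    (regs S') = \<rho> \<and>
      boxed W R (\<rho> 11) (\<rho> 30) s' (mem S') \<and>
      (\<forall>z. \<not> (\<rho> 11 \<le> z \<and> z < \<rho> 11 + R) \<and>
        \<not> (\<rho> 30 \<le> z \<and> z < \<rho> 30 + W) \<longrightarrow> mem S' z = \<mu> z))
    (exec W t c s)"
    unfolding call_def by (rule simulates_mono) auto
qed

section \<open>Independent repetitions\<close>

lemma foldM_single [simp]: "foldM f [x] = f x"
proof
  have "foldM f [] = return_spmf" by (rule ext) simp
  then show "foldM f [x] a = f x a" for a by simp
qed

text \<open>Appending at the end matches the order in which the host's loops produce results, so
  that \<open>hoare_for\<close> applies directly.\<close>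

definition seqn :: "nat \<Rightarrow> (nat \<Rightarrow> 'a spmf) \<Rightarrow> 'a list spmf" where
  "seqn n p = foldM (\<lambda>i xs. map_spmf (\<lambda>x. xs @ [x]) (p i)) [0..<n] []"

lemma seqn_0 [simp]: "seqn 0 p = return_spmf []"
  by (simp add: seqn_def)

lemma seqn_Suc: "seqn (Suc n) p = bind_spmf (seqn n p) (\<lambda>xs. map_spmf
  (\<lambda>x. xs @ [x]) (p n))"
  unfolding seqn_def by (simp add: foldM_append)

lemma set_seqnD:
  "xs \<in> set_spmf (seqn n p) \<Longrightarrow> length xs = n \<and>
    (\<forall>i<n. xs ! i \<in> set_spmf (p i))"
proof (induction n arbitrary: xs)
  case (Suc n)
  then show ?case by (auto simp: seqn_Suc nth_append less_Suc_eq set_bind_spmf bind_UNION)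
qed simp

lemma lossless_seqn: "(\<And>i. i < n \<Longrightarrow> lossless_spmf (p i)) \<Longrightarrow>
  lossless_spmf (seqn n p)"
  by (induction n) (auto simp: seqn_Suc)

lemma seqn_cong: "(\<And>i. i < n \<Longrightarrow> p i = q i) \<Longrightarrow>
  seqn n p = seqn n q"
  by (induction n) (auto simp: seqn_Suc)

text \<open>Draws for different indices commute, so phases may be regrouped index by index. This is
  what later separates interleaved rounds into independent runs.\<close>

lemma seqn_bind:
  "bind_spmf (seqn n p) (\<lambda>xs. seqn n (\<lambda>i. f i (xs ! i))) = seqn n
    (\<lambda>i. bind_spmf (p i) (f i))"
proof (induction n)
  case (Suc n)
  have "bind_spmf (seqn (Suc n) p) (\<lambda>xs. seqn (Suc n) (\<lambda>i. f i (xs ! i))) =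
    bind_spmf (seqn n p) (\<lambda>xs. bind_spmf (p n) (\<lambda>x. bind_spmf (seqn n
      (\<lambda>i. f i (xs ! i)))
      (\<lambda>ys. map_spmf (\<lambda>y. ys @ [y]) (f n x))))"
    unfolding seqn_Suc bind_spmf_assoc bind_map_spmf o_def
    by (intro bind_spmf_cong refl arg_cong2[where f = bind_spmf] seqn_cong)
      (auto dest!: set_seqnD simp: nth_append)
  \<comment> \<open>The draw from \<open>p n\<close> moves past the second phase of the earlier
    indices, which does not depend on it.\<close>
  also have "\<dots> = bind_spmf (seqn n p) (\<lambda>xs. bind_spmf (seqn n (\<lambda>i. f i
    (xs ! i)))
      (\<lambda>ys. bind_spmf (p n) (\<lambda>x. map_spmf (\<lambda>y. ys @ [y]) (f n x))))"
    by (intro bind_spmf_cong refl bind_commute_spmf)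
  also have "\<dots> = bind_spmf (seqn n (\<lambda>i. bind_spmf (p i) (f i)))
      (\<lambda>ys. bind_spmf (p n) (\<lambda>x. map_spmf (\<lambda>y. ys @ [y]) (f n x)))"
    by (simp add: Suc.IH flip: bind_spmf_assoc)
  also have "\<dots> = seqn (Suc n) (\<lambda>i. bind_spmf (p i) (f i))"
    by (simp add: seqn_Suc map_spmf_bind_spmf o_def)
  finally show ?case .
qed simp

lemma seqn_return: "seqn n (\<lambda>i. return_spmf (g i)) = return_spmf (map g [0..<n])"
  by (induction n) (auto simp: seqn_Suc)

lemma seqn_map:
  "seqn n (\<lambda>i. map_spmf (h i) (p i)) = map_spmf (\<lambda>xs. map (\<lambda>i. h i
    (xs ! i)) [0..<n]) (seqn n p)"
  using seqn_bind[of n p "\<lambda>i x. return_spmf (h i x)"]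
  by (simp add: seqn_return map_spmf_conv_bind_spmf)

text \<open>A crude binomial tail: there are at most \<open>2 ^ card I\<close> sets of failing
  indices, and any \<open>h\<close> given indices fail together with probability at most
  \<open>\<delta> ^ h\<close>. The induction follows Pascal's recursion, bounding \<open>h\<close>
  failures among \<open>n + 1\<close> draws by \<open>h\<close> among \<open>n\<close>, plus
  \<open>\<delta>\<close> times \<open>h - 1\<close> among \<open>n\<close>. The set
  \<open>I\<close> will be the copies of a single block.\<close>

lemma many_failures:
  assumes "\<And>j. j < n \<Longrightarrow> j \<in> I \<Longrightarrow>
    measure (measure_spmf (p j)) (bad j) \<le> \<delta>" and "0 \<le> \<delta>"
  shows "measure (measure_spmf (seqn n p)) {xs. h \<le> card {j \<in> I. j < n \<and>
    xs ! j \<in> bad j}}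
    \<le> 2 ^ card (I \<inter> {..<n}) * \<delta> ^ h"
  using assms(1)
proof (induction n arbitrary: h)
  case 0
  show ?case
  proof (cases h)
    case 0
    then show ?thesis using measure_spmf.subprob_measure_le_1[of _ "{}"]
      by (simp add: measure_spmf.subprob_measure_le_1)
  qed (use \<open>0 \<le> \<delta>\<close> in simp)
next
  case (Suc n)
  let ?B = "\<lambda>n h. {xs. h \<le> card {j \<in> I. j < n \<and> xs ! j \<in> bad j}}"
  let ?m = "\<lambda>p. measure (measure_spmf p)"
  have IH: "?m (seqn n p) (?B n h) \<le> 2 ^ card (I \<inter> {..<n}) * \<delta> ^ h" for h
    by (rule Suc.IH) (use Suc.prems in auto)
  have count: "card {j \<in> I. j < Suc n \<and> (xs @ [x]) ! j \<in> bad j} =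
      card {j \<in> I. j < n \<and> xs ! j \<in> bad j} + of_bool (n \<in> I \<and>
        x \<in> bad n)" if "length xs = n" for xs x
  proof -
    have "{j \<in> I. j < Suc n \<and> (xs @ [x]) ! j \<in> bad j} =
      {j \<in> I. j < n \<and> xs ! j \<in> bad j} \<union> (if n \<in> I \<and>
        x \<in> bad n then {n} else {})"
      using that by (auto simp: nth_append less_Suc_eq)
    then show ?thesis by (simp add: card_insert_if)
  qed
  show ?case
  proof (cases h)
    case 0
    have "1 \<le> (2::real) ^ card (I \<inter> {..<Suc n})" by simp
    then show ?thesis using 0 by (simp add: order.trans[OF measure_spmf.subprob_measure_le_1])
  next
    case (Suc h')
    have int: "I \<inter> {..<Suc n} = I \<inter> {..<n} \<union> (if n \<in> I then {n} else {})"
      by (auto simp: less_Suc_eq)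
    let ?\<delta> = "if n \<in> I then \<delta> else 0"
    have "emeasure (measure_spmf (seqn (Suc n) p)) (?B (Suc n) h) =
      (\<integral>\<^sup>+ xs. emeasure (measure_spmf (map_spmf (\<lambda>x. xs @ [x]) (p n))) (?B
        (Suc n) h) \<partial>measure_spmf (seqn n p))"
      unfolding seqn_Suc by (simp add: measure_spmf_bind o_def emeasure_bind[where N = "count_space
        UNIV"]
          space_measure_spmf space_subprob_algebra)
    also have "\<dots> \<le> (\<integral>\<^sup>+ xs. indicator
      (?B n h) xs + ennreal ?\<delta> * indicator (?B n h') xs \<partial>measure_spmf (seqn n p))"
    proof (rule nn_integral_mono_AE, unfold AE_measure_spmf_iff, rule ballI)
      fix xs assume "xs \<in> set_spmf (seqn n p)"
      then have len: "length xs = n" by (auto dest: set_seqnD)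
      have eq: "emeasure (measure_spmf (map_spmf (\<lambda>x. xs @ [x]) (p n))) (?B (Suc n) h) =
        emeasure (measure_spmf (p n)) {x. xs @ [x] \<in> ?B (Suc n) h}"
        by (simp add: emeasure_map_spmf vimage_def)
      \<comment> \<open>Either \<open>h\<close> failures occurred before the last draw, or exactly
        one fewer and the last draw has to fail, or \<open>h\<close> is out of reach.\<close>
      consider "xs \<in> ?B n h" | "xs \<notin> ?B n h" "xs \<in> ?B n h'" | "xs \<notin> ?B n h'"
        by blast
      then show "emeasure (measure_spmf (map_spmf (\<lambda>x. xs @ [x]) (p n))) (?B (Suc n) h)
         \<le> indicator (?B n h) xs + ennreal ?\<delta> * indicator (?B n h') xs"
      proof cases
        case 1
        then show ?thesis
          unfolding eq by (simp add: add_increasing2 measure_spmf.subprob_emeasure_le_1)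
      next
        case 2
        then have "{x. xs @ [x] \<in> ?B (Suc n) h} = (if n \<in> I then bad n else {})"
          using Suc by (auto simp: count[OF len] split: if_splits)
        then show ?thesis
          unfolding eq using 2 Suc.prems[of n]
          by (auto simp: measure_spmf.emeasure_eq_measure intro!: ennreal_leI)
      next
        case 3
        then have "{x. xs @ [x] \<in> ?B (Suc n) h} = {}"
          using Suc by (auto simp: count[OF len])
        then show ?thesis unfolding eq by simp
      qed
    qed
    also have "\<dots> = ennreal (?m (seqn n p) (?B n h) + ?\<delta> * ?m (seqn n p) (?B n h'))"
      using assms(2)
      by (simp add: nn_integral_add nn_integral_cmult measure_spmf.emeasure_eq_measure
          ennreal_mult ennreal_plus)
    finally have "ennreal (?m (seqn (Suc n) p) (?B (Suc n) h)) \<le>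
        ennreal (?m (seqn n p) (?B n h) + ?\<delta> * ?m (seqn n p) (?B n h'))"
      by (simp only: measure_spmf.emeasure_eq_measure)
    then have "?m (seqn (Suc n) p) (?B (Suc n) h) \<le> ?m (seqn n p) (?B n h) + ?\<delta> * ?m
      (seqn n p) (?B n h')"
      by (subst (asm) ennreal_le_iff) (use assms(2) in auto)
    also have "\<dots> \<le> 2 ^ card (I \<inter> {..<n}) * \<delta> ^ h + ?\<delta> * (2 ^ card
      (I \<inter> {..<n}) * \<delta> ^ h')"
      using assms(2) by (intro add_mono mult_left_mono IH) auto
    also have "\<dots> = 2 ^ card (I \<inter> {..<Suc n}) * \<delta> ^ h"
      unfolding int Suc by (simp add: card_insert_if)
    finally show ?thesis .
  qed
qed

section \<open>Interleaving the runs of several machines\<close>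

fun run_chunks :: "('o \<Rightarrow> 's \<Rightarrow>
  ('a \<times> 's) spmf) \<Rightarrow> 'o list \<Rightarrow> 's \<Rightarrow> 'a list spmf" where
  "run_chunks g [] s = return_spmf []"
| "run_chunks g (c # cs) s = bind_spmf (g c s) (\<lambda>(a, s'). map_spmf ((#) a)
  (run_chunks g cs s'))"

text \<open>The online order: every machine finishes its part of a round before any machine begins
  the next round.\<close>

fun run_parallel ::
  "nat \<Rightarrow> ('o \<Rightarrow> 's \<Rightarrow> ('a \<times> 's) spmf) \<Rightarrow>
    (nat \<Rightarrow> 'o) list \<Rightarrow> 's list \<Rightarrow> 'a list list spmf" where
  "run_parallel J g [] ss = return_spmf []"
| "run_parallel J g (c # cs) ss = bind_spmf (seqn J (\<lambda>j. g (c j) (ss ! j)))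
     (\<lambda>xs. map_spmf ((#) (map fst xs)) (run_parallel J g cs (map snd xs)))"

text \<open>The parts handed to machine \<open>j\<close> are fixed beforehand and do not react to
  answers. So \<open>seqn_bind\<close> peels off one round at a time, and what remains is a table of
  independent complete runs, read round by round instead of machine by machine.\<close>

lemma run_parallel_conv_seqn:
  assumes "length ss = J"
  shows "run_parallel J g cs ss =
    map_spmf (\<lambda>L. map (\<lambda>i. map (\<lambda>j. L ! j ! i) [0..<J]) [0..<length cs])
      (seqn J (\<lambda>j. run_chunks g (map (\<lambda>c. c j) cs) (ss ! j)))"
  using assms
proof (induction cs arbitrary: ss)
  case Nil
  then show ?case by (simp add: seqn_return)
next
  case (Cons c cs)
  let ?p = "\<lambda>j. g (c j) (ss ! j)" and ?T = "\<lambda>n L. map (\<lambda>i. map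
    (\<lambda>j. L ! j ! i) [0..<J]) [0..<n]"
  let ?q = "\<lambda>xs j. run_chunks g (map (\<lambda>c. c j) cs) (snd (xs ! j))"
  have "seqn J (\<lambda>j. run_chunks g (map (\<lambda>c. c j) (c # cs)) (ss ! j)) =
    bind_spmf (seqn J ?p) (\<lambda>xs. seqn J (\<lambda>j. map_spmf ((#) (fst (xs ! j)))
      (?q xs j)))"
    using seqn_bind[of J ?p "\<lambda>j x. map_spmf ((#) (fst x)) (run_chunks g (map
      (\<lambda>c. c j) cs) (snd x))"]
    by (simp add: case_prod_unfold)
  also have "\<dots> = bind_spmf (seqn J ?p)
      (\<lambda>xs. map_spmf (\<lambda>L. map (\<lambda>j. fst (xs ! j) # L ! j) [0..<J]) (seqn J
        (?q xs)))"
    unfolding seqn_map ..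
  finally have "map_spmf (?T (length (c # cs))) (seqn J (\<lambda>j. run_chunks g (map
    (\<lambda>c. c j) (c # cs)) (ss ! j))) =
     bind_spmf (seqn J ?p) (\<lambda>xs. map_spmf (\<lambda>L. ?T (length (c # cs)) (map
       (\<lambda>j. fst (xs ! j) # L ! j) [0..<J])) (seqn J (?q xs)))"
    by (simp add: map_spmf_bind_spmf o_def spmf.map_comp)
  also have "\<dots> = bind_spmf (seqn J ?p) (\<lambda>xs. map_spmf ((#) (map fst xs))
    (run_parallel J g cs (map snd xs)))"
  proof (rule bind_spmf_cong[OF refl])
    fix xs assume "xs \<in> set_spmf (seqn J ?p)"
    then have len: "length xs = J" by (auto dest: set_seqnD)
    have T: "?T (length (c # cs)) (map (\<lambda>j. fst
      (xs ! j) # L ! j) [0..<J]) = map fst xs # ?T (length cs) L" for L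
      by (rule nth_equalityI) (auto simp: len nth_Cons' simp del: upt_Suc intro!: nth_equalityI)
    have "seqn J (?q xs) = seqn J (\<lambda>j. run_chunks g (map (\<lambda>c. c j) cs)
      (map snd xs ! j))"
      by (rule seqn_cong) (simp add: len)
    then show "map_spmf (\<lambda>L. ?T (length (c # cs)) (map (\<lambda>j. fst
      (xs ! j) # L ! j) [0..<J])) (seqn J (?q xs)) =
      map_spmf ((#) (map fst xs)) (run_parallel J g cs (map snd xs))"
      unfolding T by (subst Cons.IH) (simp_all add: len spmf.map_comp o_def)
  qed
  finally show ?case by simp
qed

text \<open>Carries the answers along with the state, so that a sequence of operations becomes a
  \<open>foldM\<close>, as produced by the host's loops.\<close>

fun ds_step ::
  "nat \<Rightarrow> nat \<Rightarrow> nat \<Rightarrow> com \<Rightarrow> com \<Rightarrow>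
    operation \<Rightarrow> enat list \<times> state \<Rightarrow>
    (enat list \<times> state) spmf" where
  "ds_step W tu tq upd qry (Update i x) (as, s) =
     map_spmf (\<lambda>s'. (as, s')) (exec W tu upd (s\<lparr>regs :=
       (regs s)(0 := i, 1 := x)\<rparr>))"
| "ds_step W tu tq upd qry (Query i) (as, s) =
     map_spmf (\<lambda>s'. (as @ [decode_answer (regs s' 0)], s')) (exec W tq qry
       (s\<lparr>regs := (regs s)(0 := i)\<rparr>))"

lemma run_operations_append:
  "map_spmf ((@) as) (run_operations W tu tq upd qry (ops1 @ ops2) s) =
    bind_spmf (foldM (ds_step W tu tq upd qry) ops1 (as, s))
      (\<lambda>(as', s'). map_spmf ((@) as') (run_operations W tu tq upd qry ops2 s'))"
proof (induction ops1 arbitrary: as s)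
  case (Cons a ops1)
  then show ?case
  proof (cases a)
    case (Query i)
    have "map_spmf ((@) as) (map_spmf ((#) b) p) = map_spmf ((@) (as @ [b])) p" for b :: enat and p
      by (auto simp: spmf.map_comp intro!: map_spmf_cong)
    moreover have "(\<lambda>xs. as @ b # xs) = (@) (as @ [b])" for b by auto
    ultimately show ?thesis
      unfolding Query by (simp del: append_assoc add: bind_map_spmf map_spmf_bind_spmf o_def flip:
        Cons.IH)
  qed (simp add: bind_map_spmf map_spmf_bind_spmf o_def flip: Cons.IH)
qed simp

text \<open>Links the guarantee for \<open>run_ds\<close>, which knows one flat sequence of
  operations, to the division into rounds.\<close>

lemma run_operations_concat:
  "run_operations W tu tq upd qry (concat opss) s =
    map_spmf concat (run_chunks (\<lambda>ops s. foldM (ds_step W tu tq upd qry) ops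
      ([], s)) opss s)"
proof (induction opss arbitrary: s)
  case (Cons ops opss)
  have "(@) ([] :: enat list) = id" by auto
  then show ?case
    using run_operations_append[of "[]" W tu tq upd qry ops "concat opss" s]
    by (simp add: Cons.IH map_spmf_bind_spmf spmf.map_comp o_def case_prod_unfold)
qed simp

section \<open>The matrix-vector multiplication program\<close>

abbreviation plus_expr (infixl "\<oplus>" 65) where "a \<oplus> b \<equiv> Bin Add a b"
abbreviation times_expr (infixl "\<otimes>" 70) where "a \<otimes> b \<equiv> Bin Mul a b"

fun power_expr :: "expr \<Rightarrow> nat \<Rightarrow> expr" where
  "power_expr e 0 = Lit 1"
| "power_expr e (Suc k) = power_expr e k \<otimes> e"

lemma power_expr_simps [simp]:
  "value_of (power_expr e k) \<rho> \<mu> = value_of e \<rho> \<mu> ^ k"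
  "tame X e \<rho> \<mu> \<Longrightarrow> tame X (power_expr e k) \<rho> \<mu>"
  "deg (power_expr e k) = 1 + k * (deg e + 1)"
  "cost (power_expr e k) = 1 + k * (cost e + 1)"
  by (induction k) auto

text \<open>In continuation style: the exponent \<open>E\<close> is common to all expressions of a
  program, the remaining budget results from subtraction, and \<open>v\<close> allows the computed
  value to be stated in simplified form.\<close>

lemma hoare_assign_then:
  assumes "(X + 2) ^ E < W"
    and "tame X e \<rho> \<mu> \<and> value_of e \<rho> \<mu> = v \<and> deg e \<le> E \<and>
      x < 31 \<and> cost e + 1 \<le> B"
    and "hoare W (B - (cost e + 1)) cs (\<rho>(x := v)) \<mu> \<Phi> p"
  shows "hoare W B (assign x e @ cs) \<rho> \<mu> \<Phi> p"
proof -
  have "(X + 2) ^ deg e \<le> (X + 2) ^ E" by (rule power_increasing) (use assms in auto)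
  from this assms(1) have "(X + 2) ^ deg e < W" by (rule le_less_trans)
  then have "hoare W (cost e + 1) (assign x e) \<rho> \<mu>
      (\<lambda>\<rho>' \<mu>' (_::unit). hoare W (B - (cost e + 1)) cs \<rho>' \<mu>' \<Phi> p)
        (return_spmf ())"
    using assms(2,3) by (intro hoare_assign) auto
  from hoare_append_det[OF this] assms(2) show ?thesis by simp
qed

lemma hoare_store_then:
  assumes "(X + 2) ^ E < W"
    and "tame X e1 \<rho> \<mu> \<and> value_of e1 \<rho> \<mu> = a \<and> deg e1 \<le> E \<and>
      tame X e2 \<rho> \<mu> \<and> value_of e2 \<rho> \<mu> = v \<and>
      deg e2 \<le> E \<and> cost e1 + cost e2 + 1 \<le> B"
    and "hoare W (B - (cost e1 + cost e2 + 1)) cs \<rho> (\<mu>(a := v)) \<Phi> p"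
  shows "hoare W B (store e1 e2 @ cs) \<rho> \<mu> \<Phi> p"
proof -
  have "(X + 2) ^ deg e1 \<le> (X + 2) ^ E" "(X + 2) ^ deg e2 \<le> (X + 2) ^ E"
    by (rule power_increasing; use assms in auto)+
  from this[THEN le_less_trans, OF assms(1)] have "(X + 2) ^ deg e1 < W" "(X + 2) ^ deg e2 < W" .
  then have "hoare W (cost e1 + (cost e2 + 1)) (store e1 e2) \<rho> \<mu>
      (\<lambda>\<rho>' \<mu>' (_::unit). hoare W (B -
        (cost e1 + cost e2 + 1)) cs \<rho>' \<mu>' \<Phi> p) (return_spmf ())"
    using assms(2,3) by (intro hoare_store) auto
  from hoare_append_det[OF this] assms(2) show ?thesis by (simp add: add.assoc)
qed

lemma hoare_then:
  assumes "hoare W B1 cs1 \<rho> \<mu> \<Psi> (return_spmf ())" "B1 \<le> B"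
    and "\<And>\<rho>' \<mu>'. \<Psi> \<rho>' \<mu>' () \<Longrightarrow>
      hoare W (B - B1) cs2 \<rho>' \<mu>' \<Phi> p"
  shows "hoare W B (cs1 @ cs2) \<rho> \<mu> \<Phi> p"
proof -
  have "hoare W (B1 + (B - B1)) (cs1 @ cs2) \<rho> \<mu> \<Phi> p"
    by (rule hoare_append_det, rule hoare_mono[OF assms(1) order.refl]) (use assms(3) in auto)
  then show ?thesis using assms(2) by simp
qed

lemma hoare_assign_last:
  assumes "(X + 2) ^ E < W"
    and "tame X e \<rho> \<mu> \<and> value_of e \<rho> \<mu> = v \<and> deg e \<le> E \<and>
      x < 31 \<and> cost e + 1 \<le> B"
    and "\<Phi> (\<rho>(x := v)) \<mu> a"
  shows "hoare W B (assign x e) \<rho> \<mu> \<Phi> (return_spmf a)"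
  using hoare_assign_then[OF assms(1,2), of "[]" \<Phi> "return_spmf a"] assms(3)
    by (simp add: hoare_Nil)

lemma hoare_store_last:
  assumes "(X + 2) ^ E < W"
    and "tame X e1 \<rho> \<mu> \<and> value_of e1 \<rho> \<mu> = a \<and> deg e1 \<le> E \<and>
      tame X e2 \<rho> \<mu> \<and> value_of e2 \<rho> \<mu> = v \<and>
      deg e2 \<le> E \<and> cost e1 + cost e2 + 1 \<le> B"
    and "\<Phi> \<rho> (\<mu>(a := v)) b"
  shows "hoare W B (store e1 e2) \<rho> \<mu> \<Phi> (return_spmf b)"
  using hoare_store_then[OF assms(1,2), of "[]" \<Phi> "return_spmf b"] assms(3)
    by (simp add: hoare_Nil)

lemma hoare_map:
  assumes "hoare W B cs \<rho> \<mu> (\<lambda>\<rho>' \<mu>' a. \<Phi> \<rho>' \<mu>' (f a)) p"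
  shows "hoare W B cs \<rho> \<mu> \<Phi> (map_spmf f p)"
proof -
  have "hoare W B cs \<rho> \<mu> (\<lambda>\<rho>' \<mu>' a. hoare W 0 [] \<rho>' \<mu>' \<Phi>
    (return_spmf (f a))) p"
    by (rule hoare_mono[OF assms order.refl]) (rule hoare_Nil)
  from hoare_append[OF this] show ?thesis by (simp add: map_spmf_conv_bind_spmf)
qed

lemma length_save_restore [simp]: "length (restore_regs R) = 3 * R" "length (save_regs R) = 3 * R"
  by (induction R) (auto simp: restore_regs_def save_regs_def)

lemma length_call [simp]: "length (call R c) = 6 * R + 1"
  by (simp add: call_def)

text \<open>For deterministic bookkeeping after a randomized part, whose sampled value
  \<open>a\<close> is kept.\<close>

lemma hoare_append_det_right:
  assumes "hoare W B1 cs1 \<rho> \<mu> \<Psi> p"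
    and "\<And>\<rho>' \<mu>' a. \<Psi> \<rho>' \<mu>' a \<Longrightarrow>
      hoare W B2 cs2 \<rho>' \<mu>' (\<lambda>\<rho>' \<mu>' (_::unit). \<Phi> \<rho>' \<mu>' a)
      (return_spmf ())"
  shows "hoare W (B1 + B2) (cs1 @ cs2) \<rho> \<mu> \<Phi> p"
proof -
  have "hoare W B1 cs1 \<rho> \<mu> (\<lambda>\<rho>' \<mu>' a. hoare W B2 cs2 \<rho>' \<mu>' \<Phi>
    (return_spmf a)) p"
  proof (rule hoare_mono[OF assms(1) order.refl])
    fix \<rho>' \<mu>' a assume "\<Psi> \<rho>' \<mu>' a"
    then have "hoare W B2 cs2 \<rho>' \<mu>' \<Phi> (map_spmf (\<lambda>_. a) (return_spmf ()))"
      by (intro hoare_map assms(2))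
    then show "hoare W B2 cs2 \<rho>' \<mu>' \<Phi> (return_spmf a)" by simp
  qed
  from hoare_append[OF this] show ?thesis by simp
qed

text \<open>
  The host program keeps the following quantities in registers: the dimension
    (0), the base \<open>g\<close>
  of the block sizes (1), the numbers of rows (2) and columns (3) of a block, of row blocks (4) and
  column blocks (5), of simulated data structures (6), the length of the memory region reserved for
  each of them (7), the lengths of text (8) and pattern (9), and the number of copies of the data
  structure per block (19). The matrix is padded with zeros to a multiple of the block size.
  Copy \<open>j\<close> occupies the addresses from \<open>stride *
    (j + 1)\<close> on: its \<open>R\<close> registers are followed by the
  results of its queries and by its memory.
\<close>

locale reduction =
  fixes pre upd qry :: com and d R D p q G Q :: nat
begin

section \<open>Block sizes and memory layout\<close>

definition root :: "nat \<Rightarrow> nat" where "root N = (LEAST x. N \<le> x ^ D)"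
text \<open>Adding \<open>G\<close> keeps the base at least \<open>G\<close> for every
  \<open>N\<close>, so that the error bound needs no assumption that \<open>N\<close> is
  large.\<close>

definition base :: "nat \<Rightarrow> nat" where "base N = root N + G"
definition rows :: "nat \<Rightarrow> nat" where "rows N = base N ^ p"
definition cols :: "nat \<Rightarrow> nat" where "cols N = base N ^ q"
definition text_length :: "nat \<Rightarrow> nat" where "text_length N = 2 * (rows N * cols N)"
definition pattern_length :: "nat \<Rightarrow> nat" where "pattern_length N = 2 * cols N"
definition row_blocks :: "nat \<Rightarrow> nat" where "row_blocks N = N div rows N + 1"
definition col_blocks :: "nat \<Rightarrow> nat" where "col_blocks N = N div cols N + 1"
definition copies :: "nat \<Rightarrow> nat" where "copies N = Q * (row_blocks N * col_blocks N)"
text \<open>Twice the text length makes room for pattern and text. Copy 0 only begins at address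
  \<open>stride\<close>, so the summand \<open>N * N + 2 * N\<close> keeps matrix, vector and output
  below all copies.\<close>

definition stride :: "nat \<Rightarrow> nat" where
  "stride N = R + rows N + N * N + 2 * N + 2 * text_length N + (text_length N + 2) ^ d"

text \<open>Bounds all variables and loaded cells of the host, while \<open>max_deg\<close> bounds
  the degrees of its expressions; together they reduce all overflow checks to one
  inequality.\<close>

definition max_value :: "nat \<Rightarrow> nat" where
  "max_value N = stride N * (copies N + 2) + N + base N + rows N + cols N + text_length N +
    pattern_length N
     + row_blocks N + col_blocks N + copies N + Q + row_blocks N * rows N + col_blocks N * cols N"

text \<open>Literals count with their value, hence \<open>G\<close>, \<open>Q\<close> and
  \<open>R\<close>. A power of a register counts twice its exponent, and the base
  \<open>n + 2\<close>, of degree 4, gives \<open>5 * d\<close>.\<close>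

definition max_deg :: nat where
  "max_deg = 100 + G + Q + 2 * R + 2 * D + 2 * p + 2 * q + 5 * d"

section \<open>The host programs\<close>

definition select :: "com list" where
  "select =
     assign 11 (Var 7 \<otimes> (Var 10 \<oplus> Lit 1)) @
     assign 30 (Var 11 \<oplus> (Lit R \<oplus> Var 2)) @
     assign 16 (Bin Div (Var 10) (Lit Q)) @
     assign 12 (Bin Div (Var 16) (Var 5) \<otimes> Var 2) @
     assign 13 (Bin Mod (Var 16) (Var 5) \<otimes> Var 3)"

text \<open>Padding without branches: register 17 tells whether the entry lies inside the matrix.
  Multiplying the address by it redirects all other reads to cell 0, and multiplying the result by
  it turns them into 0. Comparison with the parity of the position produces the two-letter
  code.\<close>

definition write_char :: "com list" where
  "write_char =
     assign 15 (Var 12 \<oplus> Bin Div (Var 14) (Var 9)) @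
     assign 16 (Var 13 \<oplus> Bin Div (Bin Mod (Var 14) (Var 9)) (Lit 2)) @
     assign 17 (Bin Less (Var 15) (Var 0) \<otimes> Bin Less (Var 16) (Var 0)) @
     store (Var 30 \<oplus> (Var 9 \<oplus> Var 14))
       (Bin Eq (Var 17 \<otimes> At ((Var 15 \<otimes> Var 0 \<oplus> Var 16) \<otimes> Var 17))
         (Bin Mod (Var 14) (Lit 2)))"

text \<open>No pattern is written, because the memory of a fresh copy is still zero and so already
  holds the zero pattern.\<close>

definition load_block :: "com list" where
  "load_block = select @ for_loop 14 8 write_char @ store (Var 11) (Var 8) @
     store (Var 11 \<oplus> Lit 1) (Var 9) @ call R pre"

definition find_root :: "com list" where
  "find_root = assign 1 (Lit 0) @
     while_expr (Bin Less (power_expr (Var 1) D) (Var 0)) (assign 1 (Var 1 \<oplus> Lit 1))"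

definition init_prog :: "com list" where
  "init_prog = find_root @
     assign 1 (Var 1 \<oplus> Lit G) @
     assign 2 (power_expr (Var 1) p) @
     assign 3 (power_expr (Var 1) q) @
     assign 8 (Lit 2 \<otimes> (Var 2 \<otimes> Var 3)) @
     assign 9 (Lit 2 \<otimes> Var 3) @
     assign 4 (Bin Div (Var 0) (Var 2) \<oplus> Lit 1) @
     assign 5 (Bin Div (Var 0) (Var 3) \<oplus> Lit 1) @
     assign 6 (Lit Q \<otimes> (Var 4 \<otimes> Var 5)) @
     assign 7 (Lit R \<oplus> Var 2 \<oplus> Var 0 \<otimes> Var 0 \<oplus> Lit 2 \<otimes> Var 0
       \<oplus> Lit 2 \<otimes> Var 8
       \<oplus> power_expr (Var 8 \<oplus> Lit 2) d) @
     assign 19 (Lit Q) @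
     for_loop 10 6 load_block"

text \<open>Every odd position is overwritten in every round, so the pattern needs no reset.
  Register 18 collects the weight of the vector on the way.\<close>

definition feed_char :: "com list" where
  "feed_char =
     assign 15 (Var 13 \<oplus> Var 14) @
     assign 16 (Bin Less (Var 15) (Var 0)) @
     assign 16 (Var 16 \<otimes> At (Var 0 \<otimes> Var 0 \<oplus> Var 15 \<otimes> Var 16)) @
     assign 18 (Var 18 \<oplus> Var 16) @
     store (Var 11) (Lit 2 \<otimes> Var 14 \<oplus> Lit 1) @
     store (Var 11 \<oplus> Lit 1) (Var 16) @
     call R upd"

text \<open>Only the outcome of the comparison is recorded. Answers are coded with a shift by one,
  so register 18 holds the comparison value plus one.\<close>

definition ask_row :: "com list" where
  "ask_row = store (Var 11) (Var 14 \<otimes> Var 9) @ call R qry @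
     store (Var 11 \<oplus> (Lit R \<oplus> Var 14)) (Bin Less (At (Var 11)) (Var 18))"

definition process_copy :: "com list" where
  "process_copy = select @ assign 18 (Lit 0) @ for_loop 14 3 feed_char @
     assign 18 (Var 18 \<oplus> Var 3 \<oplus> Lit 1) @ for_loop 14 2 ask_row"

definition count_vote :: "com list" where
  "count_vote = assign 16 (Var 16 \<oplus>
     At (Var 7 \<otimes> (Var 15 \<oplus> Var 17 \<oplus> Lit 1) \<oplus> (Lit R \<oplus> Var 14)))"

text \<open>Register 18 accumulates a disjunction over the column blocks, written as positivity of a
  sum.\<close>

definition combine_block :: "com list" where
  "combine_block = assign 16 (Lit 0) @
     assign 15 ((Var 12 \<otimes> Var 5 \<oplus> Var 13) \<otimes> Var 19) @
     for_loop 17 19 count_vote @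
     assign 18 (Bin Less (Lit 0) (Var 18 \<oplus> Bin Less (Var 19) (Lit 2 \<otimes> Var 16)))"

definition combine_row :: "com list" where
  "combine_row = assign 12 (Bin Div (Var 10) (Var 2)) @ assign 14 (Bin Mod (Var 10) (Var 2)) @
     assign 18 (Lit 0) @ for_loop 13 5 combine_block @
     store (Var 0 \<otimes> Var 0 \<oplus> (Var 0 \<oplus> Var 10)) (Var 18)"

definition round_prog :: "com list" where
  "round_prog = for_loop 10 6 process_copy @ for_loop 10 0 combine_row"

section \<open>Blocks, operations and votes in mathematical terms\<close>

definition row_offset :: "nat \<Rightarrow> nat \<Rightarrow> nat" where
  "row_offset N j = j div Q div col_blocks N * rows N"

definition col_offset :: "nat \<Rightarrow> nat \<Rightarrow> nat" where
  "col_offset N j = j div Q mod col_blocks N * cols N"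

definition entry :: "nat \<Rightarrow> (nat \<Rightarrow> nat \<Rightarrow> bool) \<Rightarrow> nat
  \<Rightarrow> nat \<Rightarrow> bool" where
  "entry N M i l \<longleftrightarrow> i < N \<and> l < N \<and> M i l"

text \<open>The equivalence with \<open>odd a\<close> is the two-letter code: the even position
  carries the negated entry, the odd one the entry itself.\<close>

definition block_text :: "nat \<Rightarrow> (nat \<Rightarrow> nat \<Rightarrow> bool) \<Rightarrow>
  nat \<Rightarrow> nat list" where
  "block_text N M j = map (\<lambda>a.
     of_bool (entry N M (row_offset N j + a div pattern_length N)
        (col_offset N j + a mod pattern_length N div 2) \<longleftrightarrow> odd a))
          [0..<text_length N]"

definition zero_pattern :: "nat \<Rightarrow> nat list" where
  "zero_pattern N = replicate (pattern_length N) 0"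

definition coord :: "nat \<Rightarrow> (nat \<Rightarrow> bool) \<Rightarrow> nat \<Rightarrow> nat
  \<Rightarrow> bool" where
  "coord N v j l \<longleftrightarrow> col_offset N j + l < N \<and> v (col_offset N j + l)"

definition block_ops :: "nat \<Rightarrow> (nat \<Rightarrow> bool) \<Rightarrow> nat \<Rightarrow>
  operation list" where
  "block_ops N v j = map (\<lambda>l. Update (2 * l + 1) (of_bool (coord N v j l))) [0..<cols N] @
     map (\<lambda>i. Query (i * pattern_length N)) [0..<rows N]"

definition weight :: "nat \<Rightarrow> (nat \<Rightarrow> bool) \<Rightarrow> nat \<Rightarrow>
  nat" where
  "weight N v j = (\<Sum>l<cols N. of_bool (coord N v j l))"

text \<open>Mirrors the comparison of codes in the host: infinity is coded as 0 and therefore passes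
  it. In the instances that arise all distances are within the threshold, so an infinite answer is
  an error anyway.\<close>

definition hit :: "nat \<Rightarrow> (nat \<Rightarrow> bool) \<Rightarrow> nat \<Rightarrow> enat
  \<Rightarrow> bool" where
  "hit N v j a \<longleftrightarrow> (case a of enat h \<Rightarrow> h < weight N v j + cols N |
    \<infinity> \<Rightarrow> True)"

text \<open>Inverse to \<open>row_offset\<close> and \<open>col_offset\<close>: blocks are numbered
  row by row, and the \<open>Q\<close> copies of a block are adjacent.\<close>

definition copy_index :: "nat \<Rightarrow> nat \<Rightarrow> nat \<Rightarrow> nat \<Rightarrow>
  nat" where
  "copy_index N x b c = (x div rows N * col_blocks N + b) * Q + c"

definition majority :: "nat \<Rightarrow> (nat \<Rightarrow> bool) \<Rightarrow> enat list list
  \<Rightarrow> nat \<Rightarrow> nat \<Rightarrow> bool" where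
  "majority N v A x b \<longleftrightarrow>
     Q < 2 * (\<Sum>c<Q. of_bool (hit N v (copy_index N x b c) (A ! copy_index N x b c !
       (x mod rows N))))"

definition output_bits :: "nat \<Rightarrow> (nat \<Rightarrow> bool) \<Rightarrow> enat list list
  \<Rightarrow> nat list" where
  "output_bits N v A = map (\<lambda>x. of_bool (\<exists>b<col_blocks N. majority N v A x b))
    [0..<N]"

lemma root_bounds: "1 \<le> D \<Longrightarrow> N \<le> root N ^ D" "i < root N \<Longrightarrow>
  i ^ D < N" "1 \<le> D \<Longrightarrow> root N \<le> N"
proof -
  have *: "1 \<le> D \<Longrightarrow> N \<le> N ^ D" by (cases "N = 0") (auto intro: self_le_power)
  show "1 \<le> D \<Longrightarrow> N \<le> root N ^ D" unfolding root_def
    by (rule LeastI[of _ N]) (rule *)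
  show "i < root N \<Longrightarrow> i ^ D < N" unfolding root_def using not_less_Least
    by (meson not_le_imp_less)
  show "1 \<le> D \<Longrightarrow> root N \<le> N" unfolding root_def by (rule Least_le) (rule *)
qed

end

section \<open>Invariants of the host memory\<close>

locale reduction_run = reduction +
  fixes N H tp tu tq :: nat
  assumes d: "1 \<le> d" and R: "2 \<le> R" and Q: "0 < Q" and G: "1 \<le> G" and D: "1 \<le> D" and
    N: "1 \<le> N"
    and below: "regs_below R pre" "regs_below R upd" "regs_below R qry"
    and fits: "(max_value N + 2) ^ max_deg < H"
begin

abbreviation "r \<equiv> rows N"
abbreviation "w \<equiv> cols N"
abbreviation "n \<equiv> text_length N"
abbreviation "m \<equiv> pattern_length N"
abbreviation "J \<equiv> copies N"
abbreviation "Z \<equiv> stride N"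
abbreviation "X \<equiv> max_value N"
text \<open>The word bound of the simulated machines; the host has its own bound
  \<open>H\<close>.\<close>

abbreviation "Wd \<equiv> (n + 2) ^ d"
abbreviation "region j \<equiv> Z * (j + 1)"
abbreviation "cells j \<equiv> region j + (R + r)"
abbreviation "stored j s \<mu> \<equiv> boxed Wd R (region j) (cells j) s \<mu>"

definition params :: "(nat \<Rightarrow> nat) \<Rightarrow> bool" where
  "params \<rho> \<longleftrightarrow> \<rho> 0 = N \<and> \<rho> 2 = r \<and> \<rho> 3 = w \<and>
    \<rho> 4 = row_blocks N \<and> \<rho> 5 = col_blocks N \<and>
     \<rho> 6 = J \<and> \<rho> 7 = Z \<and> \<rho> 8 = n \<and> \<rho> 9 = m \<and> \<rho> 19 = Q"

lemma params_upd [simp]: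
  "10 \<le> x \<Longrightarrow> x \<noteq> 19 \<Longrightarrow>
    params (\<rho>(x := v)) = params \<rho>"
  by (auto simp: params_def)

lemma base_pos: "1 \<le> base N" using G by (simp add: base_def)

lemma pos: "0 < r" "0 < w" "0 < n" "0 < m" "0 < col_blocks N" "0 < row_blocks N"
  using base_pos by (auto simp: rows_def cols_def text_length_def pattern_length_def col_blocks_def
    row_blocks_def)

lemma Wd: "n + 2 \<le> Wd"
  by (rule self_le_power) (use d in auto)

lemma m_le_n: "m \<le> n" using pos by (simp add: text_length_def pattern_length_def)

lemma stride_ge: "R + r + Wd + m + n \<le> Z" "N * N + 2 * N \<le> Z" "R + r + Wd \<le> Z"
  using m_le_n by (auto simp: stride_def)

lemma le_max:
  "N \<le> X" "base N \<le> X" "r \<le> X" "w \<le> X" "n \<le> X" "m \<le> X" "row_blocks N \<le>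
    X" "col_blocks N \<le> X"
  "J \<le> X" "Q \<le> X" "row_blocks N * r \<le> X" "col_blocks N * w \<le> X" "Z \<le> X"
  by (auto simp: max_value_def)

lemma region_le: "j \<le> J \<Longrightarrow> region j + Z \<le> X"
proof -
  assume "j \<le> J"
  have "region j + Z = Z * (j + 2)" by simp
  also have "\<dots> \<le> Z * (J + 2)" using \<open>j \<le> J\<close>
    by (intro mult_left_mono) auto
  also have "\<dots> \<le> X" by (simp only: max_value_def add.assoc le_add1)
  finally show ?thesis .
qed

lemma region_Suc: "region (Suc j) = region j + Z"
  by simp

lemma region_mono: "i \<le> j \<Longrightarrow> region i \<le> region j"
  by simp

lemma cells_bounds: "region j + R + r + Wd \<le> region (Suc j)" "cells j + m + n + Wd \<le> region
  (Suc j)"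
  using stride_ge by (auto simp: region_Suc)

lemma X_less_H: "X < H"
proof -
  have "X + 2 \<le> (X + 2) ^ max_deg" by (rule self_le_power) (auto simp: max_deg_def)
  from le_less_trans[OF this fits] show ?thesis by simp
qed

lemma fits3: "(X + 2) ^ 3 < H"
proof -
  have "(X + 2) ^ 3 \<le> (X + 2) ^ max_deg" by (rule power_increasing) (auto simp: max_deg_def)
  from le_less_trans[OF this fits] show ?thesis .
qed

lemma copy_bounds:
  assumes "j < J"
  shows "j div Q div col_blocks N < row_blocks N" "row_offset N j + r \<le> row_blocks N * r"
    "col_offset N j + w \<le> col_blocks N * w"
proof -
  have "j div Q < row_blocks N * col_blocks N"
    using assms Q by (simp add: copies_def less_mult_imp_div_less mult.commute)
  then show 1: "j div Q div col_blocks N < row_blocks N"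
    by (simp add: less_mult_imp_div_less)
  have "(j div Q div col_blocks N + 1) * r \<le> row_blocks N * r"
    by (rule mult_right_mono) (use 1 in auto)
  then show "row_offset N j + r \<le> row_blocks N * r" by (simp add: row_offset_def)
  have "j div Q mod col_blocks N < col_blocks N" using pos by simp
  then have "(j div Q mod col_blocks N + 1) * w \<le> col_blocks N * w"
    by (intro mult_right_mono) auto
  then show "col_offset N j + w \<le> col_blocks N * w" by (simp add: col_offset_def)
qed

text \<open>The result cells between the saved registers and the memory window are exempt, so
  recording an answer leaves the stored copy intact.\<close>

lemma stored_cong:
  assumes "stored j s \<mu>" "\<And>z. region j \<le> z \<Longrightarrow>
    z < region (Suc j) \<Longrightarrow>
    z < region j + R \<or> cells j \<le> z \<Longrightarrow> \<mu>' z = \<mu> z"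
  shows "stored j s \<mu>'"
  unfolding boxed_def
proof (intro conjI allI impI)
  fix x assume x: "x < R"
  then have "\<mu>' (region j + x) = \<mu> (region j + x)"
    using cells_bounds[of j] by (intro assms(2)) auto
  then show "\<mu>' (region j + x) = regs s x" "regs s x < Wd"
    using x assms(1) unfolding boxed_def by auto
next
  fix a assume a: "a < Wd"
  then have "\<mu>' (cells j + a) = \<mu> (cells j + a)"
    using cells_bounds[of j] by (intro assms(2)) auto
  then show "\<mu>' (cells j + a) = mem s a"
    using a assms(1) unfolding boxed_def by auto
qed

abbreviation "off_region j z \<equiv> \<not> (region j \<le> z \<and> z < region (Suc j))"

lemma region_disjoint: "region i \<le> z \<Longrightarrow> z < region (Suc i) \<Longrightarrow>
  region j \<le> z \<Longrightarrow> z < region (Suc j) \<Longrightarrow> i = j"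
  using region_mono[of "Suc i" j] region_mono[of "Suc j" i] by (cases i j rule: linorder_cases) auto

lemma stored_other:
  assumes "stored i s \<mu>" "i \<noteq> j" "\<And>z. off_region j z \<Longrightarrow>
    \<mu>' z = \<mu> z"
  shows "stored i s \<mu>'"
  by (rule stored_cong[OF assms(1)], rule assms(3)) (use region_disjoint assms(2) in blast)

definition selected :: "nat \<Rightarrow> (nat \<Rightarrow> nat) \<Rightarrow> bool" where
  "selected j \<rho> \<longleftrightarrow> params \<rho> \<and> \<rho> 10 = j \<and>
    \<rho> 11 = region j \<and> \<rho> 30 = cells j \<and>
     \<rho> 12 = row_offset N j \<and> \<rho> 13 = col_offset N j"

lemma selected_upd [simp]:
  "14 \<le> x \<Longrightarrow> x < 30 \<Longrightarrow> x \<noteq> 19 \<Longrightarrow>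
    selected j (\<rho>(x := v)) = selected j \<rho>"
  by (auto simp: selected_def)

lemma hoare_select_then:
  assumes "params \<rho>" "\<rho> 10 = j" "j < J" "40 \<le> B"
    and "\<And>\<rho>'. selected j \<rho>' \<Longrightarrow>
      hoare H (B - 40) cs \<rho>' \<mu> \<Phi> P"
  shows "hoare H B (select @ cs) \<rho> \<mu> \<Phi> P"
proof -
  note p = assms(1)[unfolded params_def]
  have jX: "j \<le> X" "j div Q \<le> X" using assms(3) le_max(9) div_le_dividend[of j Q]
    by linarith+
  have rX: "region j \<le> X" "cells j \<le> X"
    using region_le[of j] stride_ge assms(3) by auto
  have off: "row_offset N j \<le> X" "col_offset N j \<le> X"
    using copy_bounds[OF assms(3)] le_max by linarith+
  have sel: "selected j (\<rho>(11 := region j, 30 := cells j, 16 := j div Q, 12 := row_offset N j,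
    13 := col_offset N j))"
    using assms(1,2) by (auto simp: selected_def)
  show ?thesis
    unfolding select_def append_assoc
    apply (rule hoare_assign_then[OF fits, where v = "region j"],
        use p assms(2,4) jX le_max rX in \<open>simp add: max_deg_def row_offset_def
          col_offset_def\<close>)
    apply (rule hoare_assign_then[OF fits, where v = "cells j"],
        use p assms(2,4) jX le_max rX in \<open>simp add: max_deg_def row_offset_def
          col_offset_def\<close>)
    apply (rule hoare_assign_then[OF fits, where v = "j div Q"],
        use p assms(2,4) jX le_max rX in \<open>simp add: max_deg_def row_offset_def
          col_offset_def\<close>)
    apply (rule hoare_assign_then[OF fits, where v = "row_offset N j"],
        use p assms(2,4) jX le_max rX in \<open>simp add: max_deg_def row_offset_def
          col_offset_def\<close>)
    apply (rule hoare_assign_then[OF fits, where v = "col_offset N j"],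
        use p assms(2,4) jX le_max rX in \<open>simp add: max_deg_def row_offset_def
          col_offset_def\<close>)
    apply (rule hoare_mono[OF assms(5)])
    using sel p assms(2,4) apply (auto simp: row_offset_def col_offset_def)
    done
qed

section \<open>Preprocessing all copies\<close>

lemmas root = root_bounds(1)[OF D, of N]

text \<open>Linear search is affordable, since the root is at most \<open>N\<close>.\<close>

lemma hoare_find_root:
  assumes "\<rho> 0 = N"
  shows "hoare H ((root N + 1) * (4 * D + 30)) find_root \<rho> \<mu>
    (\<lambda>\<rho>' \<mu>' _. \<rho>' = \<rho>(1 := root N) \<and> \<mu>' = \<mu>)
    (return_spmf ())"
proof -
  let ?e = "Bin Less (power_expr (Var 1) D) (Var 0)" and ?b = "assign 1 (Var 1 \<oplus> Lit 1)"
  let ?I = "\<lambda>i \<rho>' \<mu>' (_::unit). \<rho>' = \<rho>(1 := i) \<and> \<mu>' = \<mu>"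
  have rootX: "root N \<le> X" using le_max(2) by (simp add: base_def)
  have dg: "(X + 2) ^ deg ?e < H"
    by (rule le_less_trans[OF power_increasing fits]) (auto simp: max_deg_def)
  have "hoare H (cost ?e + (root N * (10 + length ?b + 2 * cost ?e + 2) + 1)) (while_expr ?e ?b)
    (\<rho>(1 := 0)) \<mu>
    (?I (root N)) (foldM (\<lambda>_ _. return_spmf ()) [0..<root N] ())"
  proof (rule hoare_while[where X = X and I = ?I])
    fix i \<rho>' \<mu>' and u :: unit assume i: "i < root N" and I: "?I i \<rho>' \<mu>' u"
    have "hoare H 10 ?b \<rho>' \<mu>' (?I (Suc i)) (return_spmf ())"
      by (rule hoare_assign_last[OF fits, where v = "Suc i"])
        (use I i rootX in \<open>auto simp: max_deg_def\<close>)
    then show "value_of ?e \<rho>' \<mu>' \<noteq> 0 \<and>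
      hoare H 10 ?b \<rho>' \<mu>' (?I (Suc i)) (return_spmf ())"
      using I root_bounds(2)[OF i] assms by simp
  next
    fix \<rho>' \<mu>' and u :: unit assume "?I (root N) \<rho>' \<mu>' u"
    then show "value_of ?e \<rho>' \<mu>' = 0" using root assms by simp
  qed (use assms rootX le_max(1) dg in auto)
  then have "hoare H (cost ?e + (root N * (10 + length ?b + 2 * cost ?e + 2) + 1))
    (while_expr ?e ?b) (\<rho>(1 := 0)) \<mu>
    (?I (root N)) (return_spmf ())" by simp
  then have "hoare H ((root N + 1) * (4 * D + 30) - 2) (while_expr ?e ?b) (\<rho>(1 := 0)) \<mu>
    (?I (root N)) (return_spmf ())"
    by (rule hoare_mono) (auto simp: algebra_simps)
  then show ?thesis
    unfolding find_root_def
    by (intro hoare_assign_then[OF fits, where v = 0]) (auto simp: max_deg_def algebra_simps)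
qed

lemma length_block_text [simp]: "length (block_text N M j) = n"
  by (simp add: block_text_def)

definition matrix_at :: "(nat \<Rightarrow> nat \<Rightarrow> bool) \<Rightarrow>
  (nat \<Rightarrow> nat) \<Rightarrow> bool" where
  "matrix_at M \<mu> \<longleftrightarrow> (\<forall>i<N. \<forall>l<N. \<mu> (i * N + l) = of_bool
    (M i l))"

lemma matrix_at_cong: "matrix_at M \<mu> \<Longrightarrow> (\<And>z. z < N * N \<Longrightarrow>
  \<mu>' z = \<mu> z) \<Longrightarrow> matrix_at M \<mu>'"
proof -
  assume *: "matrix_at M \<mu>" "\<And>z. z < N * N \<Longrightarrow> \<mu>' z = \<mu> z"
  have "i * N + l < N * N" if "i < N" "l < N" for i l
  proof -
    have "i * N + l < (i + 1) * N" using that by simp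
    also have "\<dots> \<le> N * N" using that by (intro mult_right_mono) auto
    finally show ?thesis .
  qed
  with * show ?thesis unfolding matrix_at_def by simp
qed

lemma hoare_write_char:
  assumes sel: "selected j \<rho>" and j: "j < J" and a: "\<rho> 14 = a" "a < n" and
    M: "matrix_at M \<mu>"
  shows "hoare H 60 write_char \<rho> \<mu> (\<lambda>\<rho>' \<mu>' _. selected j \<rho>' \<and>
    \<rho>' 14 = a \<and>
    \<mu>' = \<mu>(cells j + m + a := block_text N M j ! a)) (return_spmf ())"
proof -
  note p = sel[unfolded selected_def params_def]
  define x where "x = row_offset N j + a div m"
  define y where "y = col_offset N j + a mod m div 2"
  define b where "b = (of_bool (x < N) * of_bool (y < N) :: nat)"
  have "a div m < r" using a(2) by (simp add: text_length_def pattern_length_def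
    less_mult_imp_div_less mult_ac)
  then have x: "x \<le> X" using copy_bounds(2)[OF j] le_max(11) by (simp add: x_def)
  have "a mod m < m" using pos by simp
  then have "a mod m div 2 < w" by (simp add: pattern_length_def less_mult_imp_div_less
    mult.commute)
  then have y: "y \<le> X" using copy_bounds(3)[OF j] le_max(12) by (simp add: y_def)
  have off: "row_offset N j \<le> X" "col_offset N j \<le> X" using x y by (auto simp: x_def y_def)
  have b: "b \<le> X" using N le_max(1) by (simp add: b_def)
  have \<mu>: "\<mu> ((x * N + y) * b) \<le> 1" "b * \<mu> ((x * N + y) * b) = of_bool
    (entry N M x y)"
  proof -
    \<comment> \<open>Outside the matrix the flag \<open>b\<close> sends the read to address 0,
      which holds a matrix entry because \<open>1 \<le> N\<close>.\<close>
    have "\<mu> 0 = of_bool (M 0 0)" using M N unfolding matrix_at_def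
      by (metis add_0 less_le_trans mult_zero_left zero_less_one)
    moreover have "\<mu> (x * N + y) = of_bool (M x y)" if "x < N" "y < N"
      using M that unfolding matrix_at_def by blast
    ultimately show "\<mu> ((x * N + y) * b) \<le> 1" "b * \<mu> ((x * N + y) * b) = of_bool
      (entry N M x y)"
      by (auto simp: b_def entry_def)
  qed
  have cX: "cells j \<le> X" using region_le[of j] stride_ge j by auto
  have T: "block_text N M j ! a = of_bool (entry N M x y \<longleftrightarrow> odd a)"
    using a(2) by (simp add: block_text_def x_def y_def)
  have val: "(of_bool (b * \<mu> ((x * N + y) * b) = a mod 2) :: nat) = block_text N M j ! a"
    unfolding T \<mu> by (auto simp: mod2_eq_if)
  show ?thesis
    unfolding write_char_def
    apply (rule hoare_assign_then[OF fits, where v = x],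
        use p a le_max off in \<open>simp add: max_deg_def x_def\<close>)
    apply (rule hoare_assign_then[OF fits, where v = y],
        use p a le_max off in \<open>simp add: max_deg_def y_def\<close>)
    apply (rule hoare_assign_then[OF fits, where v = b],
        use p a le_max x y in \<open>simp add: max_deg_def b_def\<close>)
    apply (rule hoare_store_last[OF fits, where a = "cells j + m + a" and
      v = "block_text N M j ! a"])
    subgoal using p a le_max x y b cX \<mu>(1) N by (simp add: max_deg_def val[symmetric])
    subgoal using sel a by simp
    done
qed

lemma length_write_char: "length write_char = 42"
  by (simp add: write_char_def)

text \<open>Zero memory from \<open>region j\<close> on already is the right content for the
  remaining registers, the zero pattern and the rest of the window.\<close>

lemma stored_input:
  assumes zero: "\<And>z. region j \<le> z \<Longrightarrow> \<mu> z = 0"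
    and \<mu>': "\<And>z. \<mu>' z = (if z = region j then n else if z = region j + 1 then m
      else if cells j + m \<le> z \<and> z < cells j + m + n then block_text N M j ! (z -
        (cells j + m)) else \<mu> z)"
  shows "stored j (ds_input (block_text N M j) (zero_pattern N)) \<mu>'"
proof -
  have "\<mu>' (region j + x) = regs (ds_input (block_text N M j) (zero_pattern N)) x \<and>
     regs (ds_input (block_text N M j) (zero_pattern N)) x < Wd" if "x < R" for x
    unfolding \<mu>' using that zero Wd m_le_n
    by (auto simp: ds_input_def zero_pattern_def)
  moreover have "\<mu>' (cells j + a) = mem (ds_input (block_text N M j) (zero_pattern N)) a" for a
    unfolding \<mu>' using zero[of "cells j + a"] R
    by (auto simp: ds_input_def zero_pattern_def nth_append add.assoc)
  ultimately show ?thesis unfolding boxed_def by blast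
qed

definition loaded :: "(nat \<Rightarrow> nat \<Rightarrow> bool) \<Rightarrow> nat \<Rightarrow>
  (nat \<Rightarrow> nat) \<Rightarrow> (nat \<Rightarrow> nat) \<Rightarrow> state list
  \<Rightarrow> bool" where
  "loaded M j \<rho> \<mu> ss \<longleftrightarrow> params \<rho> \<and> length ss = j \<and>
    (\<forall>i<j. stored i (ss ! i) \<mu>) \<and> matrix_at M \<mu> \<and>
     (\<forall>z\<ge>region j. \<mu> z = 0)"

abbreviation "start M j \<equiv> exec Wd tp pre (ds_input (block_text N M j) (zero_pattern N))"

lemma hoare_load_block:
  assumes L: "loaded M j \<rho> \<mu> ss" and j: "j < J" "\<rho> 10 = j" and
    ll: "lossless_spmf (start M j)"
  shows "hoare H (200 * n + 3 * tp + 6 * R + 100) load_block \<rho> \<mu>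
    (\<lambda>\<rho>' \<mu>' ss'. \<rho>' 10 = j \<and> \<rho>' 6 = J \<and>
      loaded M (Suc j) (\<rho>'(10 := Suc j)) \<mu>' ss')
    (map_spmf (\<lambda>s. ss @ [s]) (start M j))"
  unfolding load_block_def
proof (rule hoare_select_then[where j = j])
  show "params \<rho>" using L by (simp add: loaded_def)
  fix \<rho>1 assume sel: "selected j \<rho>1"
  have p1: "\<rho>1 8 = n" "\<rho>1 9 = m" "\<rho>1 11 = region j" "\<rho>1 30 = cells j"
    using sel by (auto simp: selected_def params_def)
  \<comment> \<open>The memory after \<open>a\<close> characters of the text have been
    written.\<close>
  define \<mu>1 where "\<mu>1 a = (\<lambda>z. if cells j + m \<le> z \<and> z < cells j + m + a
      then block_text N M j ! (z - (cells j + m)) else \<mu> z)" for a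
  have regN: "N * N \<le> region j" using stride_ge(2) by simp
  have M\<mu>: "matrix_at M (\<mu>1 a)" for a
    by (rule matrix_at_cong[of M \<mu>]) (use L regN in \<open>auto simp: loaded_def
      \<mu>1_def\<close>)
  let ?I = "\<lambda>a \<rho>' \<mu>' (_::unit). selected j \<rho>' \<and> \<mu>' = \<mu>1 a"
  have loop: "hoare H (n * (60 + length write_char + 20) + 10)
    (for_loop 14 8 write_char) \<rho>1 \<mu>
      (?I n) (foldM (\<lambda>_ _. return_spmf ()) [0..<n] ())"
  proof (rule hoare_for[where I = ?I and X = X])
    fix a \<rho>' \<mu>' and u :: unit
    assume a: "a < n" "?I a \<rho>' \<mu>' u" "\<rho>' 14 = a" "\<rho>' 8 = n"
    have "\<mu>1 (Suc a) = (\<mu>1 a)(cells j + m + a := block_text N M j ! a)"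
      by (auto simp: \<mu>1_def fun_eq_iff less_Suc_eq)
    then show "hoare H 60 write_char \<rho>' \<mu>'
      (\<lambda>\<rho>' \<mu>' a'. \<rho>' 14 = a \<and> \<rho>' 8 = n \<and>
      ?I (Suc a) (\<rho>'(14 := Suc a)) \<mu>' a')
      (return_spmf ())"
      using a by (intro hoare_mono[OF hoare_write_char[of j \<rho>' a M \<mu>']])
        (auto simp: j M\<mu> selected_def params_def)
  qed (use sel p1 le_max fits3 in \<open>auto simp: \<mu>1_def fun_eq_iff\<close>)
  show "hoare H (200 * n + 3 * tp + 6 * R + 100 - 40)
    (for_loop 14 8 write_char @ store (Var 11) (Var 8) @ store (Var 11 \<oplus> Lit 1)
      (Var 9) @ call R pre) \<rho>1 \<mu>
    (\<lambda>\<rho>' \<mu>' ss'. \<rho>' 10 = j \<and> \<rho>' 6 = J \<and>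
      loaded M (Suc j) (\<rho>'(10 := Suc j)) \<mu>' ss')
    (map_spmf (\<lambda>s. ss @ [s]) (start M j))"
  proof (rule hoare_then[where \<Psi> = "?I n"])
    show "hoare H (200 * n + 15) (for_loop 14 8 write_char) \<rho>1 \<mu> (?I n) (return_spmf ())"
    proof (rule hoare_mono)
      show "hoare H (n * (60 + length write_char + 20) + 10)
        (for_loop 14 8 write_char) \<rho>1 \<mu>
        (?I n) (return_spmf ())"
        using loop by (simp only: foldM_return_unit)
    qed (auto simp: length_write_char)
    fix \<rho>2 \<mu>2 assume 2: "?I n \<rho>2 \<mu>2 ()"
    note p2 = 2[THEN conjunct1, unfolded selected_def params_def]
    define \<mu>3 where "\<mu>3 = \<mu>2(region j := n, region j + 1 := m)"
    have regX: "region j + 1 \<le> X" using region_le[of j] j stride_ge(1) R by auto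
    have \<mu>3: "\<mu>3 z = (if z = region j then n else if z = region j + 1 then m
      else if cells j + m \<le> z \<and> z < cells j + m + n then block_text N M j ! (z -
        (cells j + m)) else \<mu> z)" for z
      using 2 by (simp add: \<mu>3_def \<mu>1_def)
    have st: "stored j (ds_input (block_text N M j) (zero_pattern N)) \<mu>3"
      by (rule stored_input[OF _ \<mu>3]) (use L in \<open>auto simp: loaded_def\<close>)
    have frame: "\<mu>3 z = \<mu> z" if "off_region j z" for z
      using that cells_bounds[of j] R unfolding \<mu>3 by auto
    have "hoare H (3 * tp + 6 * R) (call R pre) \<rho>2 \<mu>3
      (\<lambda>\<rho>' \<mu>' s'. \<rho>' = \<rho>2 \<and>
        boxed Wd R (\<rho>2 11) (\<rho>2 30) s' \<mu>' \<and>
      (\<forall>z. \<not> (\<rho>2 11 \<le> z \<and> z < \<rho>2 11 + R) \<and>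
        \<not> (\<rho>2 30 \<le> z \<and> z < \<rho>2 30 + Wd) \<longrightarrow>
        \<mu>' z = \<mu>3 z))
      (start M j)"
      using p2 st ll below region_le[of j] j(1) stride_ge X_less_H
      by (intro hoare_call) auto
    then have "hoare H (3 * tp + 6 * R) (call R pre) \<rho>2 \<mu>3
      (\<lambda>\<rho>' \<mu>' s. \<rho>' 10 = j \<and> \<rho>' 6 = J \<and>
        loaded M (Suc j) (\<rho>'(10 := Suc j)) \<mu>' (ss @ [s]))
      (start M j)"
    proof (rule hoare_mono[OF _ order.refl])
      fix \<rho>' \<mu>' s
      assume *: "\<rho>' = \<rho>2 \<and> boxed Wd R (\<rho>2 11) (\<rho>2 30) s \<mu>' \<and>
        (\<forall>z. \<not> (\<rho>2 11 \<le> z \<and> z < \<rho>2 11 + R) \<and>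
          \<not> (\<rho>2 30 \<le> z \<and> z < \<rho>2 30 + Wd) \<longrightarrow>
          \<mu>' z = \<mu>3 z)"
      have fr: "\<mu>' z = \<mu> z" if "off_region j z" for z
        using * p2 that frame[OF that] cells_bounds[of j] by auto
      have st': "stored j s \<mu>'" using * p2 by simp
      have "stored i ((ss @ [s]) ! i) \<mu>'" if "i < Suc j" for i
      proof (cases "i = j")
        case True
        then show ?thesis using st' L by (simp add: loaded_def nth_append)
      next
        case False
        then have "i < j" using that by simp
        then have "stored i (ss ! i) \<mu>" using L by (simp add: loaded_def)
        from stored_other[OF this False fr] show ?thesis
          using \<open>i < j\<close> L by (simp add: loaded_def nth_append)
      qed
      moreover have "matrix_at M \<mu>'"
        by (rule matrix_at_cong[of M \<mu>]) (use L regN fr in \<open>auto simp: loaded_def\<close>)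
      moreover have "\<mu>' z = 0" if "region (Suc j) \<le> z" for z
      proof -
        have "\<mu> z = 0" using L that region_mono[of j "Suc j"] unfolding loaded_def by auto
        then show ?thesis using fr[of z] that by simp
      qed
      ultimately show "\<rho>' 10 = j \<and> \<rho>' 6 = J \<and>
        loaded M (Suc j) (\<rho>'(10 := Suc j)) \<mu>' (ss @ [s])"
        using * p2 2 L unfolding loaded_def selected_def by simp
    qed
    then have fin: "hoare H (3 * tp + 6 * R) (call R pre) \<rho>2 \<mu>3
      (\<lambda>\<rho>' \<mu>' ss'. \<rho>' 10 = j \<and> \<rho>' 6 = J \<and>
        loaded M (Suc j) (\<rho>'(10 := Suc j)) \<mu>' ss')
      (map_spmf (\<lambda>s. ss @ [s]) (start M j))"
      by (rule hoare_map)
    show "hoare H (200 * n + 3 * tp + 6 * R + 100 - 40 - (200 * n + 15))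
      (store (Var 11) (Var 8) @ store (Var 11 \<oplus> Lit 1) (Var 9) @ call R pre) \<rho>2 \<mu>2
     (\<lambda>\<rho>' \<mu>' ss'. \<rho>' 10 = j \<and> \<rho>' 6 = J \<and>
       loaded M (Suc j) (\<rho>'(10 := Suc j)) \<mu>' ss')
     (map_spmf (\<lambda>s. ss @ [s]) (start M j))"
      apply (rule hoare_store_then[OF fits, where a = "region j" and v = n],
          use p2 regX le_max in \<open>simp add: max_deg_def\<close>)
      apply (rule hoare_store_then[OF fits, where a = "region j + 1" and v = m],
          use p2 regX le_max in \<open>simp add: max_deg_def\<close>)
      apply (rule hoare_mono[OF fin[unfolded \<mu>3_def]])
      by auto
  qed auto
qed (use assms in auto)

lemma hoare_init:
  assumes "\<rho> 0 = N" and M: "matrix_at M \<mu>" and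
    zero: "\<And>z. N * N \<le> z \<Longrightarrow> \<mu> z = 0"
    and ll: "\<And>j. j < J \<Longrightarrow> lossless_spmf (start M j)"
  shows "hoare H ((root N + 1) * (4 * D + 30) + (2 * p + 2 * q + 4 * d + 200)
      + J * (200 * n + 3 * tp + 12 * R + 300)) init_prog \<rho> \<mu> (loaded M J) (seqn J
        (start M))"
proof -
  define \<rho>1 where "\<rho>1 = \<rho>(1 := root N, 1 := base N, 2 := r, 3 := w, 8 := n, 9 := m, 4
    := row_blocks N,
    5 := col_blocks N, 6 := J, 7 := Z, 19 := Q)"
  have p1: "params \<rho>1" using assms(1) by (simp add: \<rho>1_def params_def)
  have rootX: "root N \<le> X" using le_max(2) by (simp add: base_def)
  let ?B = "J * (200 * n + 3 * tp + 12 * R + 300)"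
  have len: "length load_block \<le> 6 * R + 100"
    by (simp add: load_block_def select_def)
  have "hoare H (J * (200 * n + 3 * tp + 6 * R + 100 + length load_block + 20) + 10)
    (for_loop 10 6 load_block) \<rho>1 \<mu> (loaded M J) (seqn J (start M))"
    unfolding seqn_def
  proof (rule hoare_for[where I = "loaded M" and X = X])
    fix j \<rho>' \<mu>' ss assume *: "j < J" "loaded M j \<rho>' \<mu>' ss" "\<rho>' 10 = j"
      "\<rho>' 6 = J"
    show "hoare H (200 * n + 3 * tp + 6 * R + 100) load_block \<rho>' \<mu>'
       (\<lambda>\<rho>' \<mu>' a'. \<rho>' 10 = j \<and> \<rho>' 6 = J \<and>
         loaded M (Suc j) (\<rho>'(10 := Suc j)) \<mu>' a')
       (map_spmf (\<lambda>x. ss @ [x]) (start M j))"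
      by (rule hoare_load_block) (use * ll in auto)
  next
    show "loaded M 0 (\<rho>1(10 := 0)) \<mu> []"
      using p1 M zero stride_ge(2) by (auto simp: loaded_def)
  qed (use p1 le_max fits3 in \<open>auto simp: params_def\<close>)
  then have loop: "hoare H (?B + 10) (for_loop 10 6 load_block) \<rho>1 \<mu> (loaded M J) (seqn J
    (start M))"
  proof (rule hoare_mono)
    show "J * (200 * n + 3 * tp + 6 * R + 100 + length load_block + 20) + 10 \<le> ?B + 10"
      using len by (intro add_mono[OF mult_le_mono2] order.refl) simp
  qed auto
  have "N div r \<le> N" "N div w \<le> N" by auto
  then have divs: "N div r \<le> X" "N div w \<le> X" using le_max(1) by linarith+
  show ?thesis
    unfolding init_prog_def
  proof (rule hoare_then[OF hoare_find_root[of \<rho>, OF assms(1)]], goal_cases)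
    case (2 \<rho>' \<mu>')
    then have eqs: "\<rho>' = \<rho>(1 := root N)" "\<mu>' = \<mu>" by auto
    show ?case
      unfolding eqs
      apply (rule hoare_assign_then[OF fits, where v = "base N"],
          use assms(1) le_max rootX in \<open>simp add: max_deg_def base_def\<close>)
      apply (rule hoare_assign_then[OF fits, where v = r],
          use assms(1) le_max rootX in \<open>simp add: max_deg_def rows_def\<close>)
      apply (rule hoare_assign_then[OF fits, where v = w],
          use assms(1) le_max rootX in \<open>simp add: max_deg_def cols_def\<close>)
      apply (rule hoare_assign_then[OF fits, where v = n],
          use assms(1) le_max rootX in \<open>simp add: max_deg_def text_length_def\<close>)
      apply (rule hoare_assign_then[OF fits, where v = m],
          use assms(1) le_max rootX in \<open>simp add: max_deg_def pattern_length_def\<close>)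
      apply (rule hoare_assign_then[OF fits, where v = "row_blocks N"],
          use assms(1) le_max rootX divs in \<open>simp add: max_deg_def row_blocks_def\<close>)
      apply (rule hoare_assign_then[OF fits, where v = "col_blocks N"],
          use assms(1) le_max rootX divs in \<open>simp add: max_deg_def col_blocks_def\<close>)
      apply (rule hoare_assign_then[OF fits, where v = J],
          use assms(1) le_max rootX in \<open>simp add: max_deg_def copies_def\<close>)
      apply (rule hoare_assign_then[OF fits, where v = Z],
          use assms(1) le_max rootX in \<open>simp add: max_deg_def stride_def\<close>)
      apply (rule hoare_assign_then[OF fits, where v = Q],
          use assms(1) le_max rootX in \<open>simp add: max_deg_def\<close>)
      apply (rule hoare_mono[OF loop[unfolded \<rho>1_def]])
      by auto
  qed auto
qed

section \<open>One round of updates and queries\<close>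

abbreviation "alive ops s \<equiv> lossless_spmf (run_operations Wd tu tq upd qry ops s)"
abbreviation "dstep \<equiv> ds_step Wd tu tq upd qry"

lemma stored_set_reg:
  assumes "stored j s \<mu>" "k < R" "v < Wd"
  shows "stored j (s\<lparr>regs := (regs s)(k := v)\<rparr>) (\<mu>(region j + k := v))"
  using assms by (auto simp: boxed_def)

lemma hoare_call_stored:
  assumes "stored j s \<mu>" "j < J" "\<rho> 11 = region j" "\<rho> 30 = cells j" "lossless_spmf
    (exec Wd t c s)" "regs_below R c"
  shows "hoare H (3 * t + 6 * R) (call R c) \<rho> \<mu>
    (\<lambda>\<rho>' \<mu>' s'. \<rho>' = \<rho> \<and> stored j s' \<mu>' \<and>
    (\<forall>z. \<not> (region j \<le> z \<and> z < region j + R) \<and>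
      \<not> (cells j \<le> z \<and> z < region (Suc j)) \<longrightarrow> \<mu>' z = \<mu> z))
    (exec Wd t c s)"
proof -
  have "cells j + Wd \<le> region (Suc j)" using cells_bounds(2)[of j] by simp
  moreover have "region (Suc j) \<le> H" using region_le[of j] assms(2) X_less_H by simp
  ultimately have "hoare H (3 * t + 6 * R) (call R c) \<rho> \<mu>
    (\<lambda>\<rho>' \<mu>' s'. \<rho>' = \<rho> \<and>
    boxed Wd R (\<rho> 11) (\<rho> 30) s' \<mu>' \<and>
    (\<forall>z. \<not> (\<rho> 11 \<le> z \<and> z < \<rho> 11 + R) \<and>
      \<not> (\<rho> 30 \<le> z \<and> z < \<rho> 30 + Wd) \<longrightarrow> \<mu>' z = \<mu> z))
    (exec Wd t c s)"
    using assms by (intro hoare_call) simp_all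
  then show ?thesis
    by (rule hoare_mono) (use assms(3,4) \<open>cells j + Wd \<le> _\<close> in auto)
qed

definition vector_at :: "(nat \<Rightarrow> bool) \<Rightarrow>
  (nat \<Rightarrow> nat) \<Rightarrow> bool" where
  "vector_at v \<mu> \<longleftrightarrow> (\<forall>y<N. \<mu> (N * N + y) = of_bool (v y))"

lemma vector_at_cong:
  "vector_at v \<mu> \<Longrightarrow> (\<And>z. off_region j z \<Longrightarrow>
    \<mu>' z = \<mu> z) \<Longrightarrow> vector_at v \<mu>'"
  using stride_ge(2) unfolding vector_at_def by (auto simp: trans_le_add1)

lemma m_less: "m + 1 \<le> X" using N by (simp add: max_value_def)

text \<open>The hypothesis \<open>alive\<close> is what the guarantee for \<open>run_ds\<close>
  yields about intermediate states: the remaining operations finish within their budgets. It passes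
  to every state in the support of the call.\<close>

lemma hoare_feed_char:
  assumes sel: "selected j \<rho>" and j: "j < J" and l: "\<rho> 14 = l" "l < w" and
    c: "\<rho> 18 = c" "c \<le> w"
    and v: "vector_at v \<mu>" and st: "stored j s \<mu>"
    and al: "alive (Update (2 * l + 1) (of_bool (coord N v j l)) # ops) s"
  shows "hoare H (80 + 3 * tu + 6 * R) feed_char \<rho> \<mu> (\<lambda>\<rho>' \<mu>'
    (as', s'). selected j \<rho>' \<and> \<rho>' 14 = l \<and>
    \<rho>' 18 = c + of_bool (coord N v j l) \<and> stored j s' \<mu>' \<and> as' = as \<and>
      alive ops s' \<and>
    (\<forall>z. off_region j z \<longrightarrow> \<mu>' z = \<mu> z))
    (dstep (Update (2 * l + 1) (of_bool (coord N v j l))) (as, s))"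
proof -
  note p = sel[unfolded selected_def params_def]
  let ?x = "of_bool (coord N v j l) :: nat"
  define y where "y = col_offset N j + l"
  define b where "b = (of_bool (y < N) :: nat)"
  have y: "y \<le> X" using copy_bounds(3)[OF j] le_max(12) l(2) by (simp add: y_def)
  then have off: "col_offset N j \<le> X" by (simp add: y_def)
  have NX: "1 \<le> X" using N le_max(1) by simp
  have bX: "b \<le> X" "?x \<le> X" using NX by (simp_all add: b_def)
  have \<mu>: "\<mu> (N * N + y * b) \<le> 1" "b * \<mu> (N * N + y * b) = ?x"
  proof -
    have "\<mu> (N * N + 0) = of_bool (v 0)" using v N unfolding vector_at_def
      by (metis less_le_trans zero_less_one)
    moreover have "\<mu> (N * N + y) = of_bool (v y)" if "y < N"
      using v that unfolding vector_at_def by blast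
    ultimately show "\<mu> (N * N + y * b) \<le> 1" "b * \<mu> (N * N + y * b) = ?x"
      by (auto simp: b_def coord_def y_def)
  qed
  have cX: "c \<le> X" "l \<le> X" "c + ?x \<le> X" using c(2) l(2) le_max(4) m_less
    by (auto simp: pattern_length_def)
  have regX: "region j + 1 \<le> X" using region_le[of j] j stride_ge(1) R by auto
  have Wd': "2 * l + 1 < Wd" "?x < Wd" using l(2) m_le_n Wd by (auto simp: pattern_length_def)
  define s1 where "s1 = s\<lparr>regs := (regs s)(0 := 2 * l + 1, 1 := ?x)\<rparr>"
  define \<mu>1 where "\<mu>1 = \<mu>(region j := 2 * l + 1, region j + 1 := ?x)"
  have st1: "stored j s1 \<mu>1"
    using stored_set_reg[OF stored_set_reg[OF st, of 0 "2 * l + 1"], of 1 ?x] R Wd'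
    by (simp add: s1_def \<mu>1_def)
  have ll: "lossless_spmf (exec Wd tu upd s1)" and
    al': "\<And>s'. s' \<in> set_spmf (exec Wd tu upd s1) \<Longrightarrow> alive ops s'"
    using al by (auto simp: s1_def)
  define \<rho>1 where "\<rho>1 = \<rho>(15 := y, 16 := b, 16 := ?x, 18 := c + ?x)"
  have sel1: "selected j \<rho>1" using sel by (simp add: \<rho>1_def)
  then have p1: "\<rho>1 11 = region j" "\<rho>1 30 = cells j" by (auto simp: selected_def)
  have "hoare H (3 * tu + 6 * R) (call R upd) \<rho>1 \<mu>1
    (\<lambda>\<rho>' \<mu>' s'. \<rho>' = \<rho>1 \<and> stored j s' \<mu>' \<and>
    (\<forall>z. \<not> (region j \<le> z \<and> z < region j + R) \<and>
      \<not> (cells j \<le> z \<and> z < region (Suc j)) \<longrightarrow> \<mu>' z = \<mu>1 z))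
    (exec Wd tu upd s1)"
    by (rule hoare_call_stored[OF st1 j p1 ll below(2)])
  then have fin: "hoare H (3 * tu + 6 * R) (call R upd) \<rho>1 \<mu>1 (\<lambda>\<rho>' \<mu>'
    (as', s'). selected j \<rho>' \<and> \<rho>' 14 = l \<and>
    \<rho>' 18 = c + ?x \<and> stored j s' \<mu>' \<and> as' = as \<and> alive ops s' \<and>
    (\<forall>z. off_region j z \<longrightarrow> \<mu>' z = \<mu> z)) (dstep (Update
      (2 * l + 1) ?x) (as, s))"
    unfolding ds_step.simps s1_def[symmetric]
  proof (intro hoare_map, elim hoare_mono[OF _ order.refl], goal_cases)
    case (1 \<rho>' \<mu>' s')
    have "\<mu>' z = \<mu> z" if "off_region j z" for z
    proof -
      have "\<mu>' z = \<mu>1 z" using 1 that cells_bounds(1)[of j] by auto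
      also have "\<dots> = \<mu> z" using that cells_bounds(1)[of j] R by (auto simp: \<mu>1_def)
      finally show ?thesis .
    qed
    then show ?case using 1 sel1 l al' by (auto simp: \<rho>1_def)
  qed
  show ?thesis
    unfolding feed_char_def
    apply (rule hoare_assign_then[OF fits, where v = y], use p l cX off in \<open>simp add:
      max_deg_def y_def\<close>)
    apply (rule hoare_assign_then[OF fits, where v = b], use p l y le_max(1) in \<open>simp add:
      max_deg_def b_def\<close>)
    apply (rule hoare_assign_then[OF fits, where v = ?x])
    subgoal using p l y le_max(1) bX \<mu> NX by (simp add: max_deg_def)
    apply (rule hoare_assign_then[OF fits, where v = "c + ?x"], use p c cX bX in \<open>simp add:
      max_deg_def\<close>)
    apply (rule hoare_store_then[OF fits, where a = "region j" and v = "2 * l + 1"],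
        use p l cX regX in \<open>simp add: max_deg_def\<close>)
    apply (rule hoare_store_then[OF fits, where a = "region j + 1" and v = ?x],
        use p l bX regX in \<open>simp add: max_deg_def\<close>)
    apply (rule hoare_mono[OF fin[unfolded \<rho>1_def \<mu>1_def]])
    by auto
qed

lemma weight_le: "weight N v j \<le> w"
  unfolding weight_def by (rule order.trans[OF sum_bounded_above[of _ _ 1]]) auto

text \<open>The code of a distance is its successor, hence the \<open>+ 1\<close>; the code 0 of
  infinity satisfies both sides.\<close>

lemma hit_decode: "hit N v j (decode_answer a) \<longleftrightarrow> a < weight N v j + w + 1"
  by (cases a) (auto simp: hit_def)

text \<open>The frame also covers the result cells of earlier rows, so that the loop over the rows
  can collect its bits.\<close>

lemma hoare_ask_row:
  assumes sel: "selected j \<rho>" and j: "j < J" and i: "\<rho> 14 = i" "i < r" and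
    c: "\<rho> 18 = weight N v j + w + 1"
    and st: "stored j s \<mu>" and al: "alive (Query (i * m) # ops) s"
  shows "hoare H (80 + 3 * tq + 6 * R) ask_row \<rho> \<mu> (\<lambda>\<rho>' \<mu>'
    (as', s'). \<rho>' = \<rho> \<and> stored j s' \<mu>' \<and> alive ops s' \<and>
    (\<exists>a. as' = as @ [a] \<and> \<mu>' (region j + R + i) = of_bool (hit N v j a)) \<and>
    (\<forall>z. off_region j z \<or> region j + R \<le> z \<and>
      z < region j + R + i \<longrightarrow> \<mu>' z = \<mu> z))
    (dstep (Query (i * m)) (as, s))"
proof -
  note p = sel[unfolded selected_def params_def]
  have regX: "region j + R + r \<le> X" using region_le[of j] j stride_ge(1) by auto
  have iX: "i \<le> X" using i(2) le_max(3) by simp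
  have wX: "weight N v j + w + 1 \<le> X" using weight_le[of v j] m_less
    by (simp add: pattern_length_def)
  have "i * m < r * m" using i(2) pos by simp
  also have "\<dots> = n" by (simp add: text_length_def pattern_length_def)
  finally have im: "i * m < Wd" using Wd by simp
  define s1 where "s1 = s\<lparr>regs := (regs s)(0 := i * m)\<rparr>"
  define \<mu>1 where "\<mu>1 = \<mu>(region j := i * m)"
  have st1: "stored j s1 \<mu>1"
    using stored_set_reg[OF st, of 0 "i * m"] R im by (simp add: s1_def \<mu>1_def)
  have ll: "lossless_spmf (exec Wd tq qry s1)" and
    al': "\<And>s'. s' \<in> set_spmf (exec Wd tq qry s1) \<Longrightarrow> alive ops s'"
    using al by (auto simp: s1_def)
  have p1: "\<rho> 11 = region j" "\<rho> 30 = cells j" using sel by (auto simp: selected_def)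
  let ?st = "store (Var 11 \<oplus> (Lit R \<oplus> Var 14)) (Bin Less (At (Var 11)) (Var 18))"
  have "hoare H (3 * tq + 6 * R + 20) (call R qry @ ?st) \<rho> \<mu>1
    (\<lambda>\<rho>' \<mu>' s'. \<rho>' = \<rho> \<and> stored j s' \<mu>' \<and>
     \<mu>' (region j + R + i) = of_bool (hit N v j (decode_answer (regs s' 0))) \<and>
    (\<forall>z. off_region j z \<or> region j + R \<le> z \<and>
      z < region j + R + i \<longrightarrow> \<mu>' z = \<mu> z))
    (exec Wd tq qry s1)"
  proof (rule hoare_append_det_right[OF hoare_call_stored[OF st1 j p1 ll below(3)]], elim conjE)
    fix \<rho>' \<mu>' s'
    assume 1: "\<rho>' = \<rho>" "stored j s' \<mu>'"
      and fr: "\<forall>z. \<not> (region j \<le> z \<and> z < region j + R) \<and>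
        \<not> (cells j \<le> z \<and> z < region (Suc j)) \<longrightarrow> \<mu>' z = \<mu>1 z"
    have r0: "\<mu>' (region j) = regs s' 0" "regs s' 0 < Wd"
      using 1(2)[unfolded boxed_def, THEN conjunct1, rule_format, of 0] R by simp_all
    have r0X: "regs s' 0 \<le> X" using r0(2) stride_ge(1) le_max(13) by linarith
    have bit: "(of_bool (regs s' 0 < weight N v j + w + 1) :: nat) = of_bool (hit N v j
      (decode_answer (regs s' 0)))"
      by (simp add: hit_decode)
    show "hoare H 20 ?st \<rho>' \<mu>' (\<lambda>\<rho>' \<mu>' _. \<rho>' = \<rho> \<and>
      stored j s' \<mu>' \<and>
       \<mu>' (region j + R + i) = of_bool (hit N v j (decode_answer (regs s' 0))) \<and>
      (\<forall>z. off_region j z \<or> region j + R \<le> z \<and>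
        z < region j + R + i \<longrightarrow> \<mu>' z = \<mu> z))
      (return_spmf ())"
    proof (rule hoare_store_last[OF fits, where a = "region j + R + i" and
          v = "of_bool (hit N v j (decode_answer (regs s' 0)))"])
      let ?\<mu> = "\<mu>'(region j + R + i := of_bool (hit N v j (decode_answer (regs s' 0))))"
      have "stored j s' ?\<mu>" by (rule stored_cong[OF 1(2)]) (use i in auto)
      moreover have "?\<mu> z = \<mu> z"
        if "off_region j z \<or> region j + R \<le> z \<and> z < region j + R + i" for z
      proof -
        have "?\<mu> z = \<mu>' z" using that i(2) cells_bounds(1)[of j] by auto
        also have "\<dots> = \<mu>1 z" using fr that i(2) cells_bounds(1)[of j] by auto
        also have "\<dots> = \<mu> z" using that R cells_bounds(1)[of j] by (auto simp: \<mu>1_def)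
        finally show ?thesis .
      qed
      ultimately show "\<rho>' = \<rho> \<and> stored j s' ?\<mu> \<and>
       ?\<mu> (region j + R + i) = of_bool (hit N v j (decode_answer (regs s' 0))) \<and>
       (\<forall>z. off_region j z \<or> region j + R \<le> z \<and>
         z < region j + R + i \<longrightarrow> ?\<mu> z = \<mu> z)"
        using 1(1) by simp
    qed (use 1(1) p i iX regX wX c r0 r0X in \<open>simp add: max_deg_def bit[symmetric]\<close>)
  qed
  then have fin: "hoare H (3 * tq + 6 * R + 20) (call R qry @ ?st) \<rho> \<mu>1
    (\<lambda>\<rho>' \<mu>' (as', s'). \<rho>' = \<rho> \<and> stored j s' \<mu>' \<and>
      alive ops s' \<and>
    (\<exists>a. as' = as @ [a] \<and> \<mu>' (region j + R + i) = of_bool (hit N v j a)) \<and>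
    (\<forall>z. off_region j z \<or> region j + R \<le> z \<and>
      z < region j + R + i \<longrightarrow> \<mu>' z = \<mu> z))
    (dstep (Query (i * m)) (as, s))"
    unfolding ds_step.simps s1_def[symmetric]
    by (intro hoare_map, elim hoare_mono[OF _ order.refl]) (use al' in auto)
  show ?thesis
    unfolding ask_row_def
    apply (rule hoare_store_then[OF fits, where a = "region j" and v = "i * m"],
        use p i iX regX le_max(6) in \<open>simp add: max_deg_def\<close>)
    apply (rule hoare_mono[OF fin[unfolded \<mu>1_def]])
    by auto
qed

lemma lengths: "length feed_char \<le> 6 * R + 100" "length ask_row \<le> 6 * R + 100"
  "length process_copy \<le> 100" "length count_vote \<le> 100" "length combine_block \<le> 100"
    "length combine_row \<le> 100"
  by (simp_all add: feed_char_def ask_row_def count_vote_def select_def process_copy_def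
    combine_block_def combine_row_def)

text \<open>The update loop leaves the weight of the relevant part of the vector in register 18;
  raised by \<open>w + 1\<close> it becomes the comparison value of the query loop. The list
  \<open>ops\<close> stands for the rounds still to come.\<close>

lemma hoare_process_copy:
  assumes p: "params \<rho>" and j: "\<rho> 10 = j" "j < J" and v: "vector_at v \<mu>" and
    st: "stored j s \<mu>"
    and al: "alive (block_ops N v j @ ops) s"
  shows "hoare H (w * (3 * tu + 12 * R + 200) + r *
    (3 * tq + 12 * R + 200) + 100) process_copy \<rho> \<mu>
    (\<lambda>\<rho>' \<mu>' (as, s'). params \<rho>' \<and> \<rho>' 10 = j \<and>
      stored j s' \<mu>' \<and> length as = r \<and>
      (\<forall>y<r. \<mu>' (region j + R + y) = of_bool (hit N v j (as ! y))) \<and>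
      (\<forall>z. off_region j z \<longrightarrow> \<mu>' z = \<mu> z))
    (foldM dstep (block_ops N v j) ([], s))"
proof -
  let ?U = "\<lambda>l. Update (2 * l + 1) (of_bool (coord N v j l))" and
    ?Q = "\<lambda>i. Query (i * m)"
  let ?frame = "\<lambda>\<mu>'. \<forall>z. off_region j z \<longrightarrow> \<mu>' z = \<mu> z"
  let ?cnt = "\<lambda>l. \<Sum>k<l. of_bool (coord N v j k) :: nat"
  let ?I = "\<lambda>l \<rho>' \<mu>' (as, s'). selected j \<rho>' \<and> \<rho>' 18 = ?cnt l \<and>
    stored j s' \<mu>' \<and> as = ([] :: enat list) \<and>
    alive (map ?U [l..<w] @ map ?Q [0..<r] @ ops) s' \<and> ?frame \<mu>'"
  let ?K = "\<lambda>i \<rho>' \<mu>' (as, s'). selected j \<rho>' \<and>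
    \<rho>' 18 = weight N v j + w + 1 \<and> stored j s' \<mu>' \<and> length as = i \<and>
    (\<forall>y<i. \<mu>' (region j + R + y) = of_bool (hit N v j (as ! y))) \<and>
    alive (map ?Q [i..<r] @ ops) s' \<and> ?frame \<mu>'"
  have cnt: "?cnt l \<le> l" for l by (rule order.trans[OF sum_bounded_above[of _ _ 1]]) auto
  have ops: "block_ops N v j = map ?U [0..<w] @ map ?Q [0..<r]" by (simp add: block_ops_def)
  have step: "foldM dstep (block_ops N v j) = (\<lambda>a. bind_spmf (foldM (\<lambda>l. dstep
    (?U l)) [0..<w] a) (foldM (\<lambda>i. dstep (?Q i)) [0..<r]))"
  proof
    have "foldM dstep (map g xs) = foldM (\<lambda>x. dstep (g x)) xs" for g and xs :: "nat list"
      by (rule ext) (rule foldM_map)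
    then show "foldM dstep (block_ops N v j) a =
        bind_spmf (foldM (\<lambda>l. dstep (?U l)) [0..<w] a) (foldM (\<lambda>i. dstep
          (?Q i)) [0..<r])" for a
      unfolding ops by (simp only: foldM_append)
  qed
  have loop1: "hoare H (w * (80 + 3 * tu + 6 * R + length feed_char + 20) + 10)
    (for_loop 14 3 feed_char) \<rho>1 \<mu>
      (?I w) (foldM (\<lambda>l. dstep (?U l)) [0..<w] ([], s))"
        if sel: "selected j \<rho>1" "\<rho>1 18 = 0" for \<rho>1
  proof (rule hoare_for[where I = ?I and X = X])
    fix l \<rho>' \<mu>' and a :: "enat list \<times> state"
    assume *: "l < w" "?I l \<rho>' \<mu>' a" "\<rho>' 14 = l" "\<rho>' 3 = w"
    obtain s' where a: "a = ([], s')" using *(2) by (cases a) auto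
    have upt: "[l..<w] = l # [Suc l..<w]" using *(1) by (rule upt_conv_Cons)
    have al': "alive (?U l # (map ?U [Suc l..<w] @ map ?Q [0..<r] @ ops)) s'"
      using *(2) unfolding a by (simp add: upt)
    have fr: "?frame \<mu>'" using *(2) a by simp
    have v': "vector_at v \<mu>'" by (rule vector_at_cong[OF v, of j]) (use fr in auto)
    have "hoare H (80 + 3 * tu + 6 * R) feed_char \<rho>' \<mu>' (\<lambda>\<rho>'' \<mu>''
      (as', s''). selected j \<rho>'' \<and> \<rho>'' 14 = l \<and>
      \<rho>'' 18 = ?cnt l + of_bool (coord N v j l) \<and> stored j s'' \<mu>'' \<and>
        as' = [] \<and>
      alive (map ?U [Suc l..<w] @ map ?Q [0..<r] @ ops) s'' \<and>
      (\<forall>z. off_region j z \<longrightarrow> \<mu>'' z = \<mu>' z)) (dstep (?U l) ([], s'))"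
      by (rule hoare_feed_char[where \<rho> = \<rho>' and \<mu> = \<mu>' and j = j and s = s' and
        v = v and l = l and c = "?cnt l" and
            ops = "map ?U [Suc l..<w] @ map ?Q [0..<r] @ ops", OF _ j(2) *(3,1) _ _ v' _ al'])
        (use *(2) a order.trans[OF cnt less_imp_le[OF *(1)]] in auto)
    then show "hoare H (80 + 3 * tu + 6 * R) feed_char \<rho>' \<mu>'
       (\<lambda>\<rho>' \<mu>' a'. \<rho>' 14 = l \<and> \<rho>' 3 = w \<and>
         ?I (Suc l) (\<rho>'(14 := Suc l)) \<mu>' a') (dstep (?U l) a)"
      unfolding a by (rule hoare_mono) (use fr in \<open>auto simp: selected_def params_def\<close>)
  next
    show "?I 0 (\<rho>1(14 := 0)) \<mu> ([], s)" using sel st al by (simp add: ops)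
  qed (use sel le_max(4) fits3 in \<open>auto simp: selected_def params_def\<close>)
  have loop2: "hoare H (r * (80 + 3 * tq + 6 * R + length ask_row + 20) + 10)
    (for_loop 14 2 ask_row) \<rho>1 \<mu>1
      (?K r) (foldM (\<lambda>i. dstep (?Q i)) [0..<r] ([], s1))"
        if K: "?K 0 (\<rho>1(14 := 0)) \<mu>1 ([], s1)" for \<rho>1 \<mu>1 s1
  proof (rule hoare_for[where I = ?K and X = X])
    fix i \<rho>' \<mu>' and a :: "enat list \<times> state"
    assume *: "i < r" "?K i \<rho>' \<mu>' a" "\<rho>' 14 = i" "\<rho>' 2 = r"
    obtain as s' where a: "a = (as, s')" by (cases a) auto
    have upt: "[i..<r] = i # [Suc i..<r]" using *(1) by (rule upt_conv_Cons)
    have al': "alive (?Q i # (map ?Q [Suc i..<r] @ ops)) s'"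
      using *(2) unfolding a by (simp add: upt)
    have "hoare H (80 + 3 * tq + 6 * R) ask_row \<rho>' \<mu>' (\<lambda>\<rho>'' \<mu>''
      (as', s''). \<rho>'' = \<rho>' \<and> stored j s'' \<mu>'' \<and>
      alive (map ?Q [Suc i..<r] @ ops) s'' \<and>
      (\<exists>a. as' = as @ [a] \<and> \<mu>'' (region j + R + i) = of_bool (hit N v j a)) \<and>
      (\<forall>z. off_region j z \<or> region j + R \<le> z \<and>
        z < region j + R + i \<longrightarrow> \<mu>'' z = \<mu>' z))
      (dstep (?Q i) (as, s'))"
      by (rule hoare_ask_row[where \<rho> = \<rho>' and \<mu> = \<mu>' and j = j and s = s' and
        v = v and i = i and ops = "map ?Q [Suc i..<r] @ ops", OF _ j(2) *(3,1) _ _ al'])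
        (use *(2) a in auto)
    then show "hoare H (80 + 3 * tq + 6 * R) ask_row \<rho>' \<mu>'
       (\<lambda>\<rho>' \<mu>' a'. \<rho>' 14 = i \<and> \<rho>' 2 = r \<and>
         ?K (Suc i) (\<rho>'(14 := Suc i)) \<mu>' a') (dstep (?Q i) a)"
      unfolding a
      by (rule hoare_mono) (use *(2-) a in \<open>auto simp: less_Suc_eq nth_append\<close>)
  next
    have "selected j \<rho>1" using K by simp
    then show "\<rho>1 2 = r" by (simp add: selected_def params_def)
  qed (use K le_max(3) fits3 in auto)
  let ?B1 = "w * (3 * tu + 12 * R + 200) + 10" and ?B2 = "r * (3 * tq + 12 * R + 200) + 10"
  have B: "w * (80 + 3 * tu + 6 * R + length feed_char + 20) + 10 \<le> ?B1"
    "r * (80 + 3 * tq + 6 * R + length ask_row + 20) + 10 \<le> ?B2"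
    using lengths by (intro add_mono[OF mult_le_mono2] order.refl; simp)+
  have main: "hoare H (?B1 + (?B2 + 10)) (for_loop 14 3 feed_char @ assign 18
    (Var 18 \<oplus> Var 3 \<oplus> Lit 1) @ for_loop 14 2 ask_row)
     \<rho>1 \<mu> (?K r) (foldM dstep (block_ops N v j) ([], s))"
       if sel: "selected j \<rho>1" "\<rho>1 18 = 0" for \<rho>1
    unfolding step
  proof (rule hoare_append, rule hoare_mono[OF loop1[OF sel] B(1)], clarify)
    fix \<rho>2 \<mu>2 s2 as2
    assume 2: "selected j \<rho>2" "\<rho>2 18 = ?cnt w" "stored j s2 \<mu>2"
      "alive (map ?U [w..<w] @ map ?Q [0..<r] @ ops) s2" "?frame \<mu>2"
    have wt: "weight N v j = ?cnt w" by (simp add: weight_def)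
    have bd: "?cnt w + w + 1 \<le> X" using weight_le[of v j] m_less
      by (simp add: wt pattern_length_def)
    have "hoare H ?B2 (for_loop 14 2 ask_row) (\<rho>2(18 := ?cnt w + w + 1)) \<mu>2 (?K r)
      (foldM (\<lambda>i. dstep (?Q i)) [0..<r] ([], s2))"
      by (rule hoare_mono[OF loop2 B(2)]) (use 2 in \<open>auto simp: wt\<close>)
    then show "hoare H (?B2 + 10) (assign 18 (Var 18 \<oplus> Var 3 \<oplus> Lit 1) @ for_loop 14 2
      ask_row) \<rho>2 \<mu>2 (?K r)
      (foldM (\<lambda>i. dstep (?Q i)) [0..<r] ([], s2))"
      apply (intro hoare_assign_then[OF fits, where v = "?cnt w + w + 1"])
      subgoal using 2 bd le_max(4) by (simp add: max_deg_def selected_def params_def)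
      by (erule hoare_mono) auto
  qed
  let ?B = "w * (3 * tu + 12 * R + 200) + r * (3 * tq + 12 * R + 200) + 100"
  show ?thesis
    unfolding process_copy_def
  proof (rule hoare_select_then[OF p j])
    fix \<rho>1 assume sel: "selected j \<rho>1"
    show "hoare H (?B - 40) (assign 18 (Lit 0) @ for_loop 14 3 feed_char @
      assign 18 (Var 18 \<oplus> Var 3 \<oplus> Lit 1) @ for_loop 14 2 ask_row) \<rho>1 \<mu>
    (\<lambda>\<rho>' \<mu>' (as, s'). params \<rho>' \<and> \<rho>' 10 = j \<and>
      stored j s' \<mu>' \<and> length as = r \<and>
      (\<forall>y<r. \<mu>' (region j + R + y) = of_bool (hit N v j (as ! y))) \<and> ?frame \<mu>')
    (foldM dstep (block_ops N v j) ([], s))"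
      apply (rule hoare_assign_then[OF fits, where v = 0], simp add: max_deg_def)
      apply (rule hoare_mono[OF main])
      using sel apply (auto simp: selected_def)
      done
  qed simp
qed

section \<open>Majority votes and the product vector\<close>

lemma copy_index_less:
  assumes "x < N" "b < col_blocks N" "c < Q"
  shows "copy_index N x b c < J"
proof -
  have "x div r \<le> N div r" using assms(1) by (intro div_le_mono) auto
  then have "(x div r + 1) * col_blocks N \<le> row_blocks N * col_blocks N"
    by (intro mult_right_mono) (auto simp: row_blocks_def)
  then have "x div r * col_blocks N + b < row_blocks N * col_blocks N" using assms(2) by simp
  then have "(x div r * col_blocks N + b + 1) * Q \<le> (row_blocks N * col_blocks N) * Q"
    by (intro mult_right_mono) auto
  then show ?thesis using assms(3) by (simp add: copy_index_def copies_def mult.commute)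
qed

definition answered :: "(nat \<Rightarrow> bool) \<Rightarrow> enat list list \<Rightarrow>
  (nat \<Rightarrow> nat) \<Rightarrow> bool" where
  "answered v A \<mu> \<longleftrightarrow> (\<forall>j<J. \<forall>y<r. \<mu>
    (region j + R + y) = of_bool (hit N v j (A ! j ! y)))"

lemma hoare_combine_block:
  assumes p: "params \<rho>" and x: "x < N" "\<rho> 12 = x div r" "\<rho> 14 = x mod r" and
    b: "\<rho> 13 = b" "b < col_blocks N"
    and 18: "\<rho> 18 = of_bool P" and A: "answered v A \<mu>"
  shows "hoare H (Q * 200 + 60) combine_block \<rho> \<mu>
    (\<lambda>\<rho>' \<mu>' _. \<mu>' = \<mu> \<and>
    \<rho>' 18 = of_bool (P \<or> majority N v A x b) \<and>
      (\<forall>y. y \<notin> {15, 16, 17, 18} \<longrightarrow>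
      \<rho>' y = \<rho> y)) (return_spmf ())"
proof -
  note p' = p[unfolded params_def]
  define k where "k = (x div r * col_blocks N + b) * Q"
  let ?h = "\<lambda>c. of_bool (hit N v (copy_index N x b c) (A ! copy_index N x b c !
    (x mod r))) :: nat"
  let ?I = "\<lambda>c \<rho>' \<mu>' (_::unit). \<mu>' = \<mu> \<and> \<rho>' 15 = k \<and>
    \<rho>' 16 = (\<Sum>c'<c. ?h c') \<and>
    (\<forall>y. y \<notin> {15, 16, 17} \<longrightarrow> \<rho>' y = \<rho> y)"
  have ci: "k + c = copy_index N x b c" for c by (simp add: k_def copy_index_def)
  have kX: "k + c + 1 \<le> X" if "c < Q" for c
    using copy_index_less[OF x(1) b(2) that] le_max(9) by (simp flip: ci)
  then have kX0: "k \<le> X" using Q by force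
  have xr: "x div r \<le> X" "x mod r < r" "x mod r \<le> X"
    using x(1) le_max(1,3) pos div_le_dividend[of x r] mod_less_divisor[of r x] by linarith+
  have bX: "b \<le> X" using b(2) le_max(8) by simp
  have sumb: "(\<Sum>c'<c. ?h c') \<le> c" for c
    by (rule order.trans[OF sum_bounded_above[of _ _ 1]]) auto
  have loop: "hoare H (Q * (30 + length count_vote + 20) + 10)
    (for_loop 17 19 count_vote) \<rho>1 \<mu>
      (?I Q) (foldM (\<lambda>_ _. return_spmf ()) [0..<Q] ())"
        if I: "?I 0 (\<rho>1(17 := 0)) \<mu> ()" for \<rho>1
  proof (rule hoare_for[where I = ?I and X = X])
    fix c \<rho>' \<mu>' and u :: unit
    assume *: "c < Q" "?I c \<rho>' \<mu>' u" "\<rho>' 17 = c" "\<rho>' 19 = Q"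
    let ?a = "Z * (k + c + 1) + (R + x mod r)"
    have a: "?a = region (copy_index N x b c) + R + x mod r" by (simp flip: ci)
    have \<mu>: "\<mu> ?a = ?h c"
      using A copy_index_less[OF x(1) b(2) *(1)] xr(2) unfolding a answered_def by simp
    have le1: "?h c \<le> X" using N le_max(1) by simp
    have sX: "(\<Sum>c'<c. ?h c') \<le> X" using sumb[of c] *(1) le_max(10) by linarith
    show "hoare H 30 count_vote \<rho>' \<mu>' (\<lambda>\<rho>' \<mu>' a'. \<rho>' 17 = c \<and>
      \<rho>' 19 = Q \<and> ?I (Suc c) (\<rho>'(17 := Suc c)) \<mu>' a')
      (return_spmf ())"
      unfolding count_vote_def
      apply (rule hoare_assign_last[OF fits, where v = "(\<Sum>c'<Suc c. ?h c')"])
      subgoal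
        using * p' x xr \<mu> le1 sX kX0 kX[OF *(1)] le_max(13) by (simp add: max_deg_def)
      subgoal using * by simp
      done
  next
    show "?I 0 (\<rho>1(17 := 0)) \<mu> ()" by (rule I)
    show "\<rho>1 19 = Q" using I p' by simp
  qed (use le_max(10) fits3 in auto)
  have Qs: "(\<Sum>c'<Q. ?h c') \<le> X" using sumb[of Q] le_max(10) by linarith
  have P1: "of_bool P \<le> X" using N le_max(1) by simp
  have "Q * (30 + length count_vote + 20) + 10 \<le> Q * 200 + 10"
    using lengths(4) by (intro add_mono[OF mult_le_mono2] order.refl) simp
  note loop' = hoare_mono[OF loop[simplified foldM_return_unit] this]
  show ?thesis
    unfolding combine_block_def
    apply (rule hoare_assign_then[OF fits, where v = 0], simp add: max_deg_def)
    apply (rule hoare_assign_then[OF fits, where v = k],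
        use p' x b xr bX le_max in \<open>simp add: max_deg_def k_def\<close>)
    apply (rule hoare_then[where \<Psi> = "?I Q"])
      apply (rule loop')
       apply simp
      apply assumption
     apply simp
    apply (rule hoare_assign_last[OF fits, where v = "of_bool (P \<or> majority N v A x b)"])
    subgoal using p' Qs P1 18 le_max(10) by (simp add: max_deg_def majority_def)
    subgoal by auto
    done
qed

lemma hoare_combine_row:
  assumes p: "params \<rho>" and x: "\<rho> 10 = x" "x < N" and A: "answered v A \<mu>"
  shows "hoare H (col_blocks N * (Q * 200 + 200) + 60) combine_row \<rho> \<mu>
    (\<lambda>\<rho>' \<mu>' _. params \<rho>' \<and> \<rho>' 10 = x \<and>
    \<mu>' = \<mu>(N * N + (N + x) := output_bits N v A ! x)) (return_spmf ())"
proof -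
  note p' = p[unfolded params_def]
  let ?o = "of_bool (\<exists>b<col_blocks N. majority N v A x b) :: nat"
  let ?I = "\<lambda>b \<rho>' \<mu>' (_::unit). \<mu>' = \<mu> \<and> params \<rho>' \<and>
    \<rho>' 10 = x \<and> \<rho>' 12 = x div r \<and> \<rho>' 14 = x mod r \<and>
    \<rho>' 18 = of_bool (\<exists>b'<b. majority N v A x b')"
  have loop: "hoare H (col_blocks N * (Q * 200 + 60 + length combine_block + 20) + 10)
    (for_loop 13 5 combine_block) \<rho>1 \<mu>
      (?I (col_blocks N)) (foldM (\<lambda>_ _. return_spmf ()) [0..<col_blocks N] ())"
        if I: "?I 0 (\<rho>1(13 := 0)) \<mu> ()" for \<rho>1
  proof (rule hoare_for[where I = ?I and X = X])
    fix b \<rho>' \<mu>' and u :: unit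
    assume *: "b < col_blocks N" "?I b \<rho>' \<mu>' u" "\<rho>' 13 = b" "\<rho>' 5 = col_blocks N"
    have eq: "\<mu>' = \<mu>" using *(2) by blast
    have "hoare H (Q * 200 + 60) combine_block \<rho>' \<mu>
      (\<lambda>\<rho>'' \<mu>' _. \<mu>' = \<mu> \<and>
      \<rho>'' 18 = of_bool ((\<exists>b'<b. majority N v A x b') \<or> majority N v A x b) \<and>
        (\<forall>y. y \<notin> {15, 16, 17, 18} \<longrightarrow> \<rho>'' y = \<rho>' y))
      (return_spmf ())"
      by (rule hoare_combine_block) (use * x A in auto)
    then show "hoare H (Q * 200 + 60) combine_block \<rho>' \<mu>'
      (\<lambda>\<rho>' \<mu>' a'. \<rho>' 13 = b \<and> \<rho>' 5 = col_blocks N \<and>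
       ?I (Suc b) (\<rho>'(13 := Suc b)) \<mu>' a') (return_spmf ())"
      unfolding eq by (rule hoare_mono[OF _ order.refl])
        (use * in \<open>auto simp: params_def less_Suc_eq\<close>)
  next
    show "?I 0 (\<rho>1(13 := 0)) \<mu> ()" by (rule I)
    show "\<rho>1 5 = col_blocks N" using I by (simp add: params_def)
  qed (use le_max(8) fits3 in auto)
  have "col_blocks N * (Q * 200 + 60 + length combine_block + 20) + 10 \<le> col_blocks N *
    (Q * 200 + 200) + 10"
    using lengths(5) by (intro add_mono[OF mult_le_mono2] order.refl) simp
  note loop' = hoare_mono[OF loop[simplified foldM_return_unit] this]
  have xX: "x \<le> X" using x(2) le_max(1) by simp
  have out: "output_bits N v A ! x = ?o" using x(2) by (simp add: output_bits_def)
  have oX: "?o \<le> X" using N le_max(1) by simp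
  show ?thesis
    unfolding combine_row_def out
    apply (rule hoare_assign_then[OF fits, where v = "x div r"], use p' x xX le_max in \<open>simp
      add: max_deg_def\<close>)
    apply (rule hoare_assign_then[OF fits, where v = "x mod r"], use p' x xX le_max in \<open>simp
      add: max_deg_def\<close>)
    apply (rule hoare_assign_then[OF fits, where v = 0], simp add: max_deg_def)
    apply (rule hoare_then[where \<Psi> = "?I (col_blocks N)"])
      apply (rule loop')
       apply (use p x in simp)
      apply assumption
     apply simp
    apply (rule hoare_store_last[OF fits, where a = "N * N + (N + x)" and v = ?o])
    subgoal using x xX oX le_max(1) by (simp add: max_deg_def params_def)
    subgoal using x by auto
    done
qed

text \<open>During the first loop the copies below the counter are in their new state and the others
  still in the old one. The second loop writes output cells only, which lie below all
  regions.\<close>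

lemma hoare_round:
  assumes p: "params \<rho>" and v: "vector_at v \<mu>" and len: "length ss = J"
    and st: "\<And>j. j < J \<Longrightarrow> stored j (ss ! j) \<mu>"
    and al: "\<And>j. j < J \<Longrightarrow> alive (block_ops N v j @ ops j) (ss ! j)"
  shows "hoare H (J * (w * (3 * tu + 12 * R + 200) + r * (3 * tq + 12 * R + 200) + 300)
      + N * (col_blocks N * (Q * 200 + 200) + 300) + 20) round_prog \<rho> \<mu>
    (\<lambda>\<rho>' \<mu>' xs. params \<rho>' \<and> length xs = J \<and>
      (\<forall>j<J. stored j (snd (xs ! j)) \<mu>') \<and>
       (\<forall>x<N. \<mu>' (N * N + N + x) = output_bits N v (map fst xs) ! x))
    (seqn J (\<lambda>j. foldM dstep (block_ops N v j) ([], ss ! j)))"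
proof -
  let ?I = "\<lambda>j \<rho>' \<mu>' xs. params \<rho>' \<and> length xs = j \<and>
    vector_at v \<mu>' \<and>
    (\<forall>i<J. stored i (if i < j then snd (xs ! i) else ss ! i) \<mu>') \<and>
    (\<forall>i<j. \<forall>y<r. \<mu>' (region i + R + y) = of_bool (hit N v i (fst
      (xs ! i) ! y)))"
  let ?B = "w * (3 * tu + 12 * R + 200) + r * (3 * tq + 12 * R + 200) + 100"
  have loop1: "hoare H (J * (?B + length process_copy + 20) + 10)
    (for_loop 10 6 process_copy) \<rho> \<mu> (?I J)
    (seqn J (\<lambda>j. foldM dstep (block_ops N v j) ([], ss ! j)))"
    unfolding seqn_def
  proof (rule hoare_for[where I = ?I and X = X])
    fix j \<rho>' \<mu>' and xs :: "(enat list \<times> state) list"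
    assume *: "j < J" "?I j \<rho>' \<mu>' xs" "\<rho>' 10 = j" "\<rho>' 6 = J"
    then have I: "params \<rho>'" "length xs = j" "vector_at v \<mu>'"
      "\<And>i. i < J \<Longrightarrow> stored i (if i < j then snd (xs ! i) else ss ! i) \<mu>'"
      "\<And>i y. i < j \<Longrightarrow> y < r \<Longrightarrow>
        \<mu>' (region i + R + y) = of_bool (hit N v i (fst (xs ! i) ! y))"
      by blast+
    have stj: "stored j (ss ! j) \<mu>'" using I(4)[OF *(1)] by simp
    show "hoare H ?B process_copy \<rho>' \<mu>' (\<lambda>\<rho>' \<mu>' a'. \<rho>' 10 = j \<and>
      \<rho>' 6 = J \<and> ?I (Suc j) (\<rho>'(10 := Suc j)) \<mu>' a')
      (map_spmf (\<lambda>x. xs @ [x]) (foldM dstep (block_ops N v j) ([], ss ! j)))"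
    proof (rule hoare_map, rule hoare_mono[OF hoare_process_copy[OF I(1) *(3,1) I(3) stj al[OF
      *(1)]] order.refl],
        clarify, goal_cases)
      case (1 \<rho>2 \<mu>2 as s2)
      have fr: "\<mu>2 z = \<mu>' z" if "off_region j z" for z using 1 that by blast
      have "stored i (if i < Suc j then snd ((xs @ [(as, s2)]) ! i) else ss ! i) \<mu>2"
        if "i < J" for i
      proof (cases "i = j")
        case True
        then show ?thesis using 1 I(2) by (simp add: nth_append)
      next
        case False
        have "stored i (if i < j then snd (xs ! i) else ss ! i) \<mu>2"
          by (rule stored_other[OF I(4)[OF that] False fr])
        then show ?thesis using False I(2) by (auto simp: nth_append less_Suc_eq)
      qed
      moreover have "\<mu>2 (region i + R + y) = of_bool (hit N v i (fst
        ((xs @ [(as, s2)]) ! i) ! y))"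
        if "i < Suc j" "y < r" for i y
      proof (cases "i = j")
        case True
        then show ?thesis using 1 I(2) that by (simp add: nth_append)
      next
        case False
        then have ij: "i < j" using that by simp
        have "region i + R + y < region (Suc i)" using cells_bounds(1)[of i] that by simp
        also have "\<dots> \<le> region j" using ij by (intro region_mono) simp
        finally have "\<mu>2 (region i + R + y) = \<mu>' (region i + R + y)" by (intro fr) simp
        then show ?thesis using I(5)[OF ij that(2)] I(2) ij by (simp add: nth_append)
      qed
      moreover have "vector_at v \<mu>2" by (rule vector_at_cong[OF I(3) fr])
      ultimately show ?case using 1 I(2) by (simp add: params_def)
    qed
  next
    show "?I 0 (\<rho>(10 := 0)) \<mu> []" using p v st by simp
  qed (use p le_max(9) fits3 in \<open>auto simp: params_def\<close>)
  have loop2: "hoare H (N * (col_blocks N * (Q * 200 + 200) + 60 + length combine_row + 20) + 10)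
    (for_loop 10 0 combine_row) \<rho>1 \<mu>1
    (\<lambda>\<rho>' \<mu>' _. params \<rho>' \<and> \<mu>' = (\<lambda>z.
      if N * N + N \<le> z \<and> z < N * N + N + N then output_bits N v (map fst xs) ! (z -
      (N * N + N)) else \<mu>1 z))
    (foldM (\<lambda>_ _. return_spmf ()) [0..<N] ())" if I: "?I J \<rho>1 \<mu>1 xs"
      for \<rho>1 \<mu>1 xs
  proof -
    let ?\<mu> = "\<lambda>x z. if N * N + N \<le> z \<and>
      z < N * N + N + x then output_bits N v (map fst xs) ! (z - (N * N + N)) else \<mu>1 z"
    let ?L = "\<lambda>x \<rho>' \<mu>' (_::unit). params \<rho>' \<and> \<mu>' = ?\<mu> x"
    have far: "N * N + N + x < region j" if "x < N" for x j
      using that stride_ge(2) by (simp add: algebra_simps trans_less_add1)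
    have A: "answered v (map fst xs) (?\<mu> x)" if "x \<le> N" for x
      unfolding answered_def
    proof (intro allI impI)
      fix j y assume "j < J" "y < r"
      have "N * N + N + x \<le> region j" using that stride_ge(2) by simp
      then have "?\<mu> x (region j + R + y) = \<mu>1 (region j + R + y)" by simp
      then show "?\<mu> x (region j + R + y) = of_bool (hit N v j (map fst xs ! j ! y))"
        using I \<open>j < J\<close> \<open>y < r\<close> by simp
    qed
    show ?thesis
    proof (rule hoare_for[where I = ?L and X = X])
      fix x \<rho>' \<mu>' and u :: unit
      assume *: "x < N" "?L x \<rho>' \<mu>' u" "\<rho>' 10 = x" "\<rho>' 0 = N"
      have upd: "(?\<mu> x)(N * N + (N + x) := output_bits N v (map fst xs) ! x) = ?\<mu> (Suc x)"
        by (auto simp: fun_eq_iff less_Suc_eq add.assoc)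
      show "hoare H (col_blocks N * (Q * 200 + 200) + 60) combine_row \<rho>' \<mu>'
        (\<lambda>\<rho>' \<mu>' a'. \<rho>' 10 = x \<and> \<rho>' 0 = N \<and>
          ?L (Suc x) (\<rho>'(10 := Suc x)) \<mu>' a') (return_spmf ())"
        by (rule hoare_mono[OF hoare_combine_row[of \<rho>' x v "map fst xs"] order.refl])
          (use * A[of x] upd in \<open>auto simp: params_def\<close>)
    qed (use I le_max(1) fits3 in \<open>auto simp: params_def fun_eq_iff\<close>)
  qed
  let ?B1 = "J * (?B + 200) + 10" and ?B2 = "N * (col_blocks N * (Q * 200 + 200) + 300) + 10"
  have B: "J * (?B + length process_copy + 20) + 10 \<le> ?B1"
    "N * (col_blocks N * (Q * 200 + 200) + 60 + length combine_row + 20) + 10 \<le> ?B2"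
    using lengths by (intro add_mono[OF mult_le_mono2] order.refl; simp)+
  have "hoare H (?B1 + ?B2) round_prog \<rho> \<mu>
    (\<lambda>\<rho>' \<mu>' xs. params \<rho>' \<and> length xs = J \<and>
      (\<forall>j<J. stored j (snd (xs ! j)) \<mu>') \<and>
       (\<forall>x<N. \<mu>' (N * N + N + x) = output_bits N v (map fst xs) ! x))
    (seqn J (\<lambda>j. foldM dstep (block_ops N v j) ([], ss ! j)))"
    unfolding round_prog_def
  proof (rule hoare_append_det_right[OF hoare_mono[OF loop1 B(1)]])
    fix \<rho>1 \<mu>1 xs assume I: "?I J \<rho>1 \<mu>1 xs"
    show "hoare H ?B2 (for_loop 10 0 combine_row) \<rho>1 \<mu>1
     (\<lambda>\<rho>' \<mu>' _. params \<rho>' \<and> length xs = J \<and>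
       (\<forall>j<J. stored j (snd (xs ! j)) \<mu>') \<and>
       (\<forall>x<N. \<mu>' (N * N + N + x) = output_bits N v (map fst xs) ! x)) (return_spmf ())"
    proof (rule hoare_mono[OF loop2[OF I, simplified foldM_return_unit] B(2)], goal_cases)
      case (1 \<rho>' \<mu>' a)
      have "stored j (snd (xs ! j)) \<mu>'" if "j < J" for j
      proof (rule stored_cong)
        show "stored j (snd (xs ! j)) \<mu>1" using I that by simp
        fix z assume "region j \<le> z"
        moreover have "N * N + N + N \<le> region j" using stride_ge(2) by simp
        ultimately show "\<mu>' z = \<mu>1 z" using 1 by simp
      qed
      then show ?case using 1 I by simp
    qed
  qed
  then show ?thesis by (rule hoare_mono) (simp_all add: algebra_simps)
qed

end

section \<open>From single rounds to the whole run\<close>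

lemma nth_concat_uniform:
  assumes "\<forall>xs\<in>set xss. length xs = k" "t < length xss" "i < k"
  shows "concat xss ! (t * k + i) = xss ! t ! i"
  using assms
proof (induction xss arbitrary: t)
  case (Cons xs xss)
  then show ?case by (cases t) (auto simp: nth_append)
qed simp

lemma length_foldM_ds_step:
  assumes "(as', s') \<in> set_spmf (foldM (ds_step W tu tq upd qry) ops (as, s))"
  shows "length as' = length as + length (filter
    (\<lambda>a. case a of Query i \<Rightarrow> True | _ \<Rightarrow> False) ops)"
  using assms
proof (induction ops arbitrary: as s)
  case (Cons a ops)
  then obtain as1 s1 where 1: "(as1, s1) \<in> set_spmf (ds_step W tu tq upd qry a (as, s))"
    and 2: "(as', s') \<in> set_spmf (foldM (ds_step W tu tq upd qry) ops (as1, s1))"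
    by (auto simp: set_bind_spmf bind_UNION)
  from 1 show ?case using Cons.IH[OF 2] by (cases a) auto
qed simp

text \<open>Provides \<open>alive\<close> for the next round in every state that a round can
  reach.\<close>

lemma lossless_run_operations_append:
  assumes "lossless_spmf (run_operations W tu tq upd qry (ops @ ops') s)"
    and "(as, s') \<in> set_spmf (foldM (ds_step W tu tq upd qry) ops ([], s))"
  shows "lossless_spmf (run_operations W tu tq upd qry ops' s')"
proof -
  have "lossless_spmf (map_spmf ((@) []) (run_operations W tu tq upd qry (ops @ ops') s))"
    using assms(1) by simp
  then show ?thesis using assms(2) unfolding run_operations_append by auto
qed

context reduction_run
begin

abbreviation "products M vs \<equiv> map (\<lambda>v. map of_bool (bool_mat_vec N M v)) vs"

definition init_time :: nat where "init_time = (root N + 1) * (4 * D + 30) +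
  (2 * p + 2 * q + 4 * d + 200)
      + J * (200 * n + 3 * tp + 12 * R + 300) + length init_prog + 1"
definition round_time :: nat where "round_time = J * (w * (3 * tu + 12 * R + 200) + r *
  (3 * tq + 12 * R + 200) + 300)
      + N * (col_blocks N * (Q * 200 + 200) + 300) + 20 + length round_prog + 1"

abbreviation "chunk ops s \<equiv> foldM dstep ops ([], s)"

definition all_ops :: "(nat \<Rightarrow> bool) list \<Rightarrow> nat \<Rightarrow> operation list
  list" where
  "all_ops vs j = map (\<lambda>v. block_ops N v j) vs"

definition outputs :: "(nat \<Rightarrow> bool) list \<Rightarrow> enat list list list \<Rightarrow>
  nat list list" where
  "outputs vs As = map (\<lambda>(v, A). output_bits N v A) (zip vs As)"

lemma low_params: "params (low \<rho>) = params \<rho>"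
  by (simp add: params_def low_def)

lemma omv_rounds_rel:
  assumes "params (regs s)" "length ss = J" "\<And>j. j < J \<Longrightarrow>
    stored j (ss ! j) (mem s)"
    and "\<And>j. j < J \<Longrightarrow> alive (concat (all_ops vs j)) (ss ! j)" and
      "length vs * round_time \<le> t"
  shows "rel_spmf (\<lambda>out As. out = outputs vs As) (omv_rounds H (block round_prog) N vs
    (s, t))
    (run_parallel J chunk (map (block_ops N) vs) ss)"
  using assms
proof (induction vs arbitrary: s t ss)
  case Nil
  then show ?case by (simp add: outputs_def)
next
  case (Cons v vs)
  obtain t2 where t2: "t = round_time + t2" "length vs * round_time \<le> t2"
  proof -
    have le: "round_time + length vs * round_time \<le> t" using Cons.prems(5) by simp
    obtain t2 where "t = round_time + t2" using le_Suc_ex[OF add_leD1[OF le]] by blast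
    with le that show ?thesis by simp
  qed
  define s1 where "s1 = omv_feed N v s"
  have far: "N * N + 2 * N \<le> region j" for j using stride_ge(2) by simp
  have v: "vector_at v (mem s1)"
    by (auto simp: vector_at_def s1_def omv_feed_def power2_eq_square)
  have st1: "stored j (ss ! j) (mem s1)" if "j < J" for j
    by (rule stored_cong[OF Cons.prems(3)[OF that]])
      (use far[of j] in \<open>auto simp: s1_def omv_feed_def power2_eq_square\<close>)
  have p1: "params (low (regs s1))" using Cons.prems(1)
    by (simp add: low_params s1_def omv_feed_def)
  have ops: "concat (all_ops (v # vs) j) = block_ops N v j @ concat (all_ops vs j)" for j
    by (simp add: all_ops_def)
  let ?p = "seqn J (\<lambda>j. chunk (block_ops N v j) (ss ! j))"
  let ?\<Phi> = "\<lambda>s' xs. params (regs s') \<and> length xs = J \<and>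
    (\<forall>j<J. stored j (snd (xs ! j)) (mem s')) \<and>
       (\<forall>x<N. mem s' (N * N + N + x) = output_bits N v (map fst xs) ! x)"
  have "simulates H (round_time - (length round_prog + 1)) round_prog s1 ?\<Phi> ?p"
  proof -
    have "hoare H (round_time - (length round_prog + 1)) round_prog (low (regs s1)) (mem s1)
      (\<lambda>\<rho>' \<mu>' xs. params \<rho>' \<and> length xs = J \<and>
        (\<forall>j<J. stored j (snd (xs ! j)) \<mu>') \<and>
       (\<forall>x<N. \<mu>' (N * N + N + x) = output_bits N v (map fst xs) ! x)) ?p"
      by (rule hoare_mono[OF hoare_round[where \<rho> = "low (regs s1)" and
        \<mu> = "mem s1", OF p1 v Cons.prems(2) st1 Cons.prems(4)[unfolded ops]]])
        (simp_all only: round_time_def add.assoc add_diff_cancel_left' diff_diff_left order.refl,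
          simp)
    from this[unfolded hoare_def, rule_format, OF refl refl] show ?thesis
      by (rule simulates_mono[OF _ order.refl]) (simp add: low_params)
  qed
  from simulates_block[OF this]
  have sim: "simulates H round_time [block round_prog] s1 ?\<Phi> ?p" by (simp add: round_time_def)
  \<comment> \<open>Budget beyond \<open>round_time\<close> is returned unspent, so at least
    \<open>t2\<close> is left for the later rounds.\<close>
  have "run H t ([block round_prog], s1) =
      map_spmf (\<lambda>(s', l). (s', l + t2)) (run H round_time ([block round_prog], s1))"
    unfolding t2(1) by (rule run_mono[OF simulates_lossless_run[OF sim]])
  then have "rel_spmf (\<lambda>(s', t') xs. ?\<Phi> s' xs \<and> t2 \<le> t' \<and>
    xs \<in> set_spmf ?p)
     (run H t ([block round_prog], s1)) ?p"
    using sim unfolding simulates_def by (auto simp: spmf_rel_map elim!: rel_spmf_mono_strong)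
  then show ?case
    unfolding omv_rounds.simps s1_def[symmetric] list.map run_parallel.simps
  proof (rule rel_spmf_bindI, clarify)
    fix s' :: state and t' xs
    assume xs: "params (regs s')" "length xs = J" "\<forall>j<J. stored j (snd (xs ! j)) (mem s')"
      and out: "\<forall>x<N. mem s' (N * N + N + x) = output_bits N v (map fst xs) ! x"
      and t': "t2 \<le> t'" and supp: "xs \<in> set_spmf ?p"
    have al: "alive (concat (all_ops vs j)) (snd (xs ! j))" if j: "j < J" for j
    proof (rule lossless_run_operations_append)
      show "alive (block_ops N v j @ concat (all_ops vs j)) (ss ! j)"
        using Cons.prems(4)[OF j] unfolding ops .
      show "(fst (xs ! j), snd (xs ! j)) \<in> set_spmf (chunk (block_ops N v j) (ss ! j))"
        using set_seqnD[OF supp] j by simp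
    qed
    have o: "omv_output N s' = output_bits N v (map fst xs)"
      using out by (intro nth_equalityI) (auto simp: omv_output_def output_bits_def
        power2_eq_square)
    have "rel_spmf (\<lambda>out As. out = outputs vs As) (omv_rounds H (block round_prog) N vs
      (s', t'))
      (run_parallel J chunk (map (block_ops N) vs) (map snd xs))"
      by (rule Cons.IH) (use xs al t' t2(2) in auto)
    then show "rel_spmf (\<lambda>out As. out = outputs (v # vs) As)
       (map_spmf ((#) (omv_output N s')) (omv_rounds H (block round_prog) N vs (s', t')))
       (map_spmf ((#) (map fst xs)) (run_parallel J chunk (map (block_ops N) vs) (map snd xs)))"
      by (auto simp: spmf_rel_map o outputs_def elim!: rel_spmf_mono)
  qed
qed

definition copy_run :: "(nat \<Rightarrow> nat \<Rightarrow> bool) \<Rightarrow>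
  (nat \<Rightarrow> bool) list \<Rightarrow> nat \<Rightarrow> enat list list spmf" where
  "copy_run M vs j = bind_spmf (start M j) (run_chunks chunk (all_ops vs j))"

lemma run_ds_conv_copy_run:
  "run_ds Wd tp tu tq pre upd qry (block_text N M j) (zero_pattern N) (concat (all_ops vs j)) =
    map_spmf concat (copy_run M vs j)"
  unfolding run_ds_def copy_run_def
  by (simp only: map_spmf_bind_spmf o_def run_operations_concat[symmetric])

text \<open>Complete runs are indexed by copy first, whereas outputs are formed round by
  round.\<close>

definition rearrange :: "nat \<Rightarrow> enat list list list \<Rightarrow> enat list list list"
  where
  "rearrange k L = map (\<lambda>i. map (\<lambda>j. L ! j ! i) [0..<J]) [0..<k]"

text \<open>The coupling relates the output to the interleaved run, and
  \<open>run_parallel_conv_seqn\<close> turns the latter into \<open>J\<close> independent runs.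
  From here on probabilities are computed without reference to the host program.\<close>

lemma run_omv_eq:
  assumes ll: "\<And>j. j < J \<Longrightarrow> lossless_spmf (copy_run M vs j)"
    and t: "init_time + length vs * round_time \<le> t"
  shows "run_omv H t (block init_prog) (block round_prog) N M vs =
    map_spmf (\<lambda>L. outputs vs (rearrange (length vs) L)) (seqn J (copy_run M vs))"
proof -
  define s where "s = omv_input N M"
  obtain t2 where t2: "t = init_time + t2" "length vs * round_time \<le> t2"
  proof -
    obtain t2 where "t = init_time + t2" using le_Suc_ex[OF add_leD1[OF t]] by blast
    with t that show ?thesis by simp
  qed
  have ll_start: "lossless_spmf (start M j)" if "j < J" for j
    using ll[OF that] by (simp add: copy_run_def)
  have al: "alive (concat (all_ops vs j)) s'" if "j < J" "s' \<in> set_spmf (start M j)" for j s'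
    using ll[OF that(1)] that(2) by (simp add: copy_run_def run_operations_concat)
  have "matrix_at M (mem s)"
    unfolding matrix_at_def
  proof (intro allI impI)
    fix i l assume il: "i < N" "l < N"
    then have "i * N + l < (i + 1) * N" by simp
    also have "\<dots> \<le> N * N" using il by (intro mult_right_mono) auto
    finally show "mem s (i * N + l) = of_bool (M i l)" using il
      by (simp add: s_def omv_input_def power2_eq_square)
  qed
  moreover have "mem s z = 0" if "N * N \<le> z" for z using that
    by (simp add: s_def omv_input_def power2_eq_square)
  moreover have "low (regs s) 0 = N" by (simp add: s_def omv_input_def low_def)
  ultimately have "simulates H (init_time - (length init_prog + 1)) init_prog s
      (\<lambda>s' ss. loaded M J (low (regs s')) (mem s') ss) (seqn J (start M))"
  proof -
    assume *: "matrix_at M (mem s)" "\<And>z. N * N \<le> z \<Longrightarrow>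
      mem s z = 0" "low (regs s) 0 = N"
    have "hoare H (init_time - (length init_prog + 1)) init_prog (low (regs s)) (mem s)
      (loaded M J) (seqn J (start M))"
      by (rule hoare_mono[OF hoare_init[where \<rho> = "low (regs s)" and
        \<mu> = "mem s", OF *(3,1,2) ll_start]]) (simp_all add: init_time_def)
    from this[unfolded hoare_def, rule_format, OF refl refl] show ?thesis .
  qed
  from simulates_block[OF this]
  have sim: "simulates H init_time [block init_prog] s
      (\<lambda>s' ss. loaded M J (low (regs s')) (mem s') ss) (seqn J (start M))"
        by (simp add: init_time_def)
  have "run H t ([block init_prog], s) =
      map_spmf (\<lambda>(s', l). (s', l + t2)) (run H init_time ([block init_prog], s))"
    unfolding t2(1) by (rule run_mono[OF simulates_lossless_run[OF sim]])
  then have "rel_spmf (\<lambda>(s', t') ss. loaded M J (low (regs s')) (mem s') ss \<and>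
    t2 \<le> t' \<and> ss \<in> set_spmf (seqn J (start M)))
     (run H t ([block init_prog], s)) (seqn J (start M))"
    using sim unfolding simulates_def by (auto simp: spmf_rel_map elim!: rel_spmf_mono_strong)
  then have "rel_spmf (\<lambda>out As. out = outputs vs As) (run_omv H t (block init_prog)
    (block round_prog) N M vs)
     (bind_spmf (seqn J (start M)) (run_parallel J chunk (map (block_ops N) vs)))"
    unfolding run_omv_def s_def[symmetric]
  proof (rule rel_spmf_bindI, clarify)
    fix s' :: state and t' ss
    assume L: "loaded M J (low (regs s')) (mem s') ss" and t': "t2 \<le> t'" and
      ss: "ss \<in> set_spmf (seqn J (start M))"
    show "rel_spmf (\<lambda>out As. out = outputs vs As) (omv_rounds H (block round_prog) N vs
      (s', t'))
       (run_parallel J chunk (map (block_ops N) vs) ss)"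
      by (rule omv_rounds_rel) (use L t' t2(2) set_seqnD[OF ss] al in \<open>auto simp: loaded_def
        low_params\<close>)
  qed
  then have "rel_spmf (=) (run_omv H t (block init_prog) (block round_prog) N M vs)
     (map_spmf (outputs vs) (bind_spmf (seqn J (start M)) (run_parallel J chunk (map
       (block_ops N) vs))))"
    by (simp add: spmf_rel_map)
  then have "run_omv H t (block init_prog) (block round_prog) N M vs =
     map_spmf (outputs vs) (bind_spmf (seqn J (start M)) (run_parallel J chunk (map
       (block_ops N) vs)))"
    by (simp add: spmf_rel_eq)
  also have "bind_spmf (seqn J (start M)) (run_parallel J chunk (map (block_ops N) vs)) =
      bind_spmf (seqn J (start M)) (\<lambda>ss. map_spmf (rearrange (length vs)) (seqn J
        (\<lambda>j. run_chunks chunk (all_ops vs j) (ss ! j))))"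
  proof (rule bind_spmf_cong[OF refl])
    fix ss assume "ss \<in> set_spmf (seqn J (start M))"
    then have "length ss = J" by (auto dest: set_seqnD)
    from run_parallel_conv_seqn[OF this, of chunk "map (block_ops N) vs"]
    show "run_parallel J chunk (map (block_ops N) vs) ss =
      map_spmf (rearrange (length vs)) (seqn J (\<lambda>j. run_chunks chunk (all_ops vs j)
        (ss ! j)))"
      by (simp add: rearrange_def[abs_def] all_ops_def o_def)
  qed
  also have "\<dots> = map_spmf (rearrange (length vs)) (seqn J (copy_run M vs))"
  proof -
    have eq: "seqn J (copy_run M vs) =
        bind_spmf (seqn J (start M)) (\<lambda>ss. seqn J (\<lambda>j. run_chunks chunk
          (all_ops vs j) (ss ! j)))"
      unfolding copy_run_def[abs_def] by (rule seqn_bind[where f = "\<lambda>j. run_chunks chunk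
        (all_ops vs j)", symmetric])
    show ?thesis unfolding eq by (simp only: map_spmf_bind_spmf o_def)
  qed
  finally show ?thesis by (simp add: spmf.map_comp o_def)
qed

subsection \<open>Correctness of the answers\<close>

definition block_pattern :: "(nat \<Rightarrow> bool) \<Rightarrow> nat \<Rightarrow> nat list"
  where
  "block_pattern v j = map (\<lambda>a. of_bool (odd a \<and> coord N v j (a div 2))) [0..<m]"

definition distance :: "(nat \<Rightarrow> nat \<Rightarrow> bool) \<Rightarrow>
  (nat \<Rightarrow> bool) \<Rightarrow> nat \<Rightarrow> nat \<Rightarrow> nat" where
  "distance M v j i = hamming_distance (take m (drop (i * m) (block_text N M j)))
    (block_pattern v j)"

lemma correct_answers_updates:
  "correct_answers k T P (map (\<lambda>l. Update (f l) (g l)) ls @ ops) =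
    correct_answers k T (fold (\<lambda>l P. P[f l := g l]) ls P) ops"
  by (induction ls arbitrary: P) auto

lemma correct_answers_queries:
  "correct_answers k T P (map (\<lambda>i. Query (f i)) is @ ops) =
    map (\<lambda>i. k_mismatch_query k T P (f i)) is @ correct_answers k T P ops"
  by (induction "is") auto

text \<open>The invariant of the pattern over all rounds, as updates touch odd positions
  only.\<close>

definition even_zero :: "nat list \<Rightarrow> bool" where
  "even_zero P \<longleftrightarrow> length P = m \<and>
    (\<forall>a<m. even a \<longrightarrow> P ! a = 0)"

text \<open>Starts from any such pattern because the odd positions still hold the previous vector;
  the induction is over the number of coordinates already replaced.\<close>

lemma fold_updates:
  assumes "even_zero P" "k \<le> w"
  shows "let P' = fold (\<lambda>l P. P[2 * l + 1 := of_bool (coord N v j l)]) [0..<k] P in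
    even_zero P' \<and> (\<forall>a<2 * k. P' ! a = of_bool (odd a \<and> coord N v j (a div 2)))"
  using assms(2)
proof (induction k)
  case 0
  then show ?case using assms by simp
next
  case (Suc k)
  define P' where "P' = fold (\<lambda>l P. P[2 * l + 1 := of_bool (coord N v j l)]) [0..<k] P"
  have IH: "even_zero P'" "\<And>a. a < 2 * k \<Longrightarrow> P' ! a = of_bool (odd a \<and>
    coord N v j (a div 2))"
    using Suc by (auto simp: P'_def Let_def)
  have len: "length P' = m" "2 * k + 1 < m"
    using IH(1) Suc.prems by (auto simp: even_zero_def pattern_length_def)
  have "P'[2 * k + 1 := of_bool (coord N v j k)] ! a = of_bool (odd a \<and> coord N v j (a div 2))"
    if "a < 2 * Suc k" for a
  proof -
    have "a < 2 * k \<or> a = 2 * k \<or> a = 2 * k + 1" using that by presburger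
    then consider "a < 2 * k" | "a = 2 * k" | "a = 2 * k + 1" by blast
    then show ?thesis
    proof cases
      case 2
      then show ?thesis using IH(1) len by (auto simp: even_zero_def)
    qed (use IH len in auto)
  qed
  moreover have "even_zero (P'[2 * k + 1 := of_bool (coord N v j k)])"
    using IH(1) len(2) by (auto simp: even_zero_def nth_list_update)
  ultimately show ?case by (simp add: P'_def Let_def)
qed

lemma even_zero_block_pattern: "even_zero (block_pattern v j)"
  by (auto simp: even_zero_def block_pattern_def)

lemma fold_all_updates:
  assumes "even_zero P"
  shows "fold (\<lambda>l P. P[2 * l + 1 := of_bool (coord N v j l)]) [0..<w] P = block_pattern v j"
  using fold_updates[OF assms order.refl, of v j]
  by (intro nth_equalityI) (auto simp: Let_def even_zero_def block_pattern_def pattern_length_def)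

lemma hamming_distance_le: "hamming_distance S P \<le> length S"
  unfolding hamming_distance_def using card_mono[of "{..<length S}" "{i. i < length S \<and>
    S ! i \<noteq> P ! i}"] by auto

lemma distance_le: "distance M v j i \<le> m"
  unfolding distance_def by (rule order.trans[OF hamming_distance_le]) auto

text \<open>With \<open>m \<le> k\<close> no distance exceeds the threshold, so all correct answers
  are finite. Since a round replaces the whole vector, it may start from whatever pattern the
  previous one left.\<close>

lemma correct_answers_all_ops:
  assumes "m \<le> k" "even_zero P"
  shows "correct_answers k (block_text N M j) P (concat (all_ops vs j)) =
    concat (map (\<lambda>v. map (\<lambda>i. enat (distance M v j i)) [0..<r]) vs)"
  using assms(2)
proof (induction vs arbitrary: P)
  case Nil
  then show ?case by (simp add: all_ops_def)
next
  case (Cons v vs)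
  have len: "length (block_pattern v j) = m" by (simp add: block_pattern_def)
  have "k_mismatch_query k (block_text N M j) (block_pattern v j) (i * m) = enat
    (distance M v j i)" for i
    using order.trans[OF distance_le[of M v j i] assms(1)]
    by (simp add: k_mismatch_query_def len Let_def distance_def)
  moreover have "concat (all_ops (v # vs) j) = map (\<lambda>l. Update (2 * l + 1) (of_bool
    (coord N v j l))) [0..<w] @
    map (\<lambda>i. Query (i * m)) [0..<r] @ concat (all_ops vs j)"
    by (simp add: all_ops_def block_ops_def)
  ultimately show ?case
    using Cons.IH[OF even_zero_block_pattern[of v j]]
    by (simp only: correct_answers_updates correct_answers_queries fold_all_updates[OF Cons.prems]
      list.map concat.simps)
qed

lemma even_zero_zero_pattern: "even_zero (zero_pattern N)"
  by (simp add: even_zero_def zero_pattern_def)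

text \<open>
  Each coordinate contributes one mismatch, one more if the vector has a one there, and two less
  if the matrix entry is one as well.
\<close>

lemma distance_eq:
  assumes "i < r"
  shows "distance M v j i + 2 * (\<Sum>l<w. of_bool (coord N v j l \<and>
    entry N M (row_offset N j + i) (col_offset N j + l)))
    = w + weight N v j"
proof -
  let ?e = "\<lambda>l. entry N M (row_offset N j + i) (col_offset N j + l)"
  let ?S = "take m (drop (i * m) (block_text N M j))" and ?P = "block_pattern v j"
  have "(i + 1) * m \<le> r * m" using assms by (intro mult_right_mono) auto
  also have "r * m = n" by (simp add: text_length_def pattern_length_def)
  finally have im: "i * m + m \<le> n" by simp
  then have len: "length ?S = m" by simp
  have S: "?S ! a = of_bool (?e (a div 2) \<longleftrightarrow> odd a)" if "a < m" for a
  proof -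
    have "even (i * m + a) = even a" by (simp add: pattern_length_def)
    moreover have "(i * m + a) div m = i" "(i * m + a) mod m = a" using that pos by auto
    ultimately show ?thesis using that im by (simp add: block_text_def)
  qed
  have P: "?P ! a = of_bool (odd a \<and> coord N v j (a div 2))" if "a < m" for a
    using that by (simp add: block_pattern_def)
  have "distance M v j i = (\<Sum>a<m. of_bool (?S ! a \<noteq> ?P ! a))"
  proof -
    have "card {a. a < m \<and> P a} = (\<Sum>a<m. of_bool (P a))" for P
      by (simp add: lessThan_def Collect_conj_eq)
    then show ?thesis unfolding distance_def hamming_distance_def len .
  qed
  also have "\<dots> = (\<Sum>a<2 * w. of_bool (of_bool (?e
    (a div 2) \<longleftrightarrow> odd a) \<noteq> (of_bool (odd a \<and>
    coord N v j (a div 2)) :: nat)))"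
    unfolding pattern_length_def[symmetric] by (intro sum.cong refl) (simp only: S P lessThan_iff)
  \<comment> \<open>Groups the positions \<open>2 * l\<close> and \<open>2 * l + 1\<close> of one
    coordinate: the first mismatches iff the entry is 0, the second iff entry and coordinate
    differ.\<close>
  also have "\<dots> = (\<Sum>l<w. of_bool (\<not> ?e l) + of_bool (?e l \<noteq> coord N v j l))"
  proof -
    have "(\<Sum>a<2 * k. of_bool (of_bool (?e (a div 2) \<longleftrightarrow> odd a) \<noteq>
      (of_bool (odd a \<and> coord N v j (a div 2)) :: nat)))
      = (\<Sum>l<k. of_bool (\<not> ?e l) + of_bool (?e l \<noteq> coord N v j l) :: nat)" for k
      by (induction k) auto
    then show ?thesis .
  qed
  finally have "distance M v j i + 2 * (\<Sum>l<w. of_bool (coord N v j l \<and> ?e l)) =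
    (\<Sum>l<w. (of_bool (\<not> ?e l) + of_bool (?e l \<noteq> coord N v j l)) + 2 * of_bool
      (coord N v j l \<and> ?e l))"
    by (simp add: sum.distrib sum_distrib_left)
  also have "\<dots> = (\<Sum>l<w. 1 + of_bool (coord N v j l))"
    by (rule sum.cong) auto
  also have "\<dots> = (\<Sum>l<w. 1) + weight N v j" by (simp only: sum.distrib weight_def)
  also have "\<dots> = w + weight N v j" by simp
  finally show ?thesis .
qed

text \<open>By \<open>distance_eq\<close> the distance drops below \<open>w + weight\<close> exactly
  if the inner product is positive.\<close>

lemma hit_distance:
  assumes "i < r"
  shows "hit N v j (enat (distance M v j i)) \<longleftrightarrow>
    (\<exists>l<w. coord N v j l \<and> entry N M (row_offset N j + i) (col_offset N j + l))"
proof -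
  let ?s = "\<Sum>l<w. of_bool (coord N v j l \<and> entry N M (row_offset N j + i)
    (col_offset N j + l)) :: nat"
  have "hit N v j (enat (distance M v j i)) \<longleftrightarrow> ?s \<noteq> 0"
    using distance_eq[OF assms, of M v j] unfolding hit_def enat.case by linarith
  also have "\<dots> \<longleftrightarrow> (\<exists>l<w. coord N v j l \<and>
    entry N M (row_offset N j + i) (col_offset N j + l))"
    by (subst sum_eq_0_iff) auto
  finally show ?thesis .
qed

text \<open>All copies of a block share its text, so the criterion is the same for every
  \<open>c\<close>.\<close>

lemma hit_copy_index:
  assumes x: "x < N" and b: "b < col_blocks N" and c: "c < Q"
  shows "hit N v (copy_index N x b c) (enat (distance M v (copy_index N x b c)
    (x mod r))) \<longleftrightarrow>
    (\<exists>y<N. y div w = b \<and> M x y \<and> v y)"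
proof -
  let ?j = "copy_index N x b c"
  have jq: "?j div Q = x div r * col_blocks N + b" using c by (simp add: copy_index_def)
  have ro: "row_offset N ?j + x mod r = x" using b unfolding row_offset_def jq by simp
  have co: "col_offset N ?j = b * w" using b unfolding col_offset_def jq by simp
  have "(\<exists>l<w. coord N v ?j l \<and> entry N M x (b * w + l)) \<longleftrightarrow>
    (\<exists>y<N. y div w = b \<and> M x y \<and> v y)"
  proof
    assume "\<exists>l<w. coord N v ?j l \<and> entry N M x (b * w + l)"
    then obtain l where "l < w" "coord N v ?j l" "entry N M x (b * w + l)" by blast
    then show "\<exists>y<N. y div w = b \<and> M x y \<and> v y"
      by (intro exI[of _ "b * w + l"]) (auto simp: coord_def entry_def co)
  next
    assume "\<exists>y<N. y div w = b \<and> M x y \<and> v y"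
    then obtain y where "y < N" "y div w = b" "M x y" "v y" by blast
    then show "\<exists>l<w. coord N v ?j l \<and> entry N M x (b * w + l)"
      using x pos by (intro exI[of _ "y mod w"]) (auto simp: coord_def entry_def co)
  qed
  then show ?thesis using hit_distance[of "x mod r" v ?j M] pos by (simp add: ro co)
qed

text \<open>Of \<open>2 * h - 1\<close> copies fewer than \<open>h\<close> err, so at least
  \<open>h\<close> of them, more than half, vote for the truth.\<close>

lemma majority_correct:
  assumes x: "x < N" and b: "b < col_blocks N" and h: "Q = 2 * h - 1"
    and few: "card {c. c < Q \<and> A ! copy_index N x b c ! (x mod r) \<noteq> enat (distance M v
      (copy_index N x b c) (x mod r))} < h"
  shows "majority N v A x b \<longleftrightarrow> (\<exists>y<N. y div w = b \<and> M x y \<and>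
    v y)"
proof -
  let ?bad = "{c. c < Q \<and> A ! copy_index N x b c ! (x mod r) \<noteq> enat (distance M v
    (copy_index N x b c) (x mod r))}"
  let ?hit = "{c. c < Q \<and> hit N v (copy_index N x b c) (A ! copy_index N x b c ! (x mod r))}"
  let ?t = "\<exists>y<N. y div w = b \<and> M x y \<and> v y"
  have maj: "majority N v A x b \<longleftrightarrow> Q < 2 * card ?hit"
    by (simp add: majority_def lessThan_def Collect_conj_eq)
  show ?thesis
  proof (cases ?t)
    case True
    have "{..<Q} - ?bad \<subseteq> ?hit"
    proof
      fix c assume c: "c \<in> {..<Q} - ?bad"
      then have "A ! copy_index N x b c ! (x mod r) = enat (distance M v (copy_index N x b c)
        (x mod r))" by simp
      with c True hit_copy_index[OF x b, of c v M] show "c \<in> ?hit"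
        by (simp only: mem_Collect_eq) simp
    qed
    then have "card ({..<Q} - ?bad) \<le> card ?hit" by (intro card_mono) auto
    moreover have "card ({..<Q} - ?bad) = Q - card ?bad" by (subst card_Diff_subset) auto
    ultimately have "Q < 2 * card ?hit" using few h by linarith
    then show ?thesis using True maj by blast
  next
    case False
    have "?hit \<subseteq> ?bad"
    proof
      fix c assume c: "c \<in> ?hit"
      have "A ! copy_index N x b c ! (x mod r) \<noteq> enat (distance M v (copy_index N x b c)
        (x mod r))"
      proof
        assume "A ! copy_index N x b c ! (x mod r) = enat (distance M v (copy_index N x b c)
          (x mod r))"
        with c hit_copy_index[OF x b, of c v M] False show False by (simp only: mem_Collect_eq)
      qed
      with c show "c \<in> ?bad" by blast
    qed
    then have "card ?hit \<le> card ?bad" by (intro card_mono) auto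
    then have "\<not> Q < 2 * card ?hit" using few h by linarith
    then show ?thesis using False maj by blast
  qed
qed

lemma output_bits_correct:
  assumes "\<And>x b. x < N \<Longrightarrow> b < col_blocks N \<Longrightarrow>
    majority N v A x b \<longleftrightarrow> (\<exists>y<N. y div w = b \<and> M x y \<and> v y)"
  shows "output_bits N v A = map of_bool (bool_mat_vec N M v)"
proof -
  have "(\<exists>b<col_blocks N. majority N v A x b) \<longleftrightarrow>
    (\<exists>y<N. M x y \<and> v y)" if "x < N" for x
  proof -
    \<comment> \<open>The additional block in \<open>col_blocks\<close> catches the columns left
      over by the division.\<close>
    have "y div w < col_blocks N" if "y < N" for y
      using that by (auto simp: col_blocks_def less_Suc_eq_le intro!: div_le_mono)
    then show ?thesis using assms[OF that] by blast
  qed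
  then show ?thesis by (auto simp: output_bits_def bool_mat_vec_def)
qed

lemma chunk_lengths:
  assumes "L \<in> set_spmf (run_chunks chunk (all_ops vs j) s)"
  shows "length L = length vs \<and> (\<forall>as\<in>set L. length as = r)"
  using assms
proof (induction vs arbitrary: s L)
  case Nil
  then show ?case by (simp add: all_ops_def)
next
  case (Cons v vs)
  then obtain as s' L' where 1: "(as, s') \<in> set_spmf (chunk (block_ops N v j) s)"
    and 2: "L' \<in> set_spmf (run_chunks chunk (all_ops vs j) s')" "L = as # L'"
    by (auto simp: all_ops_def set_bind_spmf bind_UNION)
  have "length as = r" using length_foldM_ds_step[OF 1]
    by (simp add: block_ops_def filter_map o_def)
  then show ?case using Cons.IH[OF 2(1)] 2(2) by simp
qed

text \<open>The guarantee counts answers through all rounds; as each round yields \<open>r\<close>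
  of them, answer \<open>i\<close> of round \<open>t\<close> has index \<open>t * r + i\<close>.
  These lengths are known on the support only, hence the comparison almost everywhere.\<close>

lemma copy_failure:
  assumes ll: "lossless_spmf (copy_run M vs j)" and k: "m \<le> k"
    and acc: "\<And>i. i < length vs * r \<Longrightarrow>
      measure (measure_spmf (map_spmf concat (copy_run M vs j)))
      {as. as ! i = correct_answers k (block_text N M j) (zero_pattern N) (concat
        (all_ops vs j)) ! i} \<ge> 1 - \<delta>"
    and t: "t < length vs" and i: "i < r"
  shows "measure (measure_spmf (copy_run M vs j)) {L. L ! t ! i \<noteq> enat (distance M
    (vs ! t) j i)} \<le> \<delta>"
proof -
  interpret prob_space "measure_spmf (copy_run M vs j)"
    using ll by (intro prob_spaceI) (simp add: lossless_spmf_def weight_spmf_def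
      measure_spmf.emeasure_eq_measure space_measure_spmf)
  let ?good = "{L. L ! t ! i = enat (distance M (vs ! t) j i)}"
  have "t * r + i < (t + 1) * r" using i by simp
  also have "\<dots> \<le> length vs * r" using t by (intro mult_right_mono) auto
  finally have ti: "t * r + i < length vs * r" .
  have "correct_answers k (block_text N M j) (zero_pattern N) (concat (all_ops vs j)) !
    (t * r + i) =
    enat (distance M (vs ! t) j i)"
    unfolding correct_answers_all_ops[OF k even_zero_zero_pattern]
    by (subst nth_concat_uniform) (use t i in auto)
  then have "1 - \<delta> \<le> prob {L. concat L ! (t * r + i) = enat (distance M (vs ! t) j i)}"
    using acc[OF ti] by (simp add: measure_map_spmf vimage_def)
  also have "\<dots> \<le> prob ?good"
  proof (rule measure_spmf.finite_measure_mono_AE)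
    show "AE L in measure_spmf (copy_run M vs j).
      L \<in> {L. concat L ! (t * r + i) = enat (distance M (vs ! t) j i)} \<longrightarrow>
        L \<in> ?good"
      unfolding AE_measure_spmf_iff
    proof
      fix L assume "L \<in> set_spmf (copy_run M vs j)"
      then have "length L = length vs \<and> (\<forall>as\<in>set L. length as = r)"
        using chunk_lengths unfolding copy_run_def set_bind_spmf bind_UNION
          by (auto simp del: add_2_eq_Suc')
      then show "L \<in> {L. concat L ! (t * r + i) = enat (distance M
        (vs ! t) j i)} \<longrightarrow> L \<in> ?good"
        using nth_concat_uniform[of L r t i] t i by simp
    qed
  qed simp
  finally have "1 - \<delta> \<le> prob ?good" .
  moreover have "prob (space (measure_spmf (copy_run M vs j)) - ?good) = 1 - prob ?good"
    by (rule prob_compl) simp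
  moreover have "space (measure_spmf (copy_run M vs j)) - ?good = {L. L ! t ! i \<noteq> enat
    (distance M (vs ! t) j i)}"
    by (auto simp: space_measure_spmf)
  ultimately show ?thesis by simp
qed

section \<open>Union bound over all votes\<close>

lemma outputs_correct:
  assumes len: "length vs = N" and h: "Q = 2 * h - 1"
    and few: "\<And>t x b. t < N \<Longrightarrow> x < N \<Longrightarrow>
      b < col_blocks N \<Longrightarrow>
      card {j \<in> copy_index N x b ` {..<Q}. j < J \<and>
        L ! j ! t ! (x mod r) \<noteq> enat (distance M (vs ! t) j (x mod r))} < h"
  shows "outputs vs (rearrange N L) = products M vs"
proof (rule nth_equalityI)
  show "length (outputs vs (rearrange N L)) = length (products M vs)"
    by (simp add: outputs_def rearrange_def len)
  fix t assume "t < length (outputs vs (rearrange N L))"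
  then have t: "t < N" by (simp add: outputs_def rearrange_def len)
  define A where "A = rearrange N L ! t"
  have A: "A ! j = L ! j ! t" if "j < J" for j using t that by (simp add: A_def rearrange_def)
  have "output_bits N (vs ! t) A = map of_bool (bool_mat_vec N M (vs ! t))"
  proof (rule output_bits_correct, rule majority_correct[OF _ _ h])
    fix x b assume x: "x < N" and b: "b < col_blocks N"
    let ?C = "{c. c < Q \<and> A ! copy_index N x b c ! (x mod r) \<noteq>
      enat (distance M (vs ! t) (copy_index N x b c) (x mod r))}"
    have "inj (copy_index N x b)" by (rule injI) (simp add: copy_index_def)
    then have "inj_on (copy_index N x b) ?C" by (rule inj_on_subset) (rule subset_UNIV)
    then have "card ?C = card (copy_index N x b ` ?C)" by (rule card_image[symmetric])
    also have "\<dots> \<le> card {j \<in> copy_index N x b ` {..<Q}. j < J \<and>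
       L ! j ! t ! (x mod r) \<noteq> enat (distance M (vs ! t) j (x mod r))}"
      by (rule card_mono) (auto simp: A copy_index_less[OF x b])
    also have "\<dots> < h" by (rule few[OF t x b])
    finally show "card ?C < h" .
  qed
  then show "outputs vs (rearrange N L) ! t = (products M vs) ! t"
    using t by (simp add: outputs_def rearrange_def len A_def)
qed

text \<open>The union runs over round, row and column block. One such event concerns one answer in
  each of the \<open>Q\<close> copies of a single block; these are independent, so
  \<open>many_failures\<close> applies.\<close>

theorem run_omv_success:
  assumes len: "length vs = N" and h: "Q = 2 * h - 1" and k: "m \<le> k" and
    \<delta>: "0 \<le> \<delta>"
    and time: "init_time + N * round_time \<le> t"
    and ll: "\<And>j. j < J \<Longrightarrow> lossless_spmf (run_ds Wd tp tu tq pre upd qry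
      (block_text N M j) (zero_pattern N)
        (concat (all_ops vs j)))"
    and acc: "\<And>j i. j < J \<Longrightarrow> i < N * r \<Longrightarrow>
      measure (measure_spmf (run_ds Wd tp tu tq pre upd qry (block_text N M j) (zero_pattern N)
        (concat (all_ops vs j))))
       {as. as ! i = correct_answers k (block_text N M j) (zero_pattern N) (concat
         (all_ops vs j)) ! i} \<ge> 1 - \<delta>"
  shows "lossless_spmf (run_omv H t (block init_prog) (block round_prog) N M vs)"
    and "measure (measure_spmf (run_omv H t (block init_prog) (block round_prog) N M vs))
      {products M vs} \<ge> 1 - real (N * N * col_blocks N) * (2 ^ Q * \<delta> ^ h)"
proof -
  have ll': "lossless_spmf (copy_run M vs j)" if "j < J" for j
    using ll[OF that] by (simp only: run_ds_conv_copy_run lossless_map_spmf)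
  define P where "P = seqn J (copy_run M vs)"
  have llP: "lossless_spmf P" unfolding P_def by (rule lossless_seqn) (rule ll')
  have eq: "run_omv H t (block init_prog) (block round_prog) N M vs = map_spmf
    (\<lambda>L. outputs vs (rearrange N L)) P"
    using run_omv_eq[where M = M and vs = vs and t = t, OF ll'] time unfolding P_def len by blast
  show "lossless_spmf (run_omv H t (block init_prog) (block round_prog) N M vs)"
    unfolding eq using llP by simp
  interpret prob_space "measure_spmf P"
    using llP by (intro prob_spaceI) (simp add: lossless_spmf_def weight_spmf_def
      measure_spmf.emeasure_eq_measure space_measure_spmf)
  define bad where "bad t x j = {K :: enat list list. K ! t ! (x mod r) \<noteq> enat (distance M
    (vs ! t) j (x mod r))}" for t x j
  define E where "E = (\<lambda>(t, x, b). {L. h \<le> card {j \<in> copy_index N x b ` {..<Q}. j <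
    J \<and> L ! j \<in> bad t x j}})"
  let ?I = "{..<N} \<times> {..<N} \<times> {..<col_blocks N}"
  let ?right = "{L. outputs vs (rearrange N L) = products M vs}"
  have "prob (E i) \<le> 2 ^ Q * \<delta> ^ h" if iI: "i \<in> ?I" for i
  proof -
    obtain t x b where i: "i = (t, x, b)" "t < N" "x < N" "b < col_blocks N" using iI
      by (cases i) auto
    have "prob (E i) \<le> 2 ^ card (copy_index N x b ` {..<Q} \<inter> {..<J}) * \<delta> ^ h"
      unfolding P_def E_def i(1) prod.case
    proof (rule many_failures[OF _ \<delta>])
      fix j assume j: "j < J"
      show "measure (measure_spmf (copy_run M vs j)) (bad t x j) \<le> \<delta>"
        unfolding bad_def
        by (rule copy_failure[OF ll'[OF j] k])
          (use acc[OF j] i pos len in \<open>simp_all only: len run_ds_conv_copy_run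
            mod_less_divisor\<close>)
    qed
    also have "\<dots> \<le> 2 ^ Q * \<delta> ^ h"
    proof (intro mult_right_mono power_increasing)
      have "card (copy_index N x b ` {..<Q} \<inter> {..<J}) \<le> card (copy_index N x b ` {..<Q})"
        by (intro card_mono) auto
      also have "\<dots> \<le> Q" using card_image_le[of "{..<Q}" "copy_index N x b"] by simp
      finally show "card (copy_index N x b ` {..<Q} \<inter> {..<J}) \<le> Q" .
    qed (use \<delta> in auto)
    finally show ?thesis .
  qed
  then have "(\<Sum>i\<in>?I. prob (E i)) \<le> (\<Sum>i\<in>?I. 2 ^ Q * \<delta> ^ h)"
    by (rule sum_mono)
  also have "\<dots> = real (N * N * col_blocks N) * (2 ^ Q * \<delta> ^ h)" by simp
  finally have sumle: "(\<Sum>i\<in>?I. prob (E i)) \<le> real (N * N * col_blocks N) *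
    (2 ^ Q * \<delta> ^ h)" .
  have "UNIV - ?right \<subseteq> (\<Union>i\<in>?I. E i)"
  proof
    fix L assume "L \<in> UNIV - ?right"
    then obtain t x b where "t < N" "x < N" "b < col_blocks N"
      "\<not> card {j \<in> copy_index N x b ` {..<Q}. j < J \<and>
        L ! j ! t ! (x mod r) \<noteq> enat (distance M (vs ! t) j (x mod r))} < h"
      using outputs_correct[OF len h, of L M] by blast
    then show "L \<in> (\<Union>i\<in>?I. E i)"
      by (intro UN_I[of "(t, x, b)"]) (auto simp: E_def bad_def not_less)
  qed
  then have "prob (UNIV - ?right) \<le> prob (\<Union>i\<in>?I. E i)"
    by (intro measure_spmf.finite_measure_mono) auto
  also have "\<dots> \<le> (\<Sum>i\<in>?I. prob (E i))" by (rule measure_UNION_le) auto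
  finally have "prob (UNIV - ?right) \<le> real (N * N * col_blocks N) * (2 ^ Q * \<delta> ^ h)"
    using sumle by linarith
  moreover have "prob (UNIV - ?right) = 1 - prob ?right"
    using prob_compl[of ?right] by (simp add: space_measure_spmf)
  ultimately show "measure (measure_spmf (run_omv H t (block init_prog) (block round_prog) N M vs))
      {products M vs} \<ge> 1 - real (N * N * col_blocks N) * (2 ^ Q * \<delta> ^ h)"
    unfolding eq by (simp add: measure_map_spmf vimage_def)
qed

end

section \<open>Choosing the block sizes\<close>

definition poly_bounded :: "(nat \<Rightarrow> nat) \<Rightarrow> bool" where
  "poly_bounded f \<longleftrightarrow> (\<exists>k. \<forall>N. f N \<le> (N + 2) ^ k)"

lemma poly_bounded_le: "poly_bounded g \<Longrightarrow> (\<And>N. f N \<le> g N) \<Longrightarrow>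
  poly_bounded f"
  unfolding poly_bounded_def by (meson order.trans)

lemma poly_bounded_const: "poly_bounded (\<lambda>_. c)"
  unfolding poly_bounded_def
proof (intro exI allI)
  fix N
  have "c \<le> 2 ^ c" by (rule less_imp_le[OF less_exp])
  also have "\<dots> \<le> (N + 2) ^ c" by (rule power_mono) auto
  finally show "c \<le> (N + 2) ^ c" .
qed

lemma poly_bounded_id: "poly_bounded (\<lambda>N. N)"
  unfolding poly_bounded_def by (intro exI[of _ 1]) auto

lemma poly_bounded_mult:
  assumes "poly_bounded f" "poly_bounded g"
  shows "poly_bounded (\<lambda>N. f N * g N)"
proof -
  from assms obtain k l where "\<And>N. f N \<le> (N + 2) ^ k" "\<And>N. g N \<le> (N + 2) ^ l"
    unfolding poly_bounded_def by blast
  then have "f N * g N \<le> (N + 2) ^ (k + l)" for N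
    unfolding power_add by (intro mult_mono) auto
  then show ?thesis unfolding poly_bounded_def by blast
qed

text \<open>Reduced to products by \<open>f + g \<le> (f + 1) * (g + 1)\<close>.\<close>

lemma poly_bounded_add:
  assumes "poly_bounded f" "poly_bounded g"
  shows "poly_bounded (\<lambda>N. f N + g N)"
proof -
  have *: "poly_bounded (\<lambda>N. f N + 1)" if "poly_bounded f" for f
  proof -
    from that obtain k where k: "\<And>N. f N \<le> (N + 2) ^ k" unfolding poly_bounded_def by blast
    have "f N + 1 \<le> (N + 2) ^ (k + 1)" for N
    proof -
      have "f N + 1 \<le> (N + 2) ^ k + (N + 2) ^ k" using k[of N] by (intro add_mono) auto
      also have "\<dots> = 2 * (N + 2) ^ k" by (rule mult_2[symmetric])
      also have "\<dots> \<le> (N + 2) * (N + 2) ^ k" by (rule mult_right_mono) auto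
      finally show ?thesis by simp
    qed
    then show ?thesis unfolding poly_bounded_def by blast
  qed
  show ?thesis
    by (rule poly_bounded_le[OF poly_bounded_mult[OF *[OF assms(1)] *[OF assms(2)]]])
      (simp add: algebra_simps)
qed

lemma poly_bounded_power: "poly_bounded f \<Longrightarrow> poly_bounded (\<lambda>N. f N ^ k)"
  by (induction k) (auto intro: poly_bounded_mult poly_bounded_const)

context reduction
begin

lemma poly_bounded_max_value:
  assumes "1 \<le> D"
  shows "poly_bounded max_value"
proof -
  note intros = poly_bounded_add poly_bounded_mult poly_bounded_const poly_bounded_power
    poly_bounded_id
  have 1: "poly_bounded root"
    by (rule poly_bounded_le[OF poly_bounded_id]) (rule root_bounds(3)[OF assms])
  have 2: "poly_bounded base" unfolding base_def[abs_def] by (intro intros 1)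
  have 3: "poly_bounded rows" "poly_bounded cols" unfolding rows_def[abs_def] cols_def[abs_def]
    by (intro intros 2)+
  have 4: "poly_bounded text_length" "poly_bounded pattern_length"
    unfolding text_length_def[abs_def] pattern_length_def[abs_def] by (intro intros 3)+
  have div: "poly_bounded (\<lambda>N. N div f N)" for f
    by (rule poly_bounded_le[OF poly_bounded_id]) auto
  have 5: "poly_bounded row_blocks" "poly_bounded col_blocks"
    unfolding row_blocks_def[abs_def] col_blocks_def[abs_def] by (intro intros div)+
  have 6: "poly_bounded copies" unfolding copies_def[abs_def] by (intro intros 5)
  have 7: "poly_bounded stride" unfolding stride_def[abs_def] by (intro intros 3 4)
  show ?thesis unfolding max_value_def[abs_def] by (intro intros 2 3 4 5 6 7)
qed

text \<open>Shows that host words of \<open>O(log N)\<close> bits suffice; one more factor makes the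
  polynomial bound strict.\<close>

lemma ex_word_bound:
  assumes "1 \<le> D"
  shows "\<exists>k. \<forall>N. (max_value N + 2) ^ max_deg < (N + 2) ^ k"
proof -
  have "poly_bounded (\<lambda>N. (max_value N + 2) ^ max_deg)"
    by (intro poly_bounded_power poly_bounded_add poly_bounded_const poly_bounded_max_value assms)
  then obtain k where k: "\<And>N. (max_value N + 2) ^ max_deg \<le>
    (N + 2) ^ k" unfolding poly_bounded_def by blast
  have "(max_value N + 2) ^ max_deg < (N + 2) ^ Suc k" for N
    using k[of N] by (rule le_less_trans) (rule power_strict_increasing, auto)
  then show ?thesis by blast
qed

end

section \<open>Running time in terms of \<open>N\<close>\<close>

definition dominated :: "(nat \<Rightarrow> real) \<Rightarrow>
  (nat \<Rightarrow> real) \<Rightarrow> bool" where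
  "dominated Y f \<longleftrightarrow> (\<exists>c. \<forall>N\<ge>1. f N \<le> c * Y N)"

lemma dominatedI: "(\<And>N. 1 \<le> N \<Longrightarrow> f N \<le> c * Y N) \<Longrightarrow>
  dominated Y f"
  unfolding dominated_def by blast

lemma dominated_le: "dominated Y g \<Longrightarrow> (\<And>N. 1 \<le> N \<Longrightarrow>
  f N \<le> g N) \<Longrightarrow> dominated Y f"
  unfolding dominated_def by (meson order.trans)

lemma dominated_add: "dominated Y f \<Longrightarrow> dominated Y g \<Longrightarrow>
  dominated Y (\<lambda>N. f N + g N)"
  unfolding dominated_def
proof clarify
  fix c c' assume "\<forall>N\<ge>1. f N \<le> c * Y N" "\<forall>N\<ge>1. g N \<le> c' * Y N"
  then show "\<exists>c. \<forall>N\<ge>1. f N + g N \<le> c * Y N"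
    by (intro exI[of _ "c + c'"]) (auto simp: distrib_right intro: add_mono)
qed

lemma dominated_cmult: "0 \<le> b \<Longrightarrow> dominated Y f \<Longrightarrow>
  dominated Y (\<lambda>N. b * f N)"
  unfolding dominated_def
proof clarify
  fix c assume "0 \<le> b" "\<forall>N\<ge>1. f N \<le> c * Y N"
  then show "\<exists>c. \<forall>N\<ge>1. b * f N \<le> c * Y N"
    by (intro exI[of _ "b * c"]) (auto simp: mult.assoc intro: mult_left_mono)
qed

text \<open>\<open>\<alpha>\<close> is the exponent of the operation times and
  \<open>g ^ \<theta>\<close> the factor gained over \<open>N ^ 3\<close>. Per cell of a block of
  area \<open>r * w\<close>, updates cost \<open>r ^ (\<alpha> - 1)\<close>, which is
  \<open>g ^ (- p * (1 - \<alpha>))\<close>, and queries cost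
  \<open>r ^ (\<gamma> * \<alpha>) / w\<close>, which is
  \<open>g ^ (\<gamma> * \<alpha> * p - q)\<close>; this gives the last two conditions on
  \<open>\<theta>\<close>. The condition on \<open>e\<close> limits the preprocessing of one copy to
  the order of the square root of \<open>N\<close>.\<close>

locale reduction_bounds = reduction +
  fixes \<alpha> \<gamma> C \<theta> :: real and e :: nat
  assumes p1: "1 \<le> p" "p \<le> D" and q1: "1 \<le> q" "q \<le> D" and
    De: "2 * ((p + q) * e) \<le> D"
    and C: "0 \<le> C" and \<theta>: "0 < \<theta>" "\<theta> \<le> 1 / 2" "\<theta> \<le> real p *
      (1 - \<alpha>)" "\<theta> \<le> real q - \<gamma> * \<alpha> * real p"
    and G1: "1 \<le> G" and Q1: "1 \<le> Q"
begin

definition A :: "nat \<Rightarrow> real" where "A N = real N powr (1 / real D)"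
definition Y :: "nat \<Rightarrow> real" where "Y N = real N powr (3 - \<theta> / real D)"

lemma D1: "1 \<le> D" using p1 by simp

lemma A_ge_1: "1 \<le> N \<Longrightarrow> 1 \<le> A N" by (simp add: A_def ge_one_powr_ge_zero)

lemma A_power: "1 \<le> N \<Longrightarrow> A N ^ k = real N powr (real k / real D)"
  by (simp add: A_def powr_powr flip: powr_realpow)

lemma A_le_base: assumes "1 \<le> N" shows "A N \<le> real (base N)"
proof -
  have "real N \<le> real (root N ^ D)" using root_bounds(1)[OF D1] of_nat_le_iff by blast
  then have "real N \<le> real (root N) ^ D" by simp
  moreover have "0 < root N" using root_bounds(1)[OF D1, of N] assms D1
    by (cases "root N = 0") (auto simp: zero_power)
  ultimately have "real N powr (1 / real D) \<le> (real (root N) powr real D) powr (1 / real D)"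
    by (intro powr_mono2) (auto simp: powr_realpow)
  also have "\<dots> = real (root N)" using D1 \<open>0 < root N\<close> by (simp add: powr_powr)
  finally show ?thesis by (simp add: A_def base_def)
qed

text \<open>Minimality of the root gives \<open>(root N - 1) ^ D < N\<close>, so rounding up costs
  at most 1.\<close>

lemma base_le: assumes "1 \<le> N" shows "real (base N) \<le> real (2 + G) * A N"
proof -
  have "real (root N) \<le> 1 + A N"
  proof (cases "root N")
    case (Suc x)
    then have "x ^ D < N" by (intro root_bounds(2)) simp
    then have "real x ^ D \<le> real N" by (metis less_imp_le of_nat_le_iff of_nat_power)
    have "real x \<le> A N"
    proof (cases "x = 0")
      case False
      then have "real x = (real x powr real D) powr (1 / real D)" using D1 by (simp add: powr_powr)
      also have "\<dots> \<le> real N powr (1 / real D)"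
        using False \<open>real x ^ D \<le> real N\<close>
          by (intro powr_mono2) (auto simp: powr_realpow)
      finally show ?thesis by (simp add: A_def)
    qed (use A_ge_1[OF assms] in simp)
    then show ?thesis using Suc by simp
  qed (use A_ge_1[OF assms] in simp)
  moreover have "real G \<le> real G * A N" using A_ge_1[OF assms]
    by (simp add: mult_le_cancel_left1)
  ultimately show ?thesis using A_ge_1[OF assms] by (simp add: base_def distrib_right)
qed

lemma base_ge_1: "1 \<le> real (base N)" using G1 by (simp add: base_def)

abbreviation "c1 \<equiv> real (2 + G) ^ D"

text \<open>Through rounding and \<open>G\<close> a block side may exceed \<open>N\<close>, but only
  by a constant factor; hence padding costs a constant factor as well.\<close>

lemma power_base_le:
  assumes "1 \<le> N" "k \<le> D"
  shows "real (base N) ^ k \<le> c1 * real N"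
proof -
  have "real (base N) ^ k \<le> (real (2 + G) * A N) ^ k"
    by (rule power_mono[OF base_le[OF assms(1)]]) simp
  also have "\<dots> = real (2 + G) ^ k * A N ^ k" by (rule power_mult_distrib)
  also have "\<dots> \<le> c1 * real N"
  proof (rule mult_mono)
    show "real (2 + G) ^ k \<le> c1" by (rule power_increasing) (use assms in auto)
    have "A N ^ k = real N powr (real k / real D)" by (rule A_power[OF assms(1)])
    also have "\<dots> \<le> real N powr 1" by (rule powr_mono) (use assms D1 in auto)
    finally show "A N ^ k \<le> real N" using assms by simp
  qed (use A_ge_1[OF assms(1)] in auto)
  finally show ?thesis .
qed

lemma blocks_le:
  assumes "1 \<le> N"
  shows "real (row_blocks N) * real (rows N) \<le> (1 + c1) * real N"
    and "real (col_blocks N) * real (cols N) \<le> (1 + c1) * real N"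
proof -
  have *: "real (N div k + 1) * real k \<le> (1 + c1) * real N" if "real k \<le> c1 * real N" for k
  proof -
    have "real (N div k) * real k = real (N div k * k)" by simp
    also have "\<dots> \<le> real N" by (rule of_nat_mono) (rule div_times_less_eq_dividend)
    finally show ?thesis using that by (simp add: distrib_right)
  qed
  show "real (row_blocks N) * real (rows N) \<le> (1 + c1) * real N"
    unfolding row_blocks_def by (rule *) (simp add: rows_def power_base_le[OF assms p1(2),
      simplified])
  show "real (col_blocks N) * real (cols N) \<le> (1 + c1) * real N"
    unfolding col_blocks_def by (rule *) (simp add: cols_def power_base_le[OF assms q1(2),
      simplified])
qed

abbreviation "c3 \<equiv> real Q * (1 + c1) ^ 2"

lemma copies_area_le:
  assumes "1 \<le> N"
  shows "real (copies N) * real (rows N) * real (cols N) \<le> c3 * real N ^ 2"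
proof -
  have "(real (row_blocks N) * real (rows N)) * (real (col_blocks N) * real (cols N)) \<le>
      ((1 + c1) * real N) * ((1 + c1) * real N)"
    by (intro mult_mono blocks_le assms) auto
  then have "real Q * ((real (row_blocks N) * real (rows N)) * (real (col_blocks N) * real
    (cols N))) \<le>
      real Q * (((1 + c1) * real N) * ((1 + c1) * real N))"
    by (rule mult_left_mono) simp
  then show ?thesis by (simp add: copies_def power2_eq_square mult_ac)
qed

lemma copies_le: assumes "1 \<le> N" shows "real (copies N) \<le> 4 * real Q * real N ^ 2"
proof -
  have "row_blocks N \<le> 2 * N" "col_blocks N \<le> 2 * N"
    using assms div_le_dividend[of N "rows N"] div_le_dividend[of N "cols N"]
    unfolding row_blocks_def col_blocks_def by linarith+
  then have "Q * (row_blocks N * col_blocks N) \<le> Q * ((2 * N) * (2 * N))"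
    by (intro mult_le_mono order.refl)
  then have "real (copies N) \<le> real (Q * ((2 * N) * (2 * N)))" unfolding copies_def
    by (rule of_nat_mono)
  then show ?thesis by (simp add: power2_eq_square mult_ac)
qed

lemma Y_eq: assumes "1 \<le> N" shows "Y N = real N ^ 3 * A N powr (- \<theta>)"
proof -
  have "A N powr (- \<theta>) = real N powr (- \<theta> / real D)" by (simp add: A_def powr_powr)
  moreover have "real N ^ 3 = real N powr 3" using assms by simp
  ultimately have "real N ^ 3 * A N powr (- \<theta>) = real N powr (3 + - \<theta> / real D)"
    by (simp only: powr_add[symmetric])
  then show ?thesis by (simp add: Y_def)
qed

text \<open>As \<open>\<theta> / D \<le> 1 / 2\<close>, everything up to \<open>N ^ (5 / 2)\<close>
  is covered, which is the order reached by preprocessing.\<close>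

lemma powr_le_Y: assumes "1 \<le> N" "x \<le> 5 / 2" shows "real N powr x \<le> Y N"
proof -
  have "\<theta> / real D \<le> \<theta>" using D1 \<theta>(1)
    by (simp add: divide_le_eq mult_le_cancel_left1)
  then show ?thesis unfolding Y_def using assms \<theta>(2) by (intro powr_mono) auto
qed

lemma power_le_Y: assumes "1 \<le> N" "k \<le> 2" shows "real N ^ k \<le> Y N"
  using powr_le_Y[OF assms(1), of "real k"] assms by (simp add: powr_realpow)

lemma base_powr_le:
  assumes "1 \<le> N" "\<theta> \<le> x"
  shows "real (base N) powr (- x) \<le> A N powr (- \<theta>)"
proof -
  have "real (base N) powr (- x) \<le> real (base N) powr (- \<theta>)"
    by (rule powr_mono) (use base_ge_1 assms in auto)
  also have "\<dots> \<le> A N powr (- \<theta>)"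
    by (rule powr_mono2') (use A_le_base[OF assms(1)] A_ge_1[OF assms(1)] \<theta> in auto)
  finally show ?thesis .
qed

definition tp_bound :: "nat \<Rightarrow> real" where "tp_bound N = C * real (text_length N) ^ e"
definition tu_bound :: "nat \<Rightarrow> real" where "tu_bound N = C * real (rows N) powr \<alpha>"
text \<open>The factor 2 absorbs the 2 of the threshold, as
  \<open>2 powr \<alpha> \<le> 2\<close>.\<close>

definition tq_bound :: "nat \<Rightarrow> real" where "tq_bound N = 2 * C * real (rows N) powr
  (\<gamma> * \<alpha>)"

lemma rows_powr: "real (rows N) powr x = real (base N) powr (real p * x)"
  using base_ge_1[of N] by (simp add: rows_def powr_powr flip: powr_realpow)

lemma cols_powr: "real (cols N) = real (base N) powr real q"
  using base_ge_1[of N] by (simp add: cols_def powr_realpow)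

lemma rows_eq: "real (rows N) = real (base N) powr real p"
  using base_ge_1[of N] by (simp add: rows_def powr_realpow)

text \<open>All copies together have area of order \<open>N ^ 2\<close>. If a round costs less than
  that by a factor \<open>g ^ x\<close>, then \<open>N\<close> rounds stay within the order of
  \<open>N ^ 3 / g ^ \<theta>\<close>, and this is \<open>Y\<close>.\<close>

lemma dominated_area:
  assumes "\<theta> \<le> x" "0 \<le> b"
    and "\<And>N. 1 \<le> N \<Longrightarrow> f N \<le> b * (real (copies N) * real (rows N) * real
      (cols N) * real (base N) powr (- x))"
  shows "dominated Y (\<lambda>N. real N * f N)"
proof (rule dominatedI)
  fix N :: nat assume N: "1 \<le> N"
  have "f N \<le> b * (real (copies N) * real (rows N) * real (cols N) * real (base N) powr (- x))"
    by (rule assms(3)[OF N])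
  also have "\<dots> \<le> b * (c3 * real N ^ 2 * A N powr (- \<theta>))"
    by (intro mult_left_mono mult_mono copies_area_le[OF N] base_powr_le[OF N] assms) auto
  finally have "real N * f N \<le> real N * (b * (c3 * real N ^ 2 * A N powr (- \<theta>)))"
    by (rule mult_left_mono) simp
  also have "\<dots> = b * c3 * Y N" by (simp add: Y_eq[OF N] power2_eq_square power3_eq_cube)
  finally show "real N * f N \<le> b * c3 * Y N" .
qed

lemma dominated_round_terms:
  shows "dominated Y (\<lambda>N. real N * (real (copies N) * real (cols N) * tu_bound N))"
    and "dominated Y (\<lambda>N. real N * (real (copies N) * real (rows N) * tq_bound N))"
    and "dominated Y (\<lambda>N. real N * (real (copies N) * real (cols N)))"
    and "dominated Y (\<lambda>N. real N * (real (copies N) * real (rows N)))"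
    and "dominated Y (\<lambda>N. real N * real (copies N))"
proof -
  have b: "0 < real (base N)" for N using base_ge_1[of N] by simp
  have pq: "\<theta> \<le> real p" "\<theta> \<le> real q" using \<theta>(2) p1 q1 by auto
  show "dominated Y (\<lambda>N. real N * (real (copies N) * real (cols N) * tu_bound N))"
  proof (rule dominated_area[OF \<theta>(3) C])
    fix N
    have "real (base N) powr (real p * \<alpha>) = real (rows N) * real (base N) powr (- (real p *
      (1 - \<alpha>)))"
      unfolding rows_eq using b by (simp add: powr_add[symmetric] algebra_simps)
    then show "real (copies N) * real (cols N) * tu_bound N \<le>
      C * (real (copies N) * real (rows N) * real (cols N) * real (base N) powr - (real p *
        (1 - \<alpha>)))"
      by (simp add: tu_bound_def rows_powr)
  qed
  show "dominated Y (\<lambda>N. real N * (real (copies N) * real (rows N) * tq_bound N))"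
  proof (rule dominated_area[OF \<theta>(4)])
    fix N
    have "real (base N) powr (real p * (\<gamma> * \<alpha>)) =
        real (cols N) * real (base N) powr (- (real q - \<gamma> * \<alpha> * real p))"
      unfolding cols_powr using b by (simp add: powr_add[symmetric] algebra_simps)
    then show "real (copies N) * real (rows N) * tq_bound N \<le>
      (2 * C) * (real (copies N) * real (rows N) * real (cols N) * real (base N) powr -
        (real q - \<gamma> * \<alpha> * real p))"
      by (simp add: tq_bound_def rows_powr)
  qed (use C in simp)
  \<comment> \<open>Terms that lack a factor \<open>r\<close> or \<open>w\<close> are written as the
    area times \<open>g ^ (- p)\<close> or \<open>g ^ (- q)\<close>, which is small enough because
    \<open>\<theta> \<le> 1 / 2\<close> while \<open>p\<close> and \<open>q\<close> are at least
    1.\<close>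
  have inv: "real (rows N) * real (base N) powr (- real p) = 1" "real (cols N) * real (base N) powr
    (- real q) = 1" for N
    unfolding rows_eq cols_powr using b by (simp_all add: powr_add[symmetric])
  show 3: "dominated Y (\<lambda>N. real N * (real (copies N) * real (cols N)))"
  proof (rule dominated_area[OF pq(1), of 1])
    fix N
    have "real (copies N) * real (rows N) * real (cols N) * real (base N) powr (- real p) =
      real (copies N) * real (cols N) * (real (rows N) * real (base N) powr (- real p))"
        by (simp only: mult_ac)
    also have "\<dots> = real (copies N) * real (cols N)" unfolding inv by simp
    finally have eq: "real (copies N) * real (rows N) * real (cols N) * real (base N) powr
      (- real p) =
      real (copies N) * real (cols N)" .
    show "real (copies N) * real (cols N) \<le>
       1 * (real (copies N) * real (rows N) * real (cols N) * real (base N) powr (- real p))"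
      by (simp only: eq mult_1 order.refl)
  qed simp
  show "dominated Y (\<lambda>N. real N * (real (copies N) * real (rows N)))"
  proof (rule dominated_area[OF pq(2), of 1])
    fix N
    have "real (copies N) * real (rows N) * real (cols N) * real (base N) powr (- real q) =
      real (copies N) * real (rows N) * (real (cols N) * real (base N) powr (- real q))"
        by (simp only: mult_ac)
    also have "\<dots> = real (copies N) * real (rows N)" unfolding inv by simp
    finally have eq: "real (copies N) * real (rows N) * real (cols N) * real (base N) powr
      (- real q) =
      real (copies N) * real (rows N)" .
    show "real (copies N) * real (rows N) \<le>
       1 * (real (copies N) * real (rows N) * real (cols N) * real (base N) powr (- real q))"
      by (simp only: eq mult_1 order.refl)
  qed simp
  have "1 \<le> real (cols N)" for N using base_ge_1[of N] by (simp add: cols_def)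
  then show "dominated Y (\<lambda>N. real N * real (copies N))"
    by (intro dominated_le[OF 3]) (simp add: mult_le_cancel_left1 mult_left_mono)
qed

lemma dominated_const: "0 \<le> b \<Longrightarrow> dominated Y (\<lambda>_. b)"
  using power_le_Y[of _ 0] by (intro dominatedI[of _ b]) (simp add: mult_le_cancel_left1)

lemma dominated_other_terms:
  shows "dominated Y (\<lambda>N. real N * (real N * real (col_blocks N)))"
    and "dominated Y (\<lambda>N. real N * real N)" and "dominated Y (\<lambda>N. real N)"
    and "dominated Y (\<lambda>N. real (root N))" and "dominated Y (\<lambda>N. real (copies N))"
    and "dominated Y (\<lambda>N. real (copies N) * real (text_length N))"
    and "dominated Y (\<lambda>N. real (copies N) * tp_bound N)"
proof -
  have b: "0 < real (base N)" for N using base_ge_1[of N] by simp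
  show "dominated Y (\<lambda>N. real N * (real N * real (col_blocks N)))"
  proof (rule dominatedI)
    fix N :: nat assume N: "1 \<le> N"
    \<comment> \<open>The number of column blocks is the padded width divided by
      \<open>g ^ q\<close>, and \<open>q \<ge> 1\<close> saves the required factor.\<close>
    have "real (col_blocks N) = real (col_blocks N) * real (cols N) * real (base N) powr (- real q)"
      unfolding cols_powr using b[of N] by (simp add: mult.assoc powr_add[symmetric])
    also have "\<dots> \<le> ((1 + c1) * real N) * A N powr (- \<theta>)"
      using \<theta>(2) q1 by (intro mult_mono blocks_le[OF N] base_powr_le[OF N]) auto
    finally have "real N * (real N * real (col_blocks N)) \<le> real N * (real N *
      (((1 + c1) * real N) * A N powr (- \<theta>)))"
      by (intro mult_left_mono) auto
    also have "\<dots> = (1 + c1) * Y N" by (simp add: Y_eq[OF N] power3_eq_cube)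
    finally show "real N * (real N * real (col_blocks N)) \<le> (1 + c1) * Y N" .
  qed
  show "dominated Y (\<lambda>N. real N * real N)"
    using power_le_Y[of _ 2] by (intro dominatedI[of _ 1]) (simp add: power2_eq_square)
  show id: "dominated Y (\<lambda>N. real N)"
    using power_le_Y[of _ 1] by (intro dominatedI[of _ 1]) simp
  show "dominated Y (\<lambda>N. real (root N))"
    by (rule dominated_le[OF id]) (use root_bounds(3)[OF D1] in simp)
  have sq: "dominated Y (\<lambda>N. real N ^ 2)"
    using power_le_Y[of _ 2] by (intro dominatedI[of _ 1]) simp
  show "dominated Y (\<lambda>N. real (copies N))"
    by (rule dominated_le[OF dominated_cmult[OF _ sq, of "4 * real Q"]]) (use copies_le in auto)
  show "dominated Y (\<lambda>N. real (copies N) * real (text_length N))"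
  proof (rule dominated_le[OF dominated_cmult[OF _ sq, of "2 * c3"]])
    fix N :: nat assume "1 \<le> N"
    from copies_area_le[OF this] show "real (copies N) * real
      (text_length N) \<le> 2 * c3 * real N ^ 2"
      by (simp add: text_length_def mult_ac)
  qed auto
  let ?c = "C * 2 ^ e * real (2 + G) ^ ((p + q) * e)"
  show "dominated Y (\<lambda>N. real (copies N) * tp_bound N)"
  proof (rule dominatedI)
    fix N :: nat assume N: "1 \<le> N"
    have "real (text_length N) = 2 * real (base N) ^ (p + q)"
      by (simp add: text_length_def rows_def cols_def power_add)
    then have "tp_bound N = C * 2 ^ e * real (base N) ^ ((p + q) * e)"
      by (simp add: tp_bound_def power_mult_distrib power_mult)
    also have "\<dots> \<le> C * 2 ^ e * (real (2 + G) * A N) ^ ((p + q) * e)"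
      using C by (intro mult_left_mono power_mono base_le[OF N]) auto
    also have "\<dots> = ?c * A N ^ ((p + q) * e)" by (simp add: power_mult_distrib)
    also have "\<dots> \<le> ?c * real N powr (1 / 2)"
    proof (rule mult_left_mono)
      \<comment> \<open>Here the size of \<open>D\<close> enters: preprocessing one copy costs the
        order of \<open>N ^ (1 / 2)\<close>, so all of them, \<open>O(N ^ 2)\<close> in number, cost
        \<open>N ^ (5 / 2)\<close>.\<close>
      have "real (2 * ((p + q) * e)) \<le> real D" using De of_nat_le_iff by blast
      then have "real ((p + q) * e) / real D \<le> 1 / 2" using D1 by (simp add: divide_le_eq)
      then show "A N ^ ((p + q) * e) \<le> real N powr (1 / 2)"
        unfolding A_power[OF N] using N by (intro powr_mono) auto
    qed (use C in auto)
    finally have "real (copies N) * tp_bound N \<le> (4 * real Q * real N ^ 2) * (?c * real N powr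
      (1 / 2))"
      using C by (intro mult_mono copies_le[OF N]) (auto simp: tp_bound_def)
    also have "real N ^ 2 = real N powr 2" using N by simp
    also have "(4 * real Q * real N powr 2) * (?c * real N powr (1 / 2)) =
        4 * real Q * ?c * (real N powr 2 * real N powr (1 / 2))"
      by (simp only: mult_ac)
    also have "real N powr 2 * real N powr (1 / 2) = real N powr (5 / 2)"
      unfolding powr_add[symmetric] by simp
    also have "4 * real Q * ?c * real N powr (5 / 2) \<le> 4 * real Q * ?c * Y N"
      using C by (intro mult_left_mono powr_le_Y[OF N]) auto
    finally show "real (copies N) * tp_bound N \<le> 4 * real Q * ?c * Y N" .
  qed
qed

lemma dominated_total:
  assumes "0 \<le> b"
  shows "dominated Y (\<lambda>N. b * (1 + real (root N) + real (copies N) * (1 + real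
    (text_length N) + tp_bound N)
    + real N * (1 + real (copies N) * (1 + real (cols N) * (1 + tu_bound N) + real (rows N) *
      (1 + tq_bound N))
      + real N * (1 + real (col_blocks N)))))"
proof -
  let ?f = "\<lambda>N. 1 + (real (root N) + (real (copies N) + (real (copies N) * real
    (text_length N) + (real (copies N) * tp_bound N
    + (real N + (real N * real (copies N) + (real N * (real (copies N) * real (cols N)) +
     (real N * (real (copies N) * real (cols N) * tu_bound N) + (real N * (real (copies N) * real
       (rows N)) +
     (real N * (real (copies N) * real (rows N) * tq_bound N) + (real N * real N + real N *
       (real N * real (col_blocks N)))))))))))))"
  have "dominated Y ?f"
    by (intro dominated_add dominated_round_terms dominated_other_terms dominated_const) simp
  from dominated_cmult[OF assms this] show ?thesis
    by (rule dominated_le) (simp only: distrib_left mult_1_right add_ac mult_ac order.refl)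
qed

end

section \<open>Time and error of the complete algorithm\<close>

context reduction_run
begin

text \<open>\<open>K\<close> exceeds every constant factor, including the lengths of the two
  programs, and does not depend on \<open>N\<close>.\<close>

lemma total_time_le:
  defines "K \<equiv> 4 * D + 2 * p + 2 * q + 4 * d + 12 * R + 200 * Q + 1000 + length init_prog +
    length round_prog"
  shows "init_time + N * round_time \<le> K * (1 + root N + J * (1 + n + tp) +
    N * (1 + J * (1 + w * (1 + tu) + r * (1 + tq)) + N * (1 + col_blocks N)))"
proof -
  have mult: "a * x \<le> K * (a * y)" if "x \<le> K * y" for a x y
    using mult_le_mono2[OF that, of a] by (simp only: mult_ac)
  have step: "3 * x + 12 * R + 200 \<le> K * (1 + x)" for x
  proof -
    have "3 * x \<le> K * x" by (rule mult_right_mono) (simp_all add: K_def)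
    moreover have "12 * R + 200 \<le> K" by (simp add: K_def)
    ultimately show ?thesis unfolding distrib_left mult_1_right by linarith
  qed
  have "200 * n + 3 * tp + 12 * R + 300 \<le> K * (1 + n + tp)"
  proof -
    have "200 * n \<le> K * n" "3 * tp \<le> K * tp" by (rule mult_right_mono; simp add: K_def)+
    moreover have "12 * R + 300 \<le> K" by (simp add: K_def)
    ultimately show ?thesis unfolding distrib_left mult_1_right by linarith
  qed
  note 1 = mult[OF this, of J]
  have "root N * (4 * D + 30) \<le> root N * K" by (rule mult_le_mono2) (simp add: K_def)
  moreover have "4 * D + 30 + (2 * p + 2 * q + 4 * d + 200) + length init_prog + 1 \<le> K"
    by (simp add: K_def)
  ultimately have init: "init_time \<le> K * (1 + root N + J * (1 + n + tp))"
    using 1 unfolding init_time_def by (simp add: distrib_left distrib_right mult.commute)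
  have "w * (3 * tu + 12 * R + 200) + r * (3 * tq + 12 * R + 200) + 300 \<le>
      K * (w * (1 + tu)) + K * (r * (1 + tq)) + K"
    by (intro add_mono mult step) (simp add: K_def)
  then have "w * (3 * tu + 12 * R + 200) + r * (3 * tq + 12 * R + 200) + 300 \<le>
      K * (1 + w * (1 + tu) + r * (1 + tq))"
    by (simp only: distrib_left mult_1_right add_ac)
  note 2 = mult[OF this, of J]
  have "col_blocks N * (Q * 200 + 200) + 300 \<le> col_blocks N * K + K"
    by (intro add_mono mult_le_mono2) (simp_all add: K_def)
  then have "col_blocks N * (Q * 200 + 200) + 300 \<le> K * (1 + col_blocks N)"
    by (simp only: distrib_left mult_1_right add_ac mult_ac)
  note 3 = mult[OF this, of N]
  have "20 + length round_prog + 1 \<le> K" by (simp add: K_def)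
  then have "round_time \<le> K * (J * (1 + w * (1 + tu) + r * (1 + tq))) + K * (N *
    (1 + col_blocks N)) + K"
    using add_mono[OF 2 3] unfolding round_time_def by linarith
  then have "round_time \<le> K * (1 + J * (1 + w * (1 + tu) + r * (1 + tq)) + N *
    (1 + col_blocks N))"
    by (simp only: distrib_left mult_1_right add_ac)
  note 4 = mult[OF this, of N]
  show ?thesis
    using add_mono[OF init 4] by (simp only: distrib_left[symmetric])
qed

lemma real_total_time_le:
  assumes "real tp \<le> tp'" "real tu \<le> tu'" "real tq \<le> tq'"
  shows "real (init_time + N * round_time) \<le>
    real (4 * D + 2 * p + 2 * q + 4 * d + 12 * R + 200 * Q + 1000 + length init_prog + length
      round_prog) *
    (1 + real (root N) + real J * (1 + real n + tp') +
    real N * (1 + real J * (1 + real w * (1 + tu') + real r * (1 + tq')) + real N * (1 + real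
      (col_blocks N))))"
proof -
  let ?K = "4 * D + 2 * p + 2 * q + 4 * d + 12 * R + 200 * Q + 1000 + length init_prog + length
    round_prog"
  have "real (init_time + N * round_time) \<le> real (?K * (1 + root N + J * (1 + n + tp) +
    N * (1 + J * (1 + w * (1 + tu) + r * (1 + tq)) + N * (1 + col_blocks N))))"
    by (rule of_nat_mono) (rule total_time_le)
  also have "\<dots> = real ?K * (1 + real (root N) + real J * (1 + real n + real tp) +
    real N * (1 + real J * (1 + real w * (1 + real tu) + real r * (1 + real tq)) + real N *
      (1 + real (col_blocks N))))"
    by (simp only: of_nat_mult of_nat_add of_nat_1)
  also have "\<dots> \<le> real ?K * (1 + real (root N) + real J * (1 + real n + tp') +
    real N * (1 + real J * (1 + real w * (1 + tu') + real r * (1 + tq')) + real N * (1 + real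
      (col_blocks N))))"
    by (intro mult_left_mono add_mono order.refl assms of_nat_0_le_iff)
  finally show ?thesis .
qed

lemma length_correct_answers:
  assumes "m \<le> k"
  shows "length (correct_answers k (block_text N M j) (zero_pattern N) (concat
    (all_ops vs j))) = length vs * r"
  unfolding correct_answers_all_ops[OF assms even_zero_zero_pattern] by (induction vs) auto

lemma valid_all_ops:
  assumes "2 \<le> s"
  shows "list_all (valid_operation s n m) (concat (all_ops vs j))"
proof -
  have "i * m \<le> n - m" if "i < r" for i
  proof -
    have "(i + 1) * m \<le> r * m" using that by (intro mult_right_mono) auto
    also have "r * m = n" by (simp add: text_length_def pattern_length_def)
    finally show ?thesis by simp
  qed
  moreover have "2 * l + 1 < m" if "l < w" for l using that by (simp add: pattern_length_def)
  ultimately show ?thesis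
    using assms by (induction vs) (auto simp: all_ops_def block_ops_def list_all_iff)
qed

lemma block_text_chars: "2 \<le> s \<Longrightarrow>
  set (block_text N M j) \<subseteq> {..<s}" "2 \<le> s \<Longrightarrow>
  set (zero_pattern N) \<subseteq> {..<s}"
  by (auto simp: block_text_def zero_pattern_def)

lemma length_ratio: "real n / real m = real r"
  using pos by (simp add: text_length_def pattern_length_def)

text \<open>There are at most \<open>2 * N ^ 3\<close>, hence at most
  \<open>2 * g ^ (3 * D)\<close>, events, and \<open>n \<ge> g\<close> bounds
  \<open>(1 / n) ^ h\<close> by \<open>g ^ (- 3 * D - 1)\<close>. So the choice of \<open>h\<close>
  leaves one factor \<open>1 / g\<close>, and \<open>G\<close> makes \<open>2 * 2 ^ Q / g\<close> at
  most \<open>1 / 3\<close>.\<close>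

lemma failure_le:
  assumes D: "h = 3 * D + 1" and G: "G = 6 * 2 ^ Q" and p: "1 \<le> p"
  shows "real (N * N * col_blocks N) * (2 ^ Q * (1 / real n) ^ h) \<le> 1 / 3"
proof -
  let ?g = "real (base N)"
  have "real G \<le> ?g" by (simp add: base_def)
  then have g: "0 < ?g" "6 * 2 ^ Q \<le> ?g" using base_pos by (simp_all add: G)
  have "real N \<le> real (root N ^ D)" using root by (rule of_nat_mono)
  also have "\<dots> \<le> ?g ^ D" by (simp add: base_def power_mono)
  finally have "real N ^ 3 \<le> (?g ^ D) ^ 3" by (rule power_mono) simp
  also have "(?g ^ D) ^ 3 = ?g ^ (3 * D)" by (simp flip: power_mult add: mult.commute)
  finally have N3: "real N ^ 3 \<le> ?g ^ (3 * D)" .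
  have "col_blocks N \<le> 2 * N"
    using N div_le_dividend[of N w] unfolding col_blocks_def by linarith
  then have "N * N * col_blocks N \<le> N * N * (2 * N)" by (rule mult_le_mono2)
  then have "real (N * N * col_blocks N) \<le> real (N * N * (2 * N))" by (rule of_nat_mono)
  also have "\<dots> = 2 * real N ^ 3" by (simp add: power3_eq_cube)
  finally have cnt: "real (N * N * col_blocks N) \<le> 2 * ?g ^ (3 * D)" using N3 by simp
  have "base N \<le> r" using self_le_power[of "base N" p] base_pos p by (simp add: rows_def)
  also have "r \<le> n" using pos by (simp add: text_length_def)
  finally have "1 / real n \<le> 1 / ?g" using g by (simp add: frac_le)
  then have "(1 / real n) ^ h \<le> (1 / ?g) ^ h" by (rule power_mono) simp
  then have "real (N * N * col_blocks N) * (2 ^ Q * (1 / real n) ^ h) \<le>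
      (2 * ?g ^ (3 * D)) * (2 ^ Q * (1 / ?g) ^ h)"
    by (intro mult_mono cnt mult_left_mono) auto
  also have "\<dots> = 2 * 2 ^ Q / ?g" using g(1) by (simp add: D power_one_over field_simps)
  also have "\<dots> \<le> 1 / 3" using g by (simp add: field_simps)
  finally show ?thesis .
qed

end

section \<open>Choice of the constants\<close>

theorem theorem27:
  fixes \<gamma> \<epsilon> :: real and \<sigma> :: "nat \<Rightarrow> nat"
  assumes "\<gamma> > 0" and "\<epsilon> > 0" and "\<And>n. \<sigma> n \<ge> 2"
    and "dynamic_k_mismatch_ds \<sigma> \<gamma> \<epsilon>"
  shows "\<not> OMv_conjecture"
proof -
  \<comment> \<open>The error exponent is fixed to 1, so that \<open>e\<close> is known before the
    number of copies is chosen.\<close>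
  obtain pre upd qry C d e where ds: "\<And>n m T P ops. 1 \<le> m \<Longrightarrow>
    m \<le> n \<Longrightarrow> length T = n \<Longrightarrow>
        set T \<subseteq> {..<\<sigma> n} \<Longrightarrow> length P = m \<Longrightarrow>
          set P \<subseteq> {..<\<sigma> n} \<Longrightarrow>
        list_all (valid_operation (\<sigma> n) n m) ops \<Longrightarrow>
        (let k = threshold \<gamma> n m;
             W = (n + 2) ^ d;
             tp = nat \<lfloor>C * real n ^ e\<rfloor>;
             tu = nat \<lfloor>C * (real n / real m) powr (1 - \<epsilon>)\<rfloor>;
             tq = nat \<lfloor>C * real k powr (1 - \<epsilon>)\<rfloor>;
             answers = run_ds W tp tu tq pre upd qry T P ops;
             correct = correct_answers k T P ops
         in \<sigma> n \<le> W \<and> lossless_spmf answers \<and>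
            (\<forall>j < length correct.
               measure (measure_spmf answers) {as. as ! j = correct ! j} \<ge> 1 - 1 / real n ^ 1))"
    using assms(4)[unfolded dynamic_k_mismatch_ds_def, rule_format, of 1] by metis
  \<comment> \<open>Characters are words, and already texts of length 1 have two of them available,
    so the word bound cannot be 1.\<close>
  have d: "1 \<le> d"
  proof (rule ccontr)
    assume "\<not> 1 \<le> d"
    then have "d = 0" by simp
    then have "\<sigma> 1 \<le> 1"
      using ds[of 1 1 "[0]" "[0]" "[]"] assms(3)[of 1] by (simp add: Let_def)
    then show False using assms(3)[of 1] by simp
  qed
  obtain R1 R2 R3 where "regs_below R1 pre" "regs_below R2 upd" "regs_below R3 qry"
    using ex_regs_below by metis
  then obtain R where R: "2 \<le> R" "regs_below R pre" "regs_below R upd" "regs_below R qry"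
    by (meson regs_below_mono le_add1 le_add2 order.trans that[of "R1 + R2 + R3 + 2"])
  \<comment> \<open>Capping \<open>\<epsilon>\<close> at \<open>1 / 2\<close> keeps
    \<open>\<alpha>\<close> positive, so that an upper bound for \<open>k\<close> yields one for
    \<open>k powr \<alpha>\<close>.\<close>
  define \<alpha> where "\<alpha> = 1 - min \<epsilon> (1 / 2)"
  have \<alpha>: "1 - \<epsilon> \<le> \<alpha>" "0 < \<alpha>" "\<alpha> < 1" using assms(2)
    by (auto simp: \<alpha>_def)
  \<comment> \<open>Makes the interval from \<open>\<gamma> * \<alpha> * p\<close> to
    \<open>\<gamma> * p\<close> at least 1 long, so that rounding its upper end down gives an
    integer \<open>q\<close> above the lower end.\<close>
  define p where "p = nat \<lceil>1 / (\<gamma> * (1 - \<alpha>))\<rceil>"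
  have \<gamma>\<alpha>: "0 < \<gamma> * (1 - \<alpha>)" using assms(1) \<alpha> by simp
  have pr: "1 / (\<gamma> * (1 - \<alpha>)) \<le> real p" unfolding p_def
    by (rule real_nat_ceiling_ge)
  have p1: "1 \<le> p" using less_le_trans[OF _ pr, of 0] \<gamma>\<alpha> by simp
  define q where "q = nat \<lfloor>\<gamma> * real p\<rfloor>"
  have q: "real q \<le> \<gamma> * real p" "\<gamma> * real p - 1 < real q"
    using assms(1) by (auto simp: q_def)
  have "1 \<le> real p * (\<gamma> * (1 - \<alpha>))" using pr \<gamma>\<alpha>
    by (simp add: divide_le_eq)
  then have gap: "\<gamma> * \<alpha> * real p < real q" using q(2) by (simp add: algebra_simps)
  moreover have "0 \<le> \<gamma> * \<alpha> * real p" using assms(1) \<alpha> by simp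
  ultimately have q1: "1 \<le> q" by (cases q) auto
  define \<theta> where "\<theta> = min (1 / 2) (min (real p * (1 - \<alpha>))
    (real q - \<gamma> * \<alpha> * real p))"
  have "0 < real p * (1 - \<alpha>)" using p1 \<alpha> by simp
  then have \<theta>: "0 < \<theta>" "\<theta> \<le> 1 / 2" "\<theta> \<le> real p *
    (1 - \<alpha>)" "\<theta> \<le> real q - \<gamma> * \<alpha> * real p"
    using gap unfolding \<theta>_def by linarith+
  \<comment> \<open>The summands \<open>p\<close> and \<open>q\<close> keep block sides of order
    \<open>N\<close>, the last one keeps preprocessing cheap.\<close>
  define D where "D = p + q + 2 * ((p + q) * e)"
  \<comment> \<open>Nothing is circular here: \<open>e\<close> determines \<open>D\<close>, then
    \<open>h\<close>, \<open>Q\<close> and \<open>G\<close> follow, and none of these enters the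
    data structure.\<close>
  define h where "h = 3 * D + 1"
  define Q where "Q = 2 * h - 1"
  define G :: nat where "G = 6 * 2 ^ Q"
  have DGQ: "1 \<le> D" "1 \<le> G" "1 \<le> Q" "0 < Q" using p1
    by (auto simp: D_def G_def Q_def h_def)
  interpret reduction pre upd qry d R D p q G Q .
  \<comment> \<open>\<open>C\<close> may be negative; the budgets are then 0 and still bounded
    through \<open>max C 0\<close>.\<close>
  interpret rb: reduction_bounds pre upd qry d R D p q G Q \<alpha> \<gamma> "max C 0" \<theta> e
    by unfold_locales (use p1 q1 \<theta> DGQ in \<open>auto simp: D_def\<close>)
  obtain dw where dw: "\<And>N. (max_value N + 2) ^ max_deg < (N + 2) ^ dw"
    using ex_word_bound[OF DGQ(1)] by blast
  let ?K = "4 * D + 2 * p + 2 * q + 4 * d + 12 * R + 200 * Q + 1000 + length init_prog + length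
    round_prog"
  from rb.dominated_total[of "real ?K"] obtain c where c: "\<And>N. 1 \<le> N \<Longrightarrow>
     real ?K * (1 + real (root N) + real (copies N) * (1 + real (text_length N) + rb.tp_bound N)
    + real N * (1 + real (copies N) * (1 + real (cols N) * (1 + rb.tu_bound N) + real (rows N) *
      (1 + rb.tq_bound N))
      + real N * (1 + real (col_blocks N)))) \<le> c * rb.Y N"
    unfolding dominated_def by (meson of_nat_0_le_iff)
  have "omv_solvable (\<theta> / real D)"
    unfolding omv_solvable_def
  proof (intro exI allI impI)
    fix N M and vs :: "(nat \<Rightarrow> bool) list" assume N: "1 \<le> N" and len: "length vs = N"
    let ?n = "text_length N" and ?m = "pattern_length N"
    define k where "k = threshold \<gamma> ?n ?m"
    define tp where "tp = nat \<lfloor>C * real ?n ^ e\<rfloor>"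
    define tu where "tu = nat \<lfloor>C * (real ?n / real ?m) powr (1 - \<epsilon>)\<rfloor>"
    define tq where "tq = nat \<lfloor>C * real k powr (1 - \<epsilon>)\<rfloor>"
    define t where "t = nat \<lfloor>c * real N powr (3 - \<theta> / real D)\<rfloor>"
    interpret rr: reduction_run pre upd qry d R D p q G Q N "(N + 2) ^ dw" tp tu tq
      by unfold_locales (use d R DGQ N dw in auto)
    have r1: "1 \<le> real (rows N)" using rr.pos(1) by simp
    have rf: "real (nat \<lfloor>\<gamma>'\<rfloor>) \<le> max \<gamma>' 0" for \<gamma>' :: real
      by linarith
    have Cmax: "max (C * x) 0 = max C 0 * x" if "0 \<le> x" for x
      using that by (simp add: max_def mult_le_0_iff zero_le_mult_iff)
    have tp_le: "real tp \<le> rb.tp_bound N"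
      using rf[of "C * real ?n ^ e"] by (simp add: tp_def rb.tp_bound_def Cmax)
    have "real tu \<le> max C 0 * real (rows N) powr (1 - \<epsilon>)"
      using rf[of "C * real (rows N) powr (1 - \<epsilon>)"]
        by (simp add: tu_def rr.length_ratio Cmax)
    also have "\<dots> \<le> rb.tu_bound N"
      unfolding rb.tu_bound_def using r1 \<alpha> by (intro mult_left_mono powr_mono) auto
    finally have tu_le: "real tu \<le> rb.tu_bound N" .
    have rg: "1 \<le> real (rows N) powr \<gamma>" using r1 assms(1)
      by (simp add: ge_one_powr_ge_zero)
    have k_eq: "k = 2 * nat \<lfloor>real (rows N) powr \<gamma>\<rfloor>"
      by (simp add: k_def threshold_def rr.length_ratio)
    have k_ge: "1 \<le> real k" and k_le: "real k \<le> 2 * real (rows N) powr \<gamma>"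
    proof -
      have "1 \<le> nat \<lfloor>real (rows N) powr \<gamma>\<rfloor>" by (rule le_nat_floor)
        (use rg in simp)
      moreover have "real (nat \<lfloor>real (rows N) powr \<gamma>\<rfloor>) \<le> real
        (rows N) powr \<gamma>" by (rule of_nat_floor) simp
      ultimately show "1 \<le> real k" "real k \<le> 2 * real
        (rows N) powr \<gamma>" unfolding k_eq by simp_all
    qed
    have "real tq \<le> max C 0 * real k powr (1 - \<epsilon>)"
      using rf[of "C * real k powr (1 - \<epsilon>)"] by (simp add: tq_def Cmax)
    \<comment> \<open>\<open>k \<ge> 1\<close> permits passing to the larger exponent
      \<open>\<alpha>\<close>, and positivity of \<open>\<alpha>\<close> inserting the upper bound
      for \<open>k\<close>.\<close>
    also have "\<dots> \<le> max C 0 * (2 * real (rows N) powr (\<gamma> * \<alpha>))"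
    proof (rule mult_left_mono)
      have "real k powr (1 - \<epsilon>) \<le> real k powr \<alpha>" using k_ge \<alpha>
        by (intro powr_mono) auto
      also have "\<dots> \<le> (2 * real (rows N) powr \<gamma>) powr \<alpha>"
        using k_le \<alpha> by (intro powr_mono2) auto
      also have "\<dots> = 2 powr \<alpha> * real (rows N) powr (\<gamma> * \<alpha>)"
        by (simp add: powr_mult powr_powr)
      also have "2 powr \<alpha> \<le> (2 powr 1 :: real)" using \<alpha> by (intro powr_mono) auto
      finally show "real k powr (1 - \<epsilon>) \<le> 2 * real (rows N) powr (\<gamma> * \<alpha>)"
        by (simp add: mult_right_mono)
    qed simp
    finally have tq_le: "real tq \<le> rb.tq_bound N" by (simp add: rb.tq_bound_def)
    have "real (rr.init_time + N * rr.round_time) \<le> c * rb.Y N"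
      by (rule order.trans[OF rr.real_total_time_le[OF tp_le tu_le tq_le] c[OF N]])
    then have time: "rr.init_time + N * rr.round_time \<le> t"
      unfolding t_def rb.Y_def by (rule le_nat_floor)
    \<comment> \<open>Two letters per coordinate match the factor 2 of the threshold:
      \<open>w\<close> is an integer not above \<open>r ^ \<gamma>\<close>, hence at most its
      floor.\<close>
    have mk: "?m \<le> k"
    proof -
      have "real (cols N) = real (base N) powr real q" by (rule rb.cols_powr)
      also have "\<dots> \<le> real (base N) powr (\<gamma> * real p)"
        using rb.base_ge_1[of N] q(1) by (intro powr_mono) auto
      also have "\<dots> = real (rows N) powr \<gamma>" by (simp add: rb.rows_powr mult.commute)
      finally have "cols N \<le> nat \<lfloor>real (rows N) powr \<gamma>\<rfloor>"
        by (rule le_nat_floor)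
      then show ?thesis by (simp add: k_eq pattern_length_def)
    qed
    have run: "lossless_spmf (run_ds ((?n + 2) ^ d) tp tu tq pre upd qry (block_text N M j)
      (zero_pattern N)
        (concat (rr.all_ops vs j))) \<and>
      (\<forall>i < length (correct_answers k (block_text N M j) (zero_pattern N) (concat
        (rr.all_ops vs j))).
        measure (measure_spmf (run_ds ((?n + 2) ^ d) tp tu tq pre upd qry (block_text N M j)
          (zero_pattern N)
        (concat (rr.all_ops vs j)))) {as. as ! i = correct_answers k (block_text N M j)
          (zero_pattern N)
          (concat (rr.all_ops vs j)) ! i} \<ge> 1 - 1 / real ?n ^ 1)" for j
    proof -
      have "1 \<le> ?m" "?m \<le> ?n" using rr.pos rr.m_le_n by auto
      from ds[OF this _ rr.block_text_chars(1)[OF assms(3)] _ rr.block_text_chars(2)[OF assms(3)]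
          rr.valid_all_ops[OF assms(3)], of M j vs j]
      show ?thesis unfolding Let_def tp_def tu_def tq_def k_def by (simp add: zero_pattern_def)
    qed
    note success = rr.run_omv_success[OF len Q_def mk _ time, of "1 / real ?n" M]
    have ll: "lossless_spmf (run_omv ((N + 2) ^ dw) t (block init_prog) (block round_prog) N M vs)"
      by (rule success(1)) (use run in \<open>auto simp: rr.length_correct_answers[OF mk]
        len\<close>)
    have "1 - real (N * N * col_blocks N) * (2 ^ Q * (1 / real ?n) ^ h) \<le>
      measure (measure_spmf (run_omv ((N + 2) ^ dw) t (block init_prog) (block round_prog) N M vs))
      {map (\<lambda>v. map of_bool (bool_mat_vec N M v)) vs}"
      by (rule success(2)) (use run in \<open>auto simp: rr.length_correct_answers[OF mk]
        len\<close>)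
    then have "2 / 3 \<le> measure (measure_spmf (run_omv ((N + 2) ^ dw) t (block init_prog)
      (block round_prog) N M vs))
      {map (\<lambda>v. map of_bool (bool_mat_vec N M v)) vs}"
      using rr.failure_le[OF h_def G_def p1] by linarith
    with ll show "let outputs = run_omv ((N + 2) ^ dw) (nat \<lfloor>c * real N powr
      (3 - \<theta> / real D)\<rfloor>) (block init_prog)
          (block round_prog) N M vs
      in lossless_spmf outputs \<and> 2 / 3 \<le> measure (measure_spmf outputs)
        {map (\<lambda>v. map of_bool (bool_mat_vec N M v)) vs}"
      unfolding Let_def t_def by blast
  qed
  moreover have "0 < \<theta> / real D" using \<theta>(1) DGQ(1) by simp
  ultimately show ?thesis unfolding OMv_conjecture_def by blast
qed

end
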